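(* Assume that for all integers $n,d\geq 2$ and all primes $p>n$ one has $C_{n,d}\leq n^2$ over infinite fields of characteristic $p$. Then for all integers $n,d\geq 2$ and every infinite field of characteristic $p$ with $\frac{n}{2}<p\leq n$, $$C_{n,d}<n^2 \ln(n)\, d.$$
   Context: Let $\mathbb{F}$ be an infinite field of characteristic $p\geq 0$. Let $\mathcal{M}=\mathcal{M}(x_1,\ldots,x_d)$ be the free semigroup (without unity) generated by letters $x_1,\ldots,x_d$, and let $\mathcal{M}_{\mathbb{F}}$ be the vector space over $\mathbb{F}$ with basis $\mathcal{M}$, i.e. the free associative non-unital $\mathbb{F}$-algebra on $x_1,\ldots,x_d$. For $n\geq 1$ let $N_{n,d}=\mathcal{M}_{\mathbb{F}}/I_n$, where $I_n$ is the two-sided ideal of $\mathcal{M}_{\mathbb{F}}$ generated by all $f^n$, $f\in\mathcal{M}_{\mathbb{F}}$ (the relatively free algebra with identity $x^n=0$). The nilpotency degree is $C_{n,d}=\min\{c>0 \mid a_1\cdots a_c=0 \text{ for all } a_1,\ldots,a_c\in N_{n,d}\}$. It depends only on $n$, $d$ and $p$. *)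

theory Defs
  imports Complex_Main "HOL-Algebra.Module" "HOL-Algebra.QuotRing" "HOL-Algebra.Multiplicative_Group"
    "HOL-Computational_Algebra.Primes" "HOL-Library.Extended_Real"
begin

text \<open>The characteristic of a ring is the additive order of its unit element;
  \<^const>\<open>group.ord\<close> is 0 for elements of infinite order, which gives characteristic 0.\<close>

definition ring_char :: "('a, 'b) ring_scheme \<Rightarrow> nat" where
  "ring_char R = group.ord (add_monoid R) \<one>\<^bsub>R\<^esub>"

text \<open>The free semigroup without unit on the letters \<open>x\<^sub>1, \<dots>, x\<^sub>d\<close>: the letter \<open>x\<^sub>i\<close> is
  represented by the number \<open>i\<close>, the product is concatenation of words.\<close>

definition free_semigroup :: "nat \<Rightarrow> nat list set" where
  "free_semigroup d = {w. w \<noteq> [] \<and> set w \<subseteq> {1..d}}"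

text \<open>The free non-unital algebra over \<open>F\<close>: formal linear combinations of words, i.e. finitely
  supported coefficient functions.  The record type of \<^theory>\<open>HOL-Algebra.Module\<close> has
  a field \<^const>\<open>monoid.one\<close>; the algebra has no unit, so this field carries no meaning and is left
  unspecified.  In particular the locale \<^locale>\<open>ring\<close> and the operation \<^const>\<open>pow\<close>,
  which refer to the unit, do not apply to this structure.\<close>

definition free_nonunital_algebra ::
    "('a, 'b) ring_scheme \<Rightarrow> nat \<Rightarrow> ('a, nat list \<Rightarrow> 'a) module" where
  "free_nonunital_algebra F d =
    \<lparr>carrier = {f. (\<forall>w. f w \<in> carrier F) \<and> finite {w. f w \<noteq> \<zero>\<^bsub>F\<^esub>}
                   \<and> {w. f w \<noteq> \<zero>\<^bsub>F\<^esub>} \<subseteq> free_semigroup d},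
     monoid.mult = (\<lambda>f g w. finsum F (\<lambda>(u, v). f u \<otimes>\<^bsub>F\<^esub> g v)
               {(u, v). u \<in> free_semigroup d \<and> v \<in> free_semigroup d \<and> u @ v = w}),
     monoid.one = undefined,
     ring.zero = (\<lambda>w. \<zero>\<^bsub>F\<^esub>),
     ring.add = (\<lambda>f g w. f w \<oplus>\<^bsub>F\<^esub> g w),
     module.smult = (\<lambda>c f w. c \<otimes>\<^bsub>F\<^esub> f w)\<rparr>"

text \<open>The product \<open>a\<^sub>1 \<cdots> a\<^sub>c\<close> of a nonempty list and the power \<open>f\<^sup>n\<close> for \<open>n \<ge> 1\<close>,
  defined without reference to a unit.\<close>

fun nonempty_prod :: "('a, 'b) monoid_scheme \<Rightarrow> 'a list \<Rightarrow> 'a" where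
  "nonempty_prod A [] = undefined"
| "nonempty_prod A (a # as) = foldl (monoid.mult A) a as"

definition pos_pow :: "('a, 'b) monoid_scheme \<Rightarrow> 'a \<Rightarrow> nat \<Rightarrow> 'a" where
  "pos_pow A f n = nonempty_prod A (replicate n f)"

text \<open>Two-sided ideals of a possibly non-unital algebra are required to be subspaces; without a
  unit, closure under scalar multiplication is not automatic.\<close>

definition algebra_ideal ::
    "('a, 'b) ring_scheme \<Rightarrow> ('a, 'm, 'c) module_scheme \<Rightarrow> 'm set \<Rightarrow> bool" where
  "algebra_ideal F A I \<longleftrightarrow> submodule I F A \<and>
     (\<forall>x\<in>I. \<forall>a\<in>carrier A. a \<otimes>\<^bsub>A\<^esub> x \<in> I \<and> x \<otimes>\<^bsub>A\<^esub> a \<in> I)"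

definition generated_algebra_ideal ::
    "('a, 'b) ring_scheme \<Rightarrow> ('a, 'm, 'c) module_scheme \<Rightarrow> 'm set \<Rightarrow> 'm set" where
  "generated_algebra_ideal F A S = \<Inter>{I. algebra_ideal F A I \<and> S \<subseteq> I}"

definition nil_ideal :: "('a, 'b) ring_scheme \<Rightarrow> nat \<Rightarrow> nat \<Rightarrow> (nat list \<Rightarrow> 'a) set" where
  "nil_ideal F n d =
     generated_algebra_ideal F (free_nonunital_algebra F d)
       {pos_pow (free_nonunital_algebra F d) f n | f. f \<in> carrier (free_nonunital_algebra F d)}"

text \<open>The relatively free algebra with identity \<open>x\<^sup>n = 0\<close>.  The factor ring construction of
  the library uses the unit only to fill the \<^const>\<open>monoid.one\<close> field of its result.\<close>

definition rel_free_nil_algebra ::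
    "('a, 'b) ring_scheme \<Rightarrow> nat \<Rightarrow> nat \<Rightarrow> (nat list \<Rightarrow> 'a) set ring" where
  "rel_free_nil_algebra F n d = free_nonunital_algebra F d Quot nil_ideal F n d"

text \<open>The values are extended natural numbers so that the minimum of the empty set, i.e. the case
  of an algebra that is not nilpotent, is \<open>\<infinity>\<close>.\<close>

definition nilpotency_degree :: "('a, 'b) ring_scheme \<Rightarrow> enat" where
  "nilpotency_degree A =
     Inf {enat c | c. c > 0 \<and>
       (\<forall>as. length as = c \<and> set as \<subseteq> carrier A \<longrightarrow> nonempty_prod A as = \<zero>\<^bsub>A\<^esub>)}"

definition C_deg :: "('a, 'b) ring_scheme \<Rightarrow> nat \<Rightarrow> nat \<Rightarrow> enat" where
  "C_deg F n d = nilpotency_degree (rel_free_nil_algebra F n d)"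

end

theory Submission
  imports Defs
begin

text \<open>Fix a letter \<open>a\<close>, an exponent \<open>j \<ge> 1\<close> with \<open>j < n\<close>, and put \<open>k = n div (j + 1)\<close>, so that
  \<open>n = k (j + 1) + r\<close> with \<open>r \<le> j\<close>.  Over an infinite field the part of \<open>(a + g)\<^sup>n\<close> of degree \<open>k\<close>
  in \<open>g\<close> lies in the nil ideal; multiplied by \<open>a\<^sup>j\<^sup>-\<^sup>r\<close> from the left, it is \<open>a\<^sup>j (g a\<^sup>j)\<^sup>k\<close> plus products of
  the same degree in which the exponents of \<open>a\<close> are not all equal to \<open>j\<close>.  Modulo such products the
  elements \<open>u a\<^sup>j\<close>, prefixed by \<open>a\<^sup>j\<close>, therefore satisfy the identity \<open>x\<^sup>k = 0\<close>.  Since \<open>2 k \<le> n < 2 p\<close>,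
  the assumption on large characteristic applies to \<open>k\<close>: a word with more than \<open>k\<^sup>2\<close> maximal runs
  \<open>a\<^sup>j\<close> is a combination of words with the same letters whose sum of squared run lengths is larger,
  because \<open>\<Sum> e\<^sub>i\<^sup>2\<close> for a fixed value of \<open>\<Sum> e\<^sub>i\<close> is minimal exactly when all \<open>e\<^sub>i\<close> are equal.  Iterating this,
  only words with at most \<open>(n div (j + 1))\<^sup>2\<close> runs \<open>a\<^sup>j\<close> for every letter and every \<open>j < n\<close> survive, whence
  \<open>C\<^sub>n\<^sub>,\<^sub>d \<le> 1 + d \<Sum>\<^sub>j j (n div (j + 1))\<^sup>2\<close>, and \<open>\<Sum>\<^sub>j j / (j + 1)\<^sup>2 \<le> ln n - 1/4\<close>.\<close>

section \<open>Words with equal gaps\<close>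

text \<open>The hypothesis on large characteristic is consumed only as the membership of one product
  of distinct letters, \<open>[1..<Suc c]\<close> with \<open>c \<le> k^2\<close>, in a nil ideal of
  degree \<open>k\<close>. This membership is transported along the linear extension of
  \<open>pad\<close>, which is not multiplicative. Transport works because \<open>pad\<close> turns
  multiplication by a word into prepending an \<open>lpad\<close> or appending an
  \<open>rpad\<close>, and both keep uneven words uneven. The error terms span a mere subspace,
  which is why linear maps induced by maps of words take the place of homomorphisms.

  Errors are useful only if they use the same letters as the original word. Components of given
  degree in each letter can be separated only while the factors are distinct free letters; actual
  words are therefore substituted afterwards. Unevenness fixes the number of letters
  \<open>a\<close>, so an error has the length of the original word, and the sum of squares, bounded
  in terms of the length, can grow only finitely often.

  The slack \<open>1/4\<close> in the logarithmic estimate is there to absorb the summand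
  \<open>1\<close> of the degree bound and to make the final inequality strict.\<close>

text \<open>The letter \<open>a\<close> is represented by \<open>Suc D\<close>; the letters \<open>1, \<dots>, D\<close> stand for arbitrary words.  A word is
  uneven if its letters \<open>a\<close> number \<open>j\<close> per gap, the two outer gaps included, without being
  distributed evenly.\<close>

definition pad :: "nat \<Rightarrow> nat \<Rightarrow> nat list \<Rightarrow> nat list" where
  "pad j D w = replicate j (Suc D) @ concat (map (\<lambda>i. i # replicate j (Suc D)) w)"

definition uneven :: "nat \<Rightarrow> nat \<Rightarrow> nat list \<Rightarrow> bool" where
  "uneven j D z \<longleftrightarrow> count_list z (Suc D) = j * Suc (length (filter (\<lambda>x. x \<noteq> Suc D) z)) \<and>
     z \<noteq> pad j D (filter (\<lambda>x. x \<noteq> Suc D) z)"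

text \<open>The two one-sided companions of \<open>pad\<close>: a word placed in front of
  \<open>w\<close> becomes an \<open>lpad\<close> in front of \<open>pad j D w\<close>, a word
  placed behind it becomes an \<open>rpad\<close> behind. This makes it possible to pull ideals back
  along \<open>pad\<close>.\<close>

definition lpad :: "nat \<Rightarrow> nat \<Rightarrow> nat list \<Rightarrow> nat list" where
  "lpad j D w = concat (map (\<lambda>i. replicate j (Suc D) @ [i]) w)"

definition rpad :: "nat \<Rightarrow> nat \<Rightarrow> nat list \<Rightarrow> nat list" where
  "rpad j D w = concat (map (\<lambda>i. i # replicate j (Suc D)) w)"

text \<open>For a nonempty word without \<open>a\<close> this is \<open>pad j D w\<close> stripped
  of its two outer runs. It neither begins nor ends with \<open>a\<close>, so the letters
  \<open>a\<close> between two consecutive cores come from separate factors \<open>a\<close>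
  only.\<close>

definition core :: "nat \<Rightarrow> nat \<Rightarrow> nat list \<Rightarrow> nat list" where
  "core j D w = hd w # lpad j D (tl w)"

lemma pad_lpad: "pad j D (u @ v) = lpad j D u @ pad j D v"
  by (induction u) (auto simp: pad_def lpad_def)

lemma pad_rpad: "pad j D (u @ v) = pad j D u @ rpad j D v"
  by (simp add: pad_def rpad_def)

lemma pad_core:
  assumes "w \<noteq> []"
  shows "pad j D (w @ v) = replicate j (Suc D) @ core j D w @ pad j D v"
proof -
  obtain i u where w: "w = i # u" using assms by (cases w) auto
  have "pad j D (w @ v) = lpad j D w @ pad j D v" by (rule pad_lpad)
  also have "lpad j D w = replicate j (Suc D) @ core j D w" by (simp add: w lpad_def core_def)
  finally show ?thesis by simp
qed

lemma count_pad_parts: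
  assumes "Suc D \<notin> set u"
  shows "count_list (lpad j D u) (Suc D) = j * length u" "count_list (rpad j D u) (Suc D) = j * length u"
    and "filter (\<lambda>x. x \<noteq> Suc D) (lpad j D u) = u" "filter (\<lambda>x. x \<noteq> Suc D) (rpad j D u) = u"
proof -
  have c: "count_list (replicate m x) x = m" for m and x :: nat by (induction m) auto
  show "count_list (lpad j D u) (Suc D) = j * length u" "count_list (rpad j D u) (Suc D) = j * length u"
    "filter (\<lambda>x. x \<noteq> Suc D) (lpad j D u) = u" "filter (\<lambda>x. x \<noteq> Suc D) (rpad j D u) = u"
    using assms by (induction u) (auto simp: lpad_def rpad_def c)
qed

lemma uneven_lpad: "uneven j D z \<Longrightarrow> Suc D \<notin> set u \<Longrightarrow> uneven j D (lpad j D u @ z)"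
  by (auto simp: uneven_def count_pad_parts pad_lpad algebra_simps)

lemma uneven_rpad: "uneven j D z \<Longrightarrow> Suc D \<notin> set u \<Longrightarrow> uneven j D (z @ rpad j D u)"
  by (auto simp: uneven_def count_pad_parts pad_rpad algebra_simps)

text \<open>A factor of a monomial of \<open>(a + g)\<^sup>n\<close> is \<open>None\<close> for the summand \<open>a\<close>, and \<open>Some w\<close> for the monomial
  of \<open>g\<close> that arises from \<open>pad j D w\<close> by cancelling the outer powers of \<open>a\<close>.\<close>

fun emb :: "nat \<Rightarrow> nat \<Rightarrow> nat list option \<Rightarrow> nat list" where
  "emb j D None = [Suc D]"
| "emb j D (Some w) = core j D w"

abbreviation somes :: "'b option list \<Rightarrow> 'b list" where
  "somes \<equiv> List.map_filter (\<lambda>x. x)"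

text \<open>The arrangement \<open>a^r g a^j g a^j ... g a^j\<close> of the factors, which becomes
  evenly distributed once \<open>a^(j - r)\<close> is multiplied from the left.\<close>

definition spaced :: "nat \<Rightarrow> nat \<Rightarrow> 'b list \<Rightarrow> 'b option list" where
  "spaced j r ss = replicate r None @ concat (map (\<lambda>s. Some s # replicate j None) ss)"

lemma replicate_append_Cons_eq:
  assumes "x \<noteq> a" "y \<noteq> a" "replicate e a @ x # xs = replicate j a @ y # ys"
  shows "e = j \<and> x # xs = y # ys"
  using assms(3)
proof (induction e arbitrary: j)
  case 0
  then show ?case using assms(1) by (cases j) auto
next
  case (Suc e)
  then show ?case using assms(2) by (cases j) auto
qed

text \<open>Here \<open>e\<close> counts the letters \<open>a\<close> read since the last other
  letter. A factor \<open>None\<close> increases it by one; a factor \<open>Some s\<close> forces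
  \<open>e = j\<close> and resets it to 0, because cores neither begin nor end with
  \<open>a\<close>. So an evenly distributed word determines where the factors \<open>a\<close>
  stand.\<close>

lemma emb_eq_pad:
  assumes "\<And>w. Some w \<in> set xs \<Longrightarrow> w \<noteq> [] \<and> Suc D \<notin> set w"
    and "replicate e (Suc D) @ concat (map (emb j D) xs) = pad j D (concat (somes xs))"
  shows "e \<le> j \<and> xs = spaced j (j - e) (somes xs)"
  using assms
proof (induction xs arbitrary: e)
  case Nil
  then have "length (replicate e (Suc D)) = length (replicate j (Suc D))"
    by (simp only: pad_def) (simp add: map_filter_simps)
  then show ?case by (simp add: spaced_def map_filter_simps)
next
  case (Cons x xs)
  show ?case
  proof (cases x)
    case None
    have "replicate (Suc e) (Suc D) @ concat (map (emb j D) xs) = pad j D (concat (somes xs))"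
      using Cons.prems(2) by (simp add: None map_filter_simps replicate_app_Cons_same)
    with Cons.IH[of "Suc e"] Cons.prems(1) have "Suc e \<le> j" "xs = spaced j (j - Suc e) (somes xs)"
      by auto
    then show ?thesis
      by (cases "j - e") (auto simp: None map_filter_simps spaced_def Suc_diff_Suc[symmetric])
  next
    case (Some s)
    then have s: "s \<noteq> []" "Suc D \<notin> set s" using Cons.prems(1) by auto
    then have h: "hd s \<noteq> Suc D" by (metis hd_in_set)
    have "replicate e (Suc D) @ core j D s @ concat (map (emb j D) xs) =
        replicate j (Suc D) @ core j D s @ pad j D (concat (somes xs))"
      using Cons.prems(2) pad_core[OF s(1)] by (simp add: Some map_filter_simps)
    then have "replicate e (Suc D) @ hd s # (lpad j D (tl s) @ concat (map (emb j D) xs)) =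
        replicate j (Suc D) @ hd s # (lpad j D (tl s) @ pad j D (concat (somes xs)))"
      by (simp add: core_def)
    from replicate_append_Cons_eq[OF h h this]
    have e: "e = j" and "replicate 0 (Suc D) @ concat (map (emb j D) xs) = pad j D (concat (somes xs))"
      by auto
    with Cons.IH[of 0] Cons.prems(1) have "xs = spaced j j (somes xs)" by auto
    then show ?thesis by (simp add: Some e map_filter_simps spaced_def)
  qed
qed

text \<open>The core of \<open>w\<close> carries \<open>j\<close> letters \<open>a\<close> fewer
  than \<open>j * length w\<close>, and each \<open>None\<close> carries one. The subtrahend is
  moved to the left to avoid truncated subtraction.\<close>

lemma emb_count:
  assumes "\<And>w. Some w \<in> set xs \<Longrightarrow> w \<noteq> [] \<and> Suc D \<notin> set w"
  shows "count_list (concat (map (emb j D) xs)) (Suc D) + Suc j * length (somes xs) =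
      length xs + j * length (concat (somes xs))"
    and "filter (\<lambda>x. x \<noteq> Suc D) (concat (map (emb j D) xs)) = concat (somes xs)"
proof -
  have core: "count_list (core j D w) (Suc D) + j = j * length w"
    "filter (\<lambda>x. x \<noteq> Suc D) (core j D w) = w" if "w \<noteq> [] \<and> Suc D \<notin> set w" for w
    using that count_pad_parts[of D "tl w" j] by (cases w; simp add: core_def)+
  show "filter (\<lambda>x. x \<noteq> Suc D) (concat (map (emb j D) xs)) = concat (somes xs)"
    using assms
  proof (induction xs)
    case (Cons x xs)
    then show ?case using core(2) by (cases x) (auto simp: map_filter_simps)
  qed (simp add: map_filter_simps)
  show "count_list (concat (map (emb j D) xs)) (Suc D) + Suc j * length (somes xs) =
      length xs + j * length (concat (somes xs))"
    using assms
  proof (induction xs)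
    case (Cons x xs)
    then have IH: "count_list (concat (map (emb j D) xs)) (Suc D) + Suc j * length (somes xs) =
        length xs + j * length (concat (somes xs))" by auto
    show ?case
    proof (cases x)
      case (Some w)
      then have "count_list (core j D w) (Suc D) + j = j * length w" using core(1) Cons.prems by simp
      with IH Some show ?thesis by (simp add: map_filter_simps algebra_simps)
    qed (use IH in \<open>simp add: map_filter_simps algebra_simps\<close>)
  qed (simp add: map_filter_simps)
qed

lemma somes_append: "somes (xs @ ys) = somes xs @ somes ys"
  by (induction xs) (auto simp: map_filter_simps split: option.splits)

lemma somes_replicate: "somes (replicate m None) = []"
  by (induction m) (auto simp: map_filter_simps)

lemma somes_spaced: "somes (spaced j r ss) = ss"
  by (induction ss) (auto simp: spaced_def somes_append somes_replicate map_filter_simps)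

lemma length_spaced: "length (spaced j r ss) = r + length ss * Suc j"
  by (induction ss) (auto simp: spaced_def)

lemma emb_spaced:
  assumes "r \<le> j" "\<And>s. s \<in> set ss \<Longrightarrow> s \<noteq> []"
  shows "replicate (j - r) (Suc D) @ concat (map (emb j D) (spaced j r ss)) = pad j D (concat ss)"
proof -
  have rep: "concat (map (emb j D) (replicate m None)) = replicate m (Suc D)" for m
    by (induction m) auto
  have *: "replicate j (Suc D) @ concat (map (emb j D) (concat (map (\<lambda>s. Some s # replicate j None) ss))) =
      pad j D (concat ss)"
    using assms(2)
  proof (induction ss)
    case (Cons s ss)
    then show ?case using pad_core[of s j D "concat ss"] by (simp add: rep)
  qed (simp add: pad_def)
  have "replicate j (Suc D) = replicate (j - r) (Suc D) @ replicate r (Suc D)"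
    using assms(1) by (simp add: replicate_add[symmetric])
  with * show ?thesis by (simp add: spaced_def rep)
qed

lemma length_somes: "(\<Sum>x\<leftarrow>xs. case x of None \<Rightarrow> 0 | Some _ \<Rightarrow> 1) = length (somes xs)"
  by (induction xs) (auto simp: map_filter_simps split: option.splits)

lemma set_somes: "set (somes xs) = {s. Some s \<in> set xs}"
  by (induction xs) (auto simp: map_filter_simps split: option.splits)

text \<open>The length hypothesis makes the letters \<open>a\<close> number \<open>j\<close> per
  gap: \<open>j - r\<close> are prepended and the factors contribute
  \<open>r + j * length (concat (somes xs))\<close>. Only the even distribution can fail, and it
  does unless the factors are spaced.\<close>

lemma emb_uneven:
  assumes "\<And>w. Some w \<in> set xs \<Longrightarrow> w \<noteq> [] \<and> Suc D \<notin> set w"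
    and "length xs = r + length (somes xs) * Suc j" "r \<le> j" "xs \<noteq> spaced j r (somes xs)"
  shows "uneven j D (replicate (j - r) (Suc D) @ concat (map (emb j D) xs))"
proof -
  let ?z = "replicate (j - r) (Suc D) @ concat (map (emb j D) xs)"
  have c: "count_list (replicate m x) x = m" for m and x :: nat by (induction m) auto
  have f: "filter (\<lambda>x. x \<noteq> Suc D) ?z = concat (somes xs)"
    using emb_count(2)[where xs = xs and D = D, OF assms(1)] by simp
  have "count_list ?z (Suc D) = j * Suc (length (concat (somes xs)))"
    using emb_count(1)[where xs = xs and D = D and j = j, OF assms(1)] assms(2,3) by (simp add: c algebra_simps)
  moreover have "?z \<noteq> pad j D (concat (somes xs))"
    using emb_eq_pad[where xs = xs and D = D and e = "j - r" and j = j] assms(1,3,4) by auto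
  ultimately show ?thesis unfolding uneven_def f by (rule conjI)
qed

section \<open>Sums of squared run lengths\<close>

text \<open>Prepending its letter to a run of length \<open>m\<close> adds
  \<open>(m + 1)^2 - m^2 = 2 * m + 1\<close>; this is therefore the sum of the squared lengths of
  the maximal runs.\<close>

fun run_sq :: "'b list \<Rightarrow> nat" where
  "run_sq [] = 0"
| "run_sq (x # xs) = run_sq xs + 2 * length (takeWhile ((=) x) xs) + 1"

text \<open>Ensures that among words of a fixed length \<open>run_sq\<close> cannot increase for
  ever.\<close>

lemma run_sq_le: "run_sq xs \<le> length xs ^ 2"
proof (induction xs)
  case (Cons x xs)
  then show ?case using length_takeWhile_le[of "(=) x" xs] by (simp add: power2_eq_square)
qed simp

text \<open>Two runs that meet at the seam may merge, and merging only increases the sum of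
  squares.\<close>

lemma run_sq_append: "run_sq xs + run_sq ys \<le> run_sq (xs @ ys)"
proof (induction xs)
  case (Cons x xs)
  have "length (takeWhile ((=) x) xs) \<le> length (takeWhile ((=) x) (xs @ ys))"
    by (induction xs) auto
  with Cons show ?case by simp
qed simp

lemma run_sq_concat: "(\<Sum>x\<leftarrow>xss. run_sq x) \<le> run_sq (concat xss)"
proof (induction xss)
  case (Cons x xss)
  then show ?case using run_sq_append[of x "concat xss"] by simp
qed simp

lemma run_sq_replicate: "run_sq (replicate e a) = e ^ 2"
proof (induction e)
  case (Suc e)
  then show ?case by (simp add: power2_eq_square takeWhile_eq_all_conv[THEN iffD2])
qed simp

text \<open>Every square is bounded below by its tangent at \<open>j\<close>; strictness comes from an exponent
  different from \<open>j\<close>.\<close>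

lemma run_sq_pad:
  assumes "\<sigma> (Suc D) = [a]"
  shows "(\<Sum>b\<leftarrow>filter (\<lambda>x. x \<noteq> Suc D) z. run_sq (\<sigma> b)) + 2 * j * (e + count_list z (Suc D)) +
      (if replicate e (Suc D) @ z = pad j D (filter (\<lambda>x. x \<noteq> Suc D) z) then 0 else 1)
    \<le> run_sq (replicate e a @ concat (map \<sigma> z)) + j ^ 2 * Suc (length (filter (\<lambda>x. x \<noteq> Suc D) z))"
proof (induction z arbitrary: e)
  have tangent: "2 * j * e + (if e = j then 0 else 1) \<le> e ^ 2 + j ^ 2" for e
  proof (cases "e = j")
    case False
    then have "(int e - int j) ^ 2 > 0" by simp
    then have "2 * int j * int e < int e ^ 2 + int j ^ 2" by (simp add: power2_eq_square algebra_simps)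
    then have "int (2 * j * e) < int (e ^ 2 + j ^ 2)" by simp
    then show ?thesis using False by (simp only: of_nat_less_iff) simp
  qed (simp add: power2_eq_square)
  {
    case Nil
    show ?case using tangent[of e] by (simp add: run_sq_replicate pad_def)
  next
    case (Cons b z)
    show ?case
    proof (cases "b = Suc D")
      case True
      then show ?thesis
        using Cons[of "Suc e"] assms by (simp add: replicate_app_Cons_same algebra_simps)
    next
      case False
      let ?f = "filter (\<lambda>x. x \<noteq> Suc D) z"
      have pad: "pad j D (b # ?f) = replicate j (Suc D) @ b # pad j D ?f"
        by (simp add: pad_def)
      have "(if replicate e (Suc D) @ b # z = pad j D (b # ?f) then 0 else 1) \<le>
          (if e = j then 0 else 1) + (if z = pad j D ?f then 0 else (1::nat))"
        by (auto simp: pad)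
      moreover have "e ^ 2 + (run_sq (\<sigma> b) + run_sq (concat (map \<sigma> z))) \<le>
          run_sq (replicate e a @ \<sigma> b @ concat (map \<sigma> z))"
        using run_sq_append[of "replicate e a" "\<sigma> b @ concat (map \<sigma> z)"]
          run_sq_append[of "\<sigma> b" "concat (map \<sigma> z)"] by (simp add: run_sq_replicate)
      ultimately show ?thesis
        using Cons[of 0] tangent[of e] False by (simp add: algebra_simps)
    qed
  }
qed

lemma run_sq_uneven:
  assumes "\<sigma> (Suc D) = [a]" "uneven j D z"
  shows "(\<Sum>b\<leftarrow>filter (\<lambda>x. x \<noteq> Suc D) z. run_sq (\<sigma> b)) +
    j ^ 2 * Suc (length (filter (\<lambda>x. x \<noteq> Suc D) z)) < run_sq (concat (map \<sigma> z))"
  using run_sq_pad[where \<sigma> = \<sigma> and D = D and a = a and z = z and j = j and e = 0, OF assms(1)] assms(2)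
  by (simp add: uneven_def power2_eq_square algebra_simps)

section \<open>Run-length encodings\<close>

definition expand :: "('b \<times> nat) list \<Rightarrow> 'b list" where
  "expand rs = concat (map (\<lambda>(a, e). replicate e a) rs)"

lemma expand_simps [simp]:
  "expand [] = []" "expand ((a, e) # rs) = replicate e a @ expand rs" "expand (rs @ rs') = expand rs @ expand rs'"
  by (simp_all add: expand_def)

text \<open>A new first letter either lengthens the first run or opens a run of length 1. Since
  neighbouring runs have different letters, the runs are maximal, whence the equation for
  \<open>run_sq\<close>.\<close>

lemma run_lengths:
  obtains rs where "w = expand rs" "\<forall>x\<in>set rs. 1 \<le> snd x" "distinct_adj (map fst rs)"
    "run_sq w = (\<Sum>x\<leftarrow>rs. snd x ^ 2)"
proof -
  have "\<exists>rs. w = expand rs \<and> (\<forall>x\<in>set rs. 1 \<le> snd x) \<and> distinct_adj (map fst rs) \<and>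
      run_sq w = (\<Sum>x\<leftarrow>rs. snd x ^ 2)"
  proof (induction w)
    case Nil
    show ?case by (intro exI[of _ "[]"]) simp
  next
    case (Cons x w)
    then obtain rs where rs: "w = expand rs" "\<forall>x\<in>set rs. 1 \<le> snd x" "distinct_adj (map fst rs)"
      "run_sq w = (\<Sum>x\<leftarrow>rs. snd x ^ 2)" by blast
    have tw: "takeWhile ((=) x) (expand rs') = []"
      if hd: "rs' = [] \<or> fst (hd rs') \<noteq> x" and ge: "\<forall>x\<in>set rs'. 1 \<le> snd x" for rs'
    proof (cases rs')
      case (Cons r rs'')
      then obtain a e where "r = (a, Suc e)" using ge by (cases r; cases "snd r") auto
      then show ?thesis using hd Cons by simp
    qed simp
    show ?case
    proof (cases "rs = [] \<or> fst (hd rs) \<noteq> x")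
      case True
      with rs show ?thesis
        using tw[OF True rs(2)] by (intro exI[of _ "(x, 1) # rs"]) (cases rs; auto)
    next
      case False
      then obtain e rs' where r: "rs = (x, e) # rs'" by (cases rs) auto
      have "rs' = [] \<or> fst (hd rs') \<noteq> x" using rs(3) by (cases rs') (auto simp: r)
      then have "takeWhile ((=) x) (expand rs') = []" using rs(2) by (intro tw) (auto simp: r)
      then have "takeWhile ((=) x) w = replicate e x" by (simp add: rs(1) r takeWhile_append)
      then have "run_sq (x # w) = (\<Sum>x\<leftarrow>(x, Suc e) # rs'. snd x ^ 2)"
        using rs(4) by (simp add: r power2_eq_square)
      then show ?thesis using rs(1-3) by (intro exI[of _ "(x, Suc e) # rs'"]) (auto simp: r distinct_adj_Cons)
    qed
  qed
  with that show thesis by blast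
qed

text \<open>Neighbouring runs may share their letter here, so an inequality is what remains. It is
  applied to the pieces into which a run decomposition is cut.\<close>

lemma sum_sq_le_run_sq: "(\<Sum>x\<leftarrow>rs. snd x ^ 2) \<le> run_sq (expand rs)"
proof -
  have *: "(\<Sum>x\<leftarrow>rs. snd x ^ 2) = (\<Sum>v\<leftarrow>map (\<lambda>(a, e). replicate e a) rs. run_sq v)"
    by (induction rs) (auto simp: run_sq_replicate)
  show ?thesis
    unfolding expand_def by (rule order_trans[OF eq_refl[OF *] run_sq_concat])
qed

text \<open>\<open>Suc c\<close> occurrences enclose \<open>c\<close> gaps. The gaps
  \<open>Us\<close> provide the words to be substituted for the letters \<open>1, ..., c\<close>;
  \<open>P\<close> and \<open>Q\<close> become the flanks.\<close>

lemma split_occurrences: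
  assumes "Suc c \<le> count_list rs x"
  obtains P Us Q where "length Us = c" "rs = P @ x # concat (map (\<lambda>U. U @ [x]) Us) @ Q"
proof -
  have "\<exists>P Us Q. length Us = c \<and> rs = P @ x # concat (map (\<lambda>U. U @ [x]) Us) @ Q"
    using assms
  proof (induction c arbitrary: rs)
    case 0
    then have "x \<in> set rs" by (auto simp: count_list_0_iff intro: ccontr)
    then obtain P Q where "rs = P @ x # Q" by (meson split_list)
    then show ?case by (intro exI[of _ P] exI[of _ "[]"] exI[of _ Q]) simp
  next
    case (Suc c)
    then have "x \<in> set rs" by (auto simp: count_list_0_iff intro: ccontr)
    then obtain P rs' where rs: "rs = P @ x # rs'" "x \<notin> set P" by (meson split_list_first)
    then have "Suc c \<le> count_list rs' x" using Suc.prems by simp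
    from Suc.IH[OF this] obtain P' Us Q
      where "length Us = c" "rs' = P' @ x # concat (map (\<lambda>U. U @ [x]) Us) @ Q" by blast
    with rs show ?case by (intro exI[of _ P] exI[of _ "P' # Us"] exI[of _ Q]) simp
  qed
  with that show thesis by blast
qed

lemma split_occurrences_nonempty:
  assumes "distinct_adj (map f (P @ x # concat (map (\<lambda>U. U @ [x]) Us) @ Q))" "U \<in> set Us"
  shows "U \<noteq> []"
proof
  assume "U = []"
  with assms(2) obtain L M where Us: "Us = L @ [] # M" by (meson split_list)
  \<comment> \<open>Shifting each \<open>x\<close> from the end of its block to the front brings the
    two copies of \<open>x\<close> around the empty gap next to each other.\<close>
  have "x # concat (map (\<lambda>U. U @ [x]) L) = concat (map (\<lambda>U. x # U) L) @ [x]"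
    by (induction L) auto
  then have "P @ x # concat (map (\<lambda>U. U @ [x]) Us) @ Q =
      (P @ concat (map (\<lambda>U. x # U) L)) @ [x, x] @ (concat (map (\<lambda>U. U @ [x]) M) @ Q)"
    by (simp add: Us)
  then have "distinct_adj (map f (P @ concat (map (\<lambda>U. x # U) L)) @ [f x, f x] @
      map f (concat (map (\<lambda>U. U @ [x]) M) @ Q))"
    using assms(1) by (simp only: map_append list.map)
  then have "distinct_adj ([f x, f x] @ map f (concat (map (\<lambda>U. U @ [x]) M) @ Q))"
    using distinct_adj_appendD2 by blast
  then show False by simp
qed

text \<open>The letters of the word are counted by the pair of letter and run length to which they
  belong; each of the \<open>d\<close> letters has at most \<open>B e\<close> runs of length
  \<open>e\<close>.\<close>

lemma length_le_by_counts:
  fixes rs :: "(nat \<times> nat) list"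
  assumes "\<And>a e. (a, e) \<in> set rs \<Longrightarrow> a \<in> {1..d} \<and> 1 \<le> e \<and> e < n"
    and "\<And>a e. a \<in> {1..d} \<Longrightarrow> 1 \<le> e \<Longrightarrow> e < n \<Longrightarrow> count_list rs (a, e) \<le> B e"
  shows "length (expand rs) \<le> d * (\<Sum>e\<in>{1..<n}. e * B e)"
proof -
  have "length (expand rs) = (\<Sum>x\<leftarrow>rs. snd x)"
    by (induction rs) auto
  also have "\<dots> = (\<Sum>x\<in>set rs. count_list rs x * snd x)"
    by (rule sum_list_map_eq_sum_count)
  also have "\<dots> \<le> (\<Sum>x\<in>{1..d} \<times> {1..<n}. count_list rs x * snd x)"
    using assms(1) by (intro sum_mono2) auto
  also have "\<dots> \<le> (\<Sum>x\<in>{1..d} \<times> {1..<n}. snd x * B (snd x))"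
    using assms(2) by (intro sum_mono) (auto simp: mult.commute)
  also have "\<dots> = (\<Sum>(a, e)\<in>{1..d} \<times> {1..<n}. e * B e)"
    by (simp add: case_prod_unfold)
  also have "\<dots> = (\<Sum>a\<in>{1..d}. \<Sum>e\<in>{1..<n}. e * B e)"
    by (rule sum.cartesian_product[symmetric])
  also have "\<dots> = d * (\<Sum>e\<in>{1..<n}. e * B e)"
    by simp
  finally show ?thesis .
qed

lemma sum_list_filter_split:
  fixes g :: "'b \<Rightarrow> nat"
  shows "(\<Sum>b\<leftarrow>z. g b) = count_list z a * g a + (\<Sum>b\<leftarrow>filter (\<lambda>x. x \<noteq> a) z. g b)"
  by (induction z) auto

lemma count_list_concat: "count_list (concat ws) b = (\<Sum>w\<leftarrow>ws. count_list w b)"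
  by (induction ws) auto

lemma count_list_filter_neq: "b \<noteq> a \<Longrightarrow> count_list (filter (\<lambda>x. x \<noteq> a) z) b = count_list z b"
  by (induction z) auto

lemma count_list_distinct: "distinct z \<Longrightarrow> count_list z b = (if b \<in> set z then 1 else 0)"
  by (induction z) auto

lemma count_mset_count_list: "count (mset z) b = count_list z b"
  by (induction z) auto

lemma set_expand: "set (expand rs) = fst ` {x \<in> set rs. 1 \<le> snd x}"
proof (induction rs)
  case (Cons r rs)
  obtain a e where r: "r = (a, e)" by (cases r)
  have "{x \<in> set (r # rs). 1 \<le> snd x} = (if 1 \<le> e then {(a, e)} else {}) \<union> {x \<in> set rs. 1 \<le> snd x}"
    by (auto simp: r)
  then show ?case unfolding r expand_simps set_append Cons.IH
    by (simp add: image_Un set_replicate_conv_if)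
qed simp

section \<open>Linear combinations of words\<close>

context field
begin

abbreviation Alg :: "nat \<Rightarrow> ('a, nat list \<Rightarrow> 'a) module" where
  "Alg d \<equiv> free_nonunital_algebra R d"

definition supp :: "(nat list \<Rightarrow> 'a) \<Rightarrow> nat list set" where
  "supp f = {w. f w \<noteq> \<zero>}"

definition mon :: "'a \<Rightarrow> nat list \<Rightarrow> nat list \<Rightarrow> 'a" where
  "mon c w = (\<lambda>v. if v = w then c else \<zero>)"

lemma Alg_carrier: "f \<in> carrier (Alg d) \<longleftrightarrow>
    (\<forall>w. f w \<in> carrier R) \<and> finite (supp f) \<and> supp f \<subseteq> free_semigroup d"
  by (simp add: free_nonunital_algebra_def supp_def)

lemma Alg_zero: "\<zero>\<^bsub>Alg d\<^esub> = (\<lambda>w. \<zero>)"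
  and Alg_add: "f \<oplus>\<^bsub>Alg d\<^esub> g = (\<lambda>w. f w \<oplus> g w)"
  and Alg_smult: "c \<odot>\<^bsub>Alg d\<^esub> f = (\<lambda>w. c \<otimes> f w)"
  and Alg_mult: "f \<otimes>\<^bsub>Alg d\<^esub> g = (\<lambda>w. finsum R (\<lambda>(u, v). f u \<otimes> g v)
               {(u, v). u \<in> free_semigroup d \<and> v \<in> free_semigroup d \<and> u @ v = w})"
  by (simp_all add: free_nonunital_algebra_def)

lemma Alg_closed: "f \<in> carrier (Alg d) \<Longrightarrow> f w \<in> carrier R"
  and finite_supp: "f \<in> carrier (Alg d) \<Longrightarrow> finite (supp f)"
  and supp_subset: "f \<in> carrier (Alg d) \<Longrightarrow> supp f \<subseteq> free_semigroup d"
  by (simp_all add: Alg_carrier)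

lemma append_free_semigroup: "u \<in> free_semigroup d \<Longrightarrow> v \<in> free_semigroup d \<Longrightarrow> u @ v \<in> free_semigroup d"
  by (auto simp: free_semigroup_def)

section \<open>Module structure and bilinear product\<close>

lemma module_Alg: "module R (Alg d)"
proof (rule moduleI)
  show "cring R" ..
  show "abelian_group (Alg d)"
  proof (rule abelian_groupI)
    fix x y assume xy: "x \<in> carrier (Alg d)" "y \<in> carrier (Alg d)"
    have "supp (x \<oplus>\<^bsub>Alg d\<^esub> y) \<subseteq> supp x \<union> supp y"
      by (auto simp: supp_def Alg_add)
    with xy show "x \<oplus>\<^bsub>Alg d\<^esub> y \<in> carrier (Alg d)"
      by (auto simp: Alg_carrier Alg_add intro: finite_subset)
    show "x \<oplus>\<^bsub>Alg d\<^esub> y = y \<oplus>\<^bsub>Alg d\<^esub> x"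
      using xy by (auto simp: Alg_add Alg_carrier a_comm)
  next
    fix x assume x: "x \<in> carrier (Alg d)"
    have "supp (\<lambda>w. \<ominus> x w) \<subseteq> supp x"
      using Alg_closed[OF x] by (auto simp: supp_def)
    with x have "(\<lambda>w. \<ominus> x w) \<in> carrier (Alg d)"
      by (auto simp: Alg_carrier intro: finite_subset)
    moreover have "(\<lambda>w. \<ominus> x w) \<oplus>\<^bsub>Alg d\<^esub> x = \<zero>\<^bsub>Alg d\<^esub>"
      using x by (auto simp: Alg_add Alg_zero Alg_carrier l_neg)
    ultimately show "\<exists>y\<in>carrier (Alg d). y \<oplus>\<^bsub>Alg d\<^esub> x = \<zero>\<^bsub>Alg d\<^esub>" by blast
  qed (auto simp: Alg_carrier Alg_add Alg_zero supp_def a_assoc)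
next
  fix a x assume ax: "a \<in> carrier R" "x \<in> carrier (Alg d)"
  have "supp (a \<odot>\<^bsub>Alg d\<^esub> x) \<subseteq> supp x"
    using ax by (auto simp: supp_def Alg_smult)
  with ax show "a \<odot>\<^bsub>Alg d\<^esub> x \<in> carrier (Alg d)"
    by (auto simp: Alg_carrier Alg_smult intro: finite_subset)
qed (auto simp: Alg_carrier Alg_add Alg_smult l_distr r_distr m_assoc)

interpretation A: module R "Alg d" for d
  by (rule module_Alg)

lemma finite_splits: "finite {(u, v). u \<in> Z \<and> v \<in> Y \<and> u @ v = (w::nat list)}"
proof (rule finite_subset)
  show "{(u, v). u \<in> Z \<and> v \<in> Y \<and> u @ v = w} \<subseteq> (\<lambda>i. (take i w, drop i w)) ` {..length w}"
  proof clarify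
    fix u v :: "nat list" assume "w = u @ v"
    then show "(u, v) \<in> (\<lambda>i. (take i (u @ v), drop i (u @ v))) ` {..length (u @ v)}"
      by (intro image_eqI[of _ _ "length u"]) auto
  qed
qed simp

lemma supp_mult:
  assumes "f \<in> carrier (Alg d)" "g \<in> carrier (Alg d)" "w \<in> supp (f \<otimes>\<^bsub>Alg d\<^esub> g)"
  obtains u v where "u \<in> supp f" "v \<in> supp g" "w = u @ v"
proof (rule ccontr)
  assume "\<not> thesis"
  with that have *: "f u \<otimes> g v = \<zero>" if "u @ v = w" for u v
    using assms that by (cases "f u = \<zero>"; cases "g v = \<zero>") (auto simp: supp_def Alg_carrier)
  have "(f \<otimes>\<^bsub>Alg d\<^esub> g) w = \<zero>"
    unfolding Alg_mult by (rule add.finprod_one_eqI) (use * in auto)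
  with assms(3) show False by (simp add: supp_def)
qed

lemma Alg_mult_closed:
  assumes f: "f \<in> carrier (Alg d)" and g: "g \<in> carrier (Alg d)"
  shows "f \<otimes>\<^bsub>Alg d\<^esub> g \<in> carrier (Alg d)"
proof -
  have *: "supp (f \<otimes>\<^bsub>Alg d\<^esub> g) \<subseteq> (\<lambda>(u, v). u @ v) ` (supp f \<times> supp g)"
  proof
    fix w assume "w \<in> supp (f \<otimes>\<^bsub>Alg d\<^esub> g)"
    with f g obtain u v where "u \<in> supp f" "v \<in> supp g" "w = u @ v" by (rule supp_mult)
    then show "w \<in> (\<lambda>(u, v). u @ v) ` (supp f \<times> supp g)"
      by (intro image_eqI[of _ _ "(u, v)"]) auto
  qed
  then have "finite (supp (f \<otimes>\<^bsub>Alg d\<^esub> g))"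
    by (rule finite_subset) (use f g in \<open>auto simp: Alg_carrier\<close>)
  moreover have "supp (f \<otimes>\<^bsub>Alg d\<^esub> g) \<subseteq> free_semigroup d"
    using * supp_subset[OF f] supp_subset[OF g] append_free_semigroup by fastforce
  moreover have "(f \<otimes>\<^bsub>Alg d\<^esub> g) w \<in> carrier R" for w
    unfolding Alg_mult using f g by (auto intro!: finsum_closed simp: Alg_carrier)
  ultimately show ?thesis by (simp add: Alg_carrier)
qed

lemma Alg_l_distr:
  assumes "f \<in> carrier (Alg d)" "g \<in> carrier (Alg d)" "h \<in> carrier (Alg d)"
  shows "(f \<oplus>\<^bsub>Alg d\<^esub> g) \<otimes>\<^bsub>Alg d\<^esub> h = f \<otimes>\<^bsub>Alg d\<^esub> h \<oplus>\<^bsub>Alg d\<^esub> g \<otimes>\<^bsub>Alg d\<^esub> h"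
  unfolding Alg_mult Alg_add
  by (rule ext, subst finsum_addf[symmetric])
     (use assms in \<open>auto simp: Alg_carrier l_distr intro!: finsum_cong'\<close>)

lemma Alg_r_distr:
  assumes "f \<in> carrier (Alg d)" "g \<in> carrier (Alg d)" "h \<in> carrier (Alg d)"
  shows "h \<otimes>\<^bsub>Alg d\<^esub> (f \<oplus>\<^bsub>Alg d\<^esub> g) = h \<otimes>\<^bsub>Alg d\<^esub> f \<oplus>\<^bsub>Alg d\<^esub> h \<otimes>\<^bsub>Alg d\<^esub> g"
  unfolding Alg_mult Alg_add
  by (rule ext, subst finsum_addf[symmetric])
     (use assms in \<open>auto simp: Alg_carrier r_distr intro!: finsum_cong'\<close>)

lemma Alg_l_zero: "f \<in> carrier (Alg d) \<Longrightarrow> \<zero>\<^bsub>Alg d\<^esub> \<otimes>\<^bsub>Alg d\<^esub> f = \<zero>\<^bsub>Alg d\<^esub>"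
  and Alg_r_zero: "f \<in> carrier (Alg d) \<Longrightarrow> f \<otimes>\<^bsub>Alg d\<^esub> \<zero>\<^bsub>Alg d\<^esub> = \<zero>\<^bsub>Alg d\<^esub>"
  unfolding Alg_mult Alg_zero
  by (auto intro!: add.finprod_one_eqI simp: Alg_carrier)

lemma mon_closed: "c \<in> carrier R \<Longrightarrow> w \<in> free_semigroup d \<Longrightarrow> mon c w \<in> carrier (Alg d)"
  by (auto simp: Alg_carrier mon_def supp_def intro: finite_subset[of _ "{w}"])

lemma mon_mult:
  assumes "c \<in> carrier R" "c' \<in> carrier R" "u \<in> free_semigroup d" "v \<in> free_semigroup d"
  shows "mon c u \<otimes>\<^bsub>Alg d\<^esub> mon c' v = mon (c \<otimes> c') (u @ v)"
proof
  fix w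
  let ?S = "{(u, v). u \<in> free_semigroup d \<and> v \<in> free_semigroup d \<and> u @ v = w}"
  have "(mon c u \<otimes>\<^bsub>Alg d\<^esub> mon c' v) w =
      (\<Oplus>x\<in>?S. if (u, v) = x then c \<otimes> c' else \<zero>)"
    unfolding Alg_mult by (rule finsum_cong') (use assms in \<open>auto simp: mon_def split: if_splits\<close>)
  also have "\<dots> = mon (c \<otimes> c') (u @ v) w"
  proof (cases "u @ v = w")
    case True
    then have "(u, v) \<in> ?S" using assms by auto
    then have "(\<Oplus>x\<in>?S. if (u, v) = x then c \<otimes> c' else \<zero>) = c \<otimes> c'"
      using assms by (intro add.finprod_singleton finite_splits[of "free_semigroup d" "free_semigroup d" w]) auto
    with True show ?thesis by (simp add: mon_def)
  next
    case False
    have "(\<Oplus>x\<in>?S. if (u, v) = x then c \<otimes> c' else \<zero>) = \<zero>"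
      by (rule add.finprod_one_eqI) (use False in auto)
    with False show ?thesis by (simp add: mon_def)
  qed
  finally show "(mon c u \<otimes>\<^bsub>Alg d\<^esub> mon c' v) w = mon (c \<otimes> c') (u @ v) w" .
qed

lemma smult_mon: "c' \<in> carrier R \<Longrightarrow> c' \<odot>\<^bsub>Alg d\<^esub> mon c w = mon (c' \<otimes> c) w"
  by (auto simp: Alg_smult mon_def)

lemma add_mon: "mon c w \<oplus>\<^bsub>Alg d\<^esub> mon c' w = mon (c \<oplus> c') w"
  by (auto simp: Alg_add mon_def)

lemma mon_zero: "mon \<zero> w = \<zero>\<^bsub>Alg d\<^esub>"
  by (auto simp: Alg_zero mon_def)

lemma finsum_mult_l:
  assumes "finite S" "Z \<in> S \<rightarrow> carrier (Alg d)" "g \<in> carrier (Alg d)"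
  shows "finsum (Alg d) Z S \<otimes>\<^bsub>Alg d\<^esub> g = finsum (Alg d) (\<lambda>s. Z s \<otimes>\<^bsub>Alg d\<^esub> g) S"
  using assms(1,2)
proof induction
  case (insert x S)
  then have Z: "Z x \<in> carrier (Alg d)" "Z \<in> S \<rightarrow> carrier (Alg d)" by auto
  then have Y: "(\<lambda>s. Z s \<otimes>\<^bsub>Alg d\<^esub> g) \<in> S \<rightarrow> carrier (Alg d)"
    using assms(3) by (auto intro: Alg_mult_closed)
  show ?case
    unfolding A.M.finsum_insert[OF insert.hyps Z(2,1)]
      A.M.finsum_insert[OF insert.hyps Y Alg_mult_closed[OF Z(1) assms(3)]]
    unfolding Alg_l_distr[OF Z(1) A.M.finsum_closed[OF Z(2)] assms(3)] insert.IH[OF Z(2)] ..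
next
  case empty
  show ?case
    unfolding A.M.finsum_empty by (rule Alg_l_zero[OF assms(3)])
qed

lemma finsum_mult_r:
  assumes "finite S" "Z \<in> S \<rightarrow> carrier (Alg d)" "g \<in> carrier (Alg d)"
  shows "g \<otimes>\<^bsub>Alg d\<^esub> finsum (Alg d) Z S = finsum (Alg d) (\<lambda>s. g \<otimes>\<^bsub>Alg d\<^esub> Z s) S"
  using assms(1,2)
proof induction
  case (insert x S)
  then have Z: "Z x \<in> carrier (Alg d)" "Z \<in> S \<rightarrow> carrier (Alg d)" by auto
  then have Y: "(\<lambda>s. g \<otimes>\<^bsub>Alg d\<^esub> Z s) \<in> S \<rightarrow> carrier (Alg d)"
    using assms(3) by (auto intro: Alg_mult_closed)
  show ?case
    unfolding A.M.finsum_insert[OF insert.hyps Z(2,1)]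
      A.M.finsum_insert[OF insert.hyps Y Alg_mult_closed[OF assms(3) Z(1)]]
    unfolding Alg_r_distr[OF Z(1) A.M.finsum_closed[OF Z(2)] assms(3)] insert.IH[OF Z(2)] ..
next
  case empty
  show ?case
    unfolding A.M.finsum_empty by (rule Alg_r_zero[OF assms(3)])
qed

lemma finsum_Alg_apply:
  assumes "finite S" "Z \<in> S \<rightarrow> carrier (Alg d)"
  shows "finsum (Alg d) Z S w = (\<Oplus>s\<in>S. Z s w)"
  using assms
proof induction
  case (insert x S)
  then have Z: "Z x \<in> carrier (Alg d)" "Z \<in> S \<rightarrow> carrier (Alg d)" by auto
  then have Y: "(\<lambda>s. Z s w) \<in> S \<rightarrow> carrier R" "Z x w \<in> carrier R"
    by (auto intro: Alg_closed)
  show ?case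
    unfolding A.M.finsum_insert[OF insert.hyps Z(2,1)] finsum_insert[OF insert.hyps Y]
    unfolding Alg_add insert.IH[OF Z(2)] ..
next
  case empty
  show ?case
    unfolding A.M.finsum_empty finsum_empty Alg_zero ..
qed

text \<open>The index set is kept apart from the words because \<open>\<omega>\<close> need not be
  injective: expansions of powers can be handled without collecting equal words, and parts of them
  are selected by conditions on the indices.\<close>

definition comb :: "nat \<Rightarrow> 's set \<Rightarrow> ('s \<Rightarrow> 'a) \<Rightarrow> ('s \<Rightarrow> nat list) \<Rightarrow> nat list \<Rightarrow> 'a" where
  "comb d S c \<omega> = finsum (Alg d) (\<lambda>s. mon (c s) (\<omega> s)) S"

lemma mon_Pi: "c \<in> S \<rightarrow> carrier R \<Longrightarrow> \<omega> \<in> S \<rightarrow> free_semigroup d \<Longrightarrow>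
    (\<lambda>s. mon (c s) (\<omega> s)) \<in> S \<rightarrow> carrier (Alg d)"
  by (auto intro!: mon_closed)

lemma comb_closed: "c \<in> S \<rightarrow> carrier R \<Longrightarrow> \<omega> \<in> S \<rightarrow> free_semigroup d \<Longrightarrow>
    comb d S c \<omega> \<in> carrier (Alg d)"
  unfolding comb_def by (intro A.M.finsum_closed mon_Pi)

lemma comb_empty: "comb d {} c \<omega> = \<zero>\<^bsub>Alg d\<^esub>"
  by (simp add: comb_def)

lemma comb_insert:
  assumes "finite S" "s \<notin> S" "c \<in> insert s S \<rightarrow> carrier R" "\<omega> \<in> insert s S \<rightarrow> free_semigroup d"
  shows "comb d (insert s S) c \<omega> = mon (c s) (\<omega> s) \<oplus>\<^bsub>Alg d\<^esub> comb d S c \<omega>"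
  unfolding comb_def using assms mon_Pi[of c S \<omega> d]
  by (subst A.M.finsum_insert) (auto intro: mon_closed)

lemma comb_Un:
  assumes "finite S" "finite T" "S \<inter> T = {}" "c \<in> S \<union> T \<rightarrow> carrier R" "\<omega> \<in> S \<union> T \<rightarrow> free_semigroup d"
  shows "comb d (S \<union> T) c \<omega> = comb d S c \<omega> \<oplus>\<^bsub>Alg d\<^esub> comb d T c \<omega>"
  unfolding comb_def using assms
  by (subst A.M.finsum_Un_disjoint) (auto intro: mon_closed)

lemma comb_cong:
  assumes "S = T" "c' \<in> T \<rightarrow> carrier R" "\<omega>' \<in> T \<rightarrow> free_semigroup d"
    "\<And>s. s \<in> T \<Longrightarrow> c s = c' s" "\<And>s. s \<in> T \<Longrightarrow> \<omega> s = \<omega>' s"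
  shows "comb d S c \<omega> = comb d T c' \<omega>'"
  unfolding comb_def using assms by (intro A.M.finsum_cong') (auto intro: mon_closed)

lemma comb_reindex:
  assumes "inj_on h S" "c \<in> h ` S \<rightarrow> carrier R" "\<omega> \<in> h ` S \<rightarrow> free_semigroup d"
  shows "comb d (h ` S) c \<omega> = comb d S (\<lambda>s. c (h s)) (\<lambda>s. \<omega> (h s))"
  unfolding comb_def using assms by (subst A.M.add.finprod_reindex) (auto intro: mon_closed)

lemma comb_subset:
  assumes "finite T" "S \<subseteq> T" "c \<in> T \<rightarrow> carrier R" "\<omega> \<in> T \<rightarrow> free_semigroup d"
    "\<And>s. s \<in> T - S \<Longrightarrow> c s = \<zero>"
  shows "comb d S c \<omega> = comb d T c \<omega>"
  unfolding comb_def using assms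
  by (intro A.M.add.finprod_mono_neutral_cong_left) (auto intro: mon_closed simp: mon_zero)

lemma smult_comb:
  assumes "finite S" "a \<in> carrier R" "c \<in> S \<rightarrow> carrier R" "\<omega> \<in> S \<rightarrow> free_semigroup d"
  shows "a \<odot>\<^bsub>Alg d\<^esub> comb d S c \<omega> = comb d S (\<lambda>s. a \<otimes> c s) \<omega>"
  unfolding comb_def using assms mon_Pi[of c S \<omega> d]
  by (subst A.finsum_smult_ldistr) (auto simp: smult_mon intro!: A.M.finsum_cong' mon_closed)

lemma comb_supp:
  assumes f: "f \<in> carrier (Alg d)"
  shows "comb d (supp f) f (\<lambda>w. w) = f"
proof
  fix w
  have "comb d (supp f) f (\<lambda>w. w) w = (\<Oplus>v\<in>supp f. if w = v then f v else \<zero>)"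
    unfolding comb_def
  proof (subst finsum_Alg_apply)
    show "(\<lambda>s. mon (f s) s) \<in> supp f \<rightarrow> carrier (Alg d)"
      using f by (intro mon_Pi) (auto simp: Alg_carrier)
  qed (use f in \<open>auto simp: Alg_carrier mon_def intro!: finsum_cong'\<close>)
  also have "\<dots> = f w"
  proof (cases "w \<in> supp f")
    case True
    then show ?thesis using f by (subst add.finprod_singleton) (auto simp: Alg_carrier)
  next
    case False
    then have "(\<Oplus>v\<in>supp f. if w = v then f v else \<zero>) = \<zero>"
      by (intro add.finprod_one_eqI) auto
    with False show ?thesis by (simp add: supp_def)
  qed
  finally show "comb d (supp f) f (\<lambda>w. w) w = f w" .
qed

lemma mon_comb:
  assumes "finite T" "a \<in> carrier R" "u \<in> free_semigroup d" "c \<in> T \<rightarrow> carrier R" "\<omega> \<in> T \<rightarrow> free_semigroup d"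
  shows "mon a u \<otimes>\<^bsub>Alg d\<^esub> comb d T c \<omega> = comb d T (\<lambda>t. a \<otimes> c t) (\<lambda>t. u @ \<omega> t)"
  unfolding comb_def finsum_mult_r[OF assms(1) mon_Pi[OF assms(4,5)] mon_closed[OF assms(2,3)]]
  using assms by (intro A.M.finsum_cong' refl) (auto intro!: mon_mult mon_closed append_free_semigroup)

lemma comb_mon:
  assumes "finite T" "a \<in> carrier R" "u \<in> free_semigroup d" "c \<in> T \<rightarrow> carrier R" "\<omega> \<in> T \<rightarrow> free_semigroup d"
  shows "comb d T c \<omega> \<otimes>\<^bsub>Alg d\<^esub> mon a u = comb d T (\<lambda>t. c t \<otimes> a) (\<lambda>t. \<omega> t @ u)"
  unfolding comb_def finsum_mult_l[OF assms(1) mon_Pi[OF assms(4,5)] mon_closed[OF assms(2,3)]]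
  using assms by (intro A.M.finsum_cong' refl) (auto intro!: mon_mult mon_closed append_free_semigroup)

lemma comb_times:
  assumes "finite S" "finite T" "c \<in> S \<rightarrow> carrier R" "\<omega> \<in> S \<rightarrow> free_semigroup d"
    and c': "c' \<in> T \<rightarrow> carrier R" and \<omega>': "\<omega>' \<in> T \<rightarrow> free_semigroup d"
  shows "comb d S c \<omega> \<otimes>\<^bsub>Alg d\<^esub> comb d T c' \<omega>' =
    comb d (S \<times> T) (\<lambda>(s, t). c s \<otimes> c' t) (\<lambda>(s, t). \<omega> s @ \<omega>' t)"
  using assms(1,3,4)
proof (induction S)
  case empty
  show ?case
    using Alg_l_zero[OF comb_closed[OF c' \<omega>']] by (simp add: comb_empty)
next
  case (insert x S)
  then have x: "c x \<in> carrier R" "\<omega> x \<in> free_semigroup d"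
    and S: "c \<in> S \<rightarrow> carrier R" "\<omega> \<in> S \<rightarrow> free_semigroup d" by auto
  let ?c = "\<lambda>(s, t). c s \<otimes> c' t" and ?\<omega> = "\<lambda>(s, t). \<omega> s @ \<omega>' t"
  have cl: "?c \<in> Z \<times> T \<rightarrow> carrier R" "?\<omega> \<in> Z \<times> T \<rightarrow> free_semigroup d" if "Z \<subseteq> insert x S" for Z
    using that x S c' \<omega>' by (fastforce intro!: append_free_semigroup)+
  have ins: "insert x S \<times> T = Pair x ` T \<union> S \<times> T" by auto
  have px: "Pair x ` T = {x} \<times> T" by auto
  have "comb d (insert x S \<times> T) ?c ?\<omega> = comb d (Pair x ` T) ?c ?\<omega> \<oplus>\<^bsub>Alg d\<^esub> comb d (S \<times> T) ?c ?\<omega>"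
    unfolding ins
  proof (rule comb_Un)
    show "?c \<in> Pair x ` T \<union> S \<times> T \<rightarrow> carrier R" "?\<omega> \<in> Pair x ` T \<union> S \<times> T \<rightarrow> free_semigroup d"
      unfolding ins[symmetric] by (rule cl; simp)+
  qed (use insert assms(2) in auto)
  also have "comb d (Pair x ` T) ?c ?\<omega> = comb d T (\<lambda>t. c x \<otimes> c' t) (\<lambda>t. \<omega> x @ \<omega>' t)"
    using comb_reindex[of "Pair x" T ?c ?\<omega> d] cl[of "{x}"] by (auto simp: px inj_on_def)
  also have "\<dots> = mon (c x) (\<omega> x) \<otimes>\<^bsub>Alg d\<^esub> comb d T c' \<omega>'"
    using mon_comb[OF assms(2) x c' \<omega>'] by simp
  also have "comb d (S \<times> T) ?c ?\<omega> = comb d S c \<omega> \<otimes>\<^bsub>Alg d\<^esub> comb d T c' \<omega>'"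
    using insert.IH[OF S] by simp
  finally show ?case
    unfolding comb_insert[OF insert.hyps insert.prems]
      Alg_l_distr[OF mon_closed[OF x] comb_closed[OF S] comb_closed[OF c' \<omega>']] by simp
qed

section \<open>Expansion of powers\<close>

definition tuples :: "'s set \<Rightarrow> nat \<Rightarrow> 's list set" where
  "tuples S n = {ss. set ss \<subseteq> S \<and> length ss = n}"

lemma finite_tuples: "finite S \<Longrightarrow> finite (tuples S n)"
  by (simp add: tuples_def finite_lists_length_eq)

lemma tuples_1: "tuples S (Suc 0) = (\<lambda>s. [s]) ` S"
  by (auto simp: tuples_def length_Suc_conv)

lemma tuples_Suc: "tuples S (Suc n) = (\<lambda>(ss, s). ss @ [s]) ` (tuples S n \<times> S)"
proof -
  have "ss \<in> (\<lambda>(ss, s). ss @ [s]) ` (tuples S n \<times> S)" if "ss \<in> tuples S (Suc n)" for ss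
    using that by (cases ss rule: rev_cases) (auto simp: tuples_def image_iff)
  then show ?thesis by (auto simp: tuples_def)
qed

definition cprod :: "('s \<Rightarrow> 'a) \<Rightarrow> 's list \<Rightarrow> 'a" where
  "cprod c ss = foldr (\<lambda>s x. c s \<otimes> x) ss \<one>"

lemma cprod_Nil [simp]: "cprod c [] = \<one>"
  and cprod_Cons [simp]: "cprod c (s # ss) = c s \<otimes> cprod c ss"
  by (simp_all add: cprod_def)

lemma cprod_closed: "c \<in> S \<rightarrow> carrier R \<Longrightarrow> set ss \<subseteq> S \<Longrightarrow> cprod c ss \<in> carrier R"
  by (induction ss) auto

lemma cprod_snoc:
  assumes "c \<in> S \<rightarrow> carrier R" "set ss \<subseteq> S" "s \<in> S"
  shows "cprod c (ss @ [s]) = cprod c ss \<otimes> c s"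
  using assms(2)
proof (induction ss)
  case (Cons a ss)
  then show ?case using assms cprod_closed[OF assms(1), of ss]
    by (auto simp: m_assoc Pi_def)
next
  case Nil
  then show ?case using funcset_mem[OF assms(1,3)] by simp
qed

lemma concat_free_semigroup:
  assumes "\<omega> \<in> S \<rightarrow> free_semigroup d" "set ss \<subseteq> S" "ss \<noteq> []"
  shows "concat (map \<omega> ss) \<in> free_semigroup d"
  using assms(2,3)
proof (induction ss)
  case (Cons a ss)
  then show ?case using assms(1)
    by (cases "ss = []") (auto intro!: append_free_semigroup)
qed simp

lemma tuples_closed:
  assumes "c \<in> S \<rightarrow> carrier R" "\<omega> \<in> S \<rightarrow> free_semigroup d" "n \<ge> 1"
  shows "cprod c \<in> tuples S n \<rightarrow> carrier R" "(\<lambda>ss. concat (map \<omega> ss)) \<in> tuples S n \<rightarrow> free_semigroup d"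
proof -
  show "cprod c \<in> tuples S n \<rightarrow> carrier R"
    by (rule funcsetI, rule cprod_closed[OF assms(1)]) (simp add: tuples_def)
  show "(\<lambda>ss. concat (map \<omega> ss)) \<in> tuples S n \<rightarrow> free_semigroup d"
    by (rule funcsetI, rule concat_free_semigroup[OF assms(2)]) (use assms(3) in \<open>auto simp: tuples_def\<close>)
qed

lemma pos_pow_1: "pos_pow G f (Suc 0) = f"
  by (simp add: pos_pow_def)

lemma pos_pow_Suc: "pos_pow G f (Suc (Suc n)) = pos_pow G f (Suc n) \<otimes>\<^bsub>G\<^esub> f"
proof -
  have "pos_pow G f (Suc (Suc n)) = foldl (monoid.mult G) f (replicate (Suc n) f)"
    by (simp add: pos_pow_def)
  also have "replicate (Suc n) f = replicate n f @ [f]"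
    by (simp add: replicate_append_same)
  finally show ?thesis by (simp add: pos_pow_def)
qed

text \<open>The noncommutative multinomial expansion. Tuples record the order of the factors, and no
  terms are merged.\<close>

lemma pow_comb:
  assumes "n \<ge> 1" "finite S" and c: "c \<in> S \<rightarrow> carrier R" and \<omega>: "\<omega> \<in> S \<rightarrow> free_semigroup d"
  shows "pos_pow (Alg d) (comb d S c \<omega>) n = comb d (tuples S n) (cprod c) (\<lambda>ss. concat (map \<omega> ss))"
  using assms(1)
proof (induction n rule: dec_induct)
  case base
  have "comb d (tuples S 1) (cprod c) (\<lambda>ss. concat (map \<omega> ss)) =
      comb d S (\<lambda>s. cprod c [s]) (\<lambda>s. concat (map \<omega> [s]))"
    using tuples_closed[OF c \<omega>, of 1] comb_reindex[of "\<lambda>s. [s]" S "cprod c" "\<lambda>ss. concat (map \<omega> ss)" d]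
    by (simp add: tuples_1 inj_on_def)
  also have "\<dots> = comb d S c \<omega>"
    using c \<omega> by (intro comb_cong) (auto simp: Pi_def)
  finally show ?case by (simp add: pos_pow_1)
next
  case (step n)
  let ?w = "\<lambda>ss. concat (map \<omega> ss)"
  have cl: "cprod c \<in> tuples S m \<rightarrow> carrier R" "?w \<in> tuples S m \<rightarrow> free_semigroup d" if "m \<ge> 1" for m
    using tuples_closed[OF c \<omega> that] by auto
  obtain m where m: "n = Suc m" using step by (cases n) auto
  have "pos_pow (Alg d) (comb d S c \<omega>) (Suc n) =
      comb d (tuples S n \<times> S) (\<lambda>(ss, s). cprod c ss \<otimes> c s) (\<lambda>(ss, s). ?w ss @ \<omega> s)"
    using step.IH pos_pow_Suc[of "Alg d" "comb d S c \<omega>" m]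
      comb_times[OF finite_tuples[OF assms(2)] assms(2) cl(1)[OF step.hyps(1)] cl(2)[OF step.hyps(1)] c \<omega>]
    by (simp add: m)
  also have "\<dots> = comb d (tuples S n \<times> S) (\<lambda>x. cprod c (case x of (ss, s) \<Rightarrow> ss @ [s]))
      (\<lambda>x. ?w (case x of (ss, s) \<Rightarrow> ss @ [s]))"
  proof (rule comb_cong)
    have "(case x of (ss, s) \<Rightarrow> ss @ [s]) \<in> tuples S (Suc n)" if "x \<in> tuples S n \<times> S" for x
      using that unfolding tuples_Suc by (rule imageI)
    then show "(\<lambda>x. cprod c (case x of (ss, s) \<Rightarrow> ss @ [s])) \<in> tuples S n \<times> S \<rightarrow> carrier R"
      "(\<lambda>x. ?w (case x of (ss, s) \<Rightarrow> ss @ [s])) \<in> tuples S n \<times> S \<rightarrow> free_semigroup d"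
      using cl[of "Suc n"] by (auto simp del: tuples_Suc)
  qed (use cprod_snoc[OF c] in \<open>auto simp: tuples_def\<close>)
  also have "\<dots> = comb d (tuples S (Suc n)) (cprod c) ?w"
    unfolding tuples_Suc using cl[of "Suc n"] unfolding tuples_Suc
    by (intro comb_reindex[symmetric]) (auto simp: inj_on_def)
  finally show ?case .
qed

lemma submodule_AlgI:
  assumes "J \<subseteq> carrier (Alg d)" "\<zero>\<^bsub>Alg d\<^esub> \<in> J"
    and "\<And>a b. a \<in> J \<Longrightarrow> b \<in> J \<Longrightarrow> a \<oplus>\<^bsub>Alg d\<^esub> b \<in> J"
    and smult: "\<And>c a. c \<in> carrier R \<Longrightarrow> a \<in> J \<Longrightarrow> c \<odot>\<^bsub>Alg d\<^esub> a \<in> J"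
  shows "submodule J R (Alg d)"
proof (rule A.submoduleI)
  fix a assume "a \<in> J"
  with assms(1) have "\<ominus>\<^bsub>Alg d\<^esub> a = (\<ominus> \<one>) \<odot>\<^bsub>Alg d\<^esub> a"
    by (subst A.smult_l_minus) auto
  with smult[OF _ \<open>a \<in> J\<close>] show "\<ominus>\<^bsub>Alg d\<^esub> a \<in> J" by simp
qed (use assms in auto)

lemma submodule_finsum:
  assumes "module R M" "submodule J R M" "finite S" "Z \<in> S \<rightarrow> J"
  shows "finsum M Z S \<in> J"
proof -
  interpret M: module R M by fact
  note sub = M.submoduleE[OF assms(2)]
  show ?thesis
    using assms(3,4)
  proof induction
    case empty
    then show ?case using subgroup.one_closed[OF submodule.axioms(1)[OF assms(2)]] by simp
  next
    case (insert x S)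
    then have "Z x \<in> J" "Z \<in> S \<rightarrow> J" "Z x \<in> carrier M" "Z \<in> S \<rightarrow> carrier M"
      using sub(1) by (auto simp: Pi_def)
    then show ?case
      using insert.IH sub(5) M.M.finsum_insert[OF insert.hyps] by auto
  qed
qed

section \<open>Homogeneous components of powers\<close>

primrec horner :: "('a, 'm, 'c) module_scheme \<Rightarrow> 'a \<Rightarrow> 'm list \<Rightarrow> 'm" where
  "horner M t [] = \<zero>\<^bsub>M\<^esub>"
| "horner M t (v # vs) = v \<oplus>\<^bsub>M\<^esub> t \<odot>\<^bsub>M\<^esub> horner M t vs"

text \<open>The quotient on division by the linear polynomial with root \<open>s\<close>,
  coefficients listed from the constant term upwards: its entries are the Horner values of the
  proper tails, and the remainder is \<open>horner M s vs\<close>.\<close>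

primrec synthetic_div :: "('a, 'm, 'c) module_scheme \<Rightarrow> 'a \<Rightarrow> 'm list \<Rightarrow> 'm list" where
  "synthetic_div M s [] = []"
| "synthetic_div M s (v # vs) = (if vs = [] then [] else horner M s vs # synthetic_div M s vs)"

lemma length_synthetic_div: "length (synthetic_div M s vs) = length vs - 1"
  by (induction vs) auto

lemma horner_closed:
  assumes "module R M" "t \<in> carrier R" "set vs \<subseteq> carrier M"
  shows "horner M t vs \<in> carrier M"
proof -
  interpret M: module R M by fact
  show ?thesis using assms(3) by (induction vs) (auto simp: assms(2))
qed

lemma synthetic_div_closed:
  assumes "module R M" "s \<in> carrier R" "set vs \<subseteq> carrier M"
  shows "set (synthetic_div M s vs) \<subseteq> carrier M"
  using assms(3) by (induction vs) (auto simp: horner_closed[OF assms(1,2)])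

lemma horner_synthetic_div:
  assumes "module R M" and t: "t \<in> carrier R" and s: "s \<in> carrier R" and "set vs \<subseteq> carrier M"
  shows "horner M t vs = (t \<ominus> s) \<odot>\<^bsub>M\<^esub> horner M t (synthetic_div M s vs) \<oplus>\<^bsub>M\<^esub> horner M s vs"
  using assms(4)
proof (induction vs)
  case Nil
  interpret M: module R M by fact
  show ?case using s t by simp
next
  case (Cons v vs)
  interpret M: module R M by fact
  show ?case
  proof (cases "vs = []")
    case True
    then show ?thesis using Cons.prems s t by simp
  next
    case False
    let ?a = "horner M s vs" and ?q = "horner M t (synthetic_div M s vs)"
    have vs: "v \<in> carrier M" "set vs \<subseteq> carrier M" using Cons.prems by auto
    note cl = vs(1) horner_closed[OF assms(1) s vs(2)]
      horner_closed[OF assms(1) t synthetic_div_closed[OF assms(1) s vs(2)]] minus_closed[OF t s]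
    have ts: "t \<odot>\<^bsub>M\<^esub> ?a = (t \<ominus> s) \<odot>\<^bsub>M\<^esub> ?a \<oplus>\<^bsub>M\<^esub> s \<odot>\<^bsub>M\<^esub> ?a"
    proof -
      have "t = (t \<ominus> s) \<oplus> s" using s t by algebra
      then have "t \<odot>\<^bsub>M\<^esub> ?a = ((t \<ominus> s) \<oplus> s) \<odot>\<^bsub>M\<^esub> ?a" by simp
      then show ?thesis using M.smult_l_distr[OF cl(4) s cl(2)] by simp
    qed
    have comm: "t \<odot>\<^bsub>M\<^esub> ((t \<ominus> s) \<odot>\<^bsub>M\<^esub> ?q) = (t \<ominus> s) \<odot>\<^bsub>M\<^esub> (t \<odot>\<^bsub>M\<^esub> ?q)"
      using t cl by (simp only: M.smult_assoc1[symmetric] m_comm[of t])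
    have IH: "horner M t vs = (t \<ominus> s) \<odot>\<^bsub>M\<^esub> ?q \<oplus>\<^bsub>M\<^esub> ?a"
      using Cons by simp
    have "horner M t (v # vs) = v \<oplus>\<^bsub>M\<^esub> ((t \<ominus> s) \<odot>\<^bsub>M\<^esub> (t \<odot>\<^bsub>M\<^esub> ?q) \<oplus>\<^bsub>M\<^esub> ((t \<ominus> s) \<odot>\<^bsub>M\<^esub> ?a \<oplus>\<^bsub>M\<^esub> s \<odot>\<^bsub>M\<^esub> ?a))"
      using t cl by (simp only: horner.simps IH M.smult_r_distr M.smult_closed comm ts)
    also have "\<dots> = ((t \<ominus> s) \<odot>\<^bsub>M\<^esub> ?a \<oplus>\<^bsub>M\<^esub> (t \<ominus> s) \<odot>\<^bsub>M\<^esub> (t \<odot>\<^bsub>M\<^esub> ?q)) \<oplus>\<^bsub>M\<^esub> (v \<oplus>\<^bsub>M\<^esub> s \<odot>\<^bsub>M\<^esub> ?a)"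
      using t s cl by (simp only: M.M.a_ac M.smult_closed M.M.a_closed)
    also have "\<dots> = (t \<ominus> s) \<odot>\<^bsub>M\<^esub> (?a \<oplus>\<^bsub>M\<^esub> t \<odot>\<^bsub>M\<^esub> ?q) \<oplus>\<^bsub>M\<^esub> horner M s (v # vs)"
      using t cl by (simp only: horner.simps M.smult_r_distr M.smult_closed)
    finally show ?thesis using False by simp
  qed
qed

text \<open>Inverts the division: each coefficient is the Horner value of the list starting with it
  minus \<open>s\<close> times the Horner value of the rest, and all these values are entries of the
  quotient or the remainder.\<close>

lemma coefficients_from_synthetic_div:
  assumes "module R M" "submodule H R M" "s \<in> carrier R" "set vs \<subseteq> carrier M"
    and "set (synthetic_div M s vs) \<subseteq> H" "horner M s vs \<in> H"
  shows "set vs \<subseteq> H"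
  using assms(4-6)
proof (induction vs)
  case (Cons v vs)
  interpret M: module R M by fact
  note sub = M.submoduleE[OF assms(2)]
  have cl: "v \<in> carrier M" "horner M s vs \<in> carrier M"
    using Cons.prems(1) by (auto intro!: horner_closed assms(1,3))
  show ?case
  proof (cases "vs = []")
    case True
    then show ?thesis using Cons.prems assms(3) by simp
  next
    case False
    with Cons.prems have H: "set (synthetic_div M s vs) \<subseteq> H" "horner M s vs \<in> H" by auto
    have "v = (v \<oplus>\<^bsub>M\<^esub> s \<odot>\<^bsub>M\<^esub> horner M s vs) \<oplus>\<^bsub>M\<^esub> \<ominus>\<^bsub>M\<^esub> (s \<odot>\<^bsub>M\<^esub> horner M s vs)"
      using cl assms(3) by (simp add: M.M.a_assoc M.M.r_neg)
    also have "\<dots> \<in> H"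
      using Cons.prems(3) sub(3)[OF sub(4)[OF assms(3) H(2)]] by - (rule sub(5), simp_all)
    finally show ?thesis using Cons.IH H Cons.prems(1) by simp
  qed
qed simp

text \<open>Takes the place of a Vandermonde determinant. For a fixed \<open>s\<close> in
  \<open>T\<close> the difference of the values at \<open>t\<close> and \<open>s\<close> is
  \<open>t - s\<close> times the value of the quotient; as \<open>t - s\<close> is invertible, the
  shorter quotient takes values in \<open>H\<close> on \<open>T - {s}\<close>, which is still
  infinite.\<close>

lemma horner_coefficients_in_submodule:
  assumes "module R M" "submodule H R M"
    and "infinite T" "T \<subseteq> carrier R" "set vs \<subseteq> carrier M" "\<And>t. t \<in> T \<Longrightarrow> horner M t vs \<in> H"
  shows "set vs \<subseteq> H"
  using assms(3-6)
proof (induction "length vs" arbitrary: vs T rule: less_induct)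
  case less
  interpret M: module R M by fact
  note sub = M.submoduleE[OF assms(2)]
  show ?case
  proof (cases "vs = []")
    case False
    obtain s where s: "s \<in> T" using less.prems(1) infinite_imp_nonempty by blast
    then have sR: "s \<in> carrier R" using less.prems(2) by blast
    let ?q = "synthetic_div M s vs"
    have qc: "set ?q \<subseteq> carrier M" by (rule synthetic_div_closed[OF assms(1) sR less.prems(3)])
    have "set ?q \<subseteq> H"
    proof (rule less.hyps)
      show "length ?q < length vs" using False by (simp add: length_synthetic_div)
      show "infinite (T - {s})" using less.prems(1) by simp
      show "T - {s} \<subseteq> carrier R" using less.prems(2) by auto
      fix t assume t: "t \<in> T - {s}"
      then have tR: "t \<in> carrier R" using less.prems(2) by blast
      have "t \<ominus> s \<noteq> \<zero>" using t tR sR by (simp add: r_right_minus_eq)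
      then have u: "t \<ominus> s \<in> Units R" using tR sR by (simp add: field_Units)
      have cl: "horner M t ?q \<in> carrier M" "horner M s vs \<in> carrier M"
        using horner_closed[OF assms(1) tR qc] horner_closed[OF assms(1) sR less.prems(3)] .
      have "(t \<ominus> s) \<odot>\<^bsub>M\<^esub> horner M t ?q = horner M t vs \<oplus>\<^bsub>M\<^esub> \<ominus>\<^bsub>M\<^esub> horner M s vs"
        unfolding horner_synthetic_div[OF assms(1) tR sR less.prems(3)]
        using cl tR sR by (simp add: M.M.a_assoc M.M.r_neg)
      also have "\<dots> \<in> H"
        using less.prems(4) s t sub(3) by (intro sub(5)) auto
      finally have in_H: "(t \<ominus> s) \<odot>\<^bsub>M\<^esub> horner M t ?q \<in> H" .
      have "horner M t ?q = inv (t \<ominus> s) \<odot>\<^bsub>M\<^esub> ((t \<ominus> s) \<odot>\<^bsub>M\<^esub> horner M t ?q)"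
        using u cl(1) tR sR by (simp add: M.smult_assoc1[symmetric])
      also have "\<dots> \<in> H" by (rule sub(4)[OF Units_inv_closed[OF u] in_H])
      finally show "horner M t ?q \<in> H" .
    qed (rule qc)
    then show ?thesis
      by (rule coefficients_from_synthetic_div[OF assms(1,2) sR less.prems(3) _ less.prems(4)[OF s]])
  qed simp
qed

lemma finsum_powers_horner:
  assumes "module R M" "t \<in> carrier R" "v \<in> {..N} \<rightarrow> carrier M"
  shows "(\<Oplus>\<^bsub>M\<^esub>m\<in>{..N}. t [^] (m :: nat) \<odot>\<^bsub>M\<^esub> v m) = horner M t (map v [0..<Suc N])"
  using assms(3)
proof (induction N arbitrary: v)
  case 0
  interpret M: module R M by fact
  show ?case using 0 assms(2) by (auto simp: M.M.finsum_0)
next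
  case (Suc N)
  interpret M: module R M by fact
  have v: "v m \<in> carrier M" if "m \<le> Suc N" for m using Suc.prems that by auto
  have "(\<Oplus>\<^bsub>M\<^esub>m\<in>{..Suc N}. t [^] m \<odot>\<^bsub>M\<^esub> v m) =
      (\<Oplus>\<^bsub>M\<^esub>m\<in>{..N}. t [^] Suc m \<odot>\<^bsub>M\<^esub> v (Suc m)) \<oplus>\<^bsub>M\<^esub> t [^] (0::nat) \<odot>\<^bsub>M\<^esub> v 0"
    using v assms(2) by (intro M.M.finsum_Suc2) auto
  also have "(\<Oplus>\<^bsub>M\<^esub>m\<in>{..N}. t [^] Suc m \<odot>\<^bsub>M\<^esub> v (Suc m)) =
      (\<Oplus>\<^bsub>M\<^esub>m\<in>{..N}. t \<odot>\<^bsub>M\<^esub> (t [^] m \<odot>\<^bsub>M\<^esub> v (Suc m)))"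
    using v assms(2) by (intro M.M.finsum_cong') (auto simp: M.smult_assoc1[symmetric] m_comm)
  also have "\<dots> = t \<odot>\<^bsub>M\<^esub> (\<Oplus>\<^bsub>M\<^esub>m\<in>{..N}. t [^] m \<odot>\<^bsub>M\<^esub> v (Suc m))"
    using v assms(2) by (intro M.finsum_smult_ldistr[symmetric]) auto
  also have "(\<Oplus>\<^bsub>M\<^esub>m\<in>{..N}. t [^] m \<odot>\<^bsub>M\<^esub> v (Suc m)) = horner M t (map (\<lambda>m. v (Suc m)) [0..<Suc N])"
    by (rule Suc.IH) (use v in auto)
  finally have eq: "(\<Oplus>\<^bsub>M\<^esub>m\<in>{..Suc N}. t [^] m \<odot>\<^bsub>M\<^esub> v m) =
      t \<odot>\<^bsub>M\<^esub> horner M t (map (\<lambda>m. v (Suc m)) [0..<Suc N]) \<oplus>\<^bsub>M\<^esub> v 0"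
    using v[of 0] assms(2) by simp
  have upt: "map v [0..<Suc (Suc N)] = v 0 # map (\<lambda>m. v (Suc m)) [0..<Suc N]"
    by (simp only: upt_conv_Cons[of 0 "Suc (Suc N)"] map_Suc_upt[symmetric] zero_less_Suc list.map map_map comp_def)
  have "horner M t (map (\<lambda>m. v (Suc m)) [0..<Suc N]) \<in> carrier M"
    using v by (intro horner_closed assms(1,2)) auto
  then show ?case
    unfolding eq upt horner.simps using v[of 0] assms(2) by (intro M.M.a_comm) auto
qed

lemma coefficients_in_submodule:
  fixes v :: "nat \<Rightarrow> 'm"
  assumes "module R M" "submodule H R M" "infinite (carrier R)"
    and v: "v \<in> {..N} \<rightarrow> carrier M"
    and H: "\<And>t. t \<in> carrier R \<Longrightarrow> (\<Oplus>\<^bsub>M\<^esub>m\<in>{..N}. t [^] m \<odot>\<^bsub>M\<^esub> v m) \<in> H"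
    and "m \<le> N"
  shows "v m \<in> H"
proof -
  have "set (map v [0..<Suc N]) \<subseteq> H"
  proof (rule horner_coefficients_in_submodule[OF assms(1,2,3) order_refl])
    show "set (map v [0..<Suc N]) \<subseteq> carrier M" using v by (auto simp del: upt_Suc)
    show "horner M t (map v [0..<Suc N]) \<in> H" if "t \<in> carrier R" for t
      using H[OF that] by (simp only: finsum_powers_horner[OF assms(1) that v])
  qed
  moreover have "v m \<in> set (map v [0..<Suc N])" using assms(6) by (auto simp del: upt_Suc)
  ultimately show ?thesis by blast
qed

section \<open>Ideals and graded parts of powers\<close>

lemma submodule_AlgE:
  assumes "submodule J R (Alg d)"
  shows "J \<subseteq> carrier (Alg d)" "\<zero>\<^bsub>Alg d\<^esub> \<in> J"
    and "\<And>a b. a \<in> J \<Longrightarrow> b \<in> J \<Longrightarrow> a \<oplus>\<^bsub>Alg d\<^esub> b \<in> J"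
    and "\<And>c a. c \<in> carrier R \<Longrightarrow> a \<in> J \<Longrightarrow> c \<odot>\<^bsub>Alg d\<^esub> a \<in> J"
    and "\<And>a. a \<in> J \<Longrightarrow> \<ominus>\<^bsub>Alg d\<^esub> a \<in> J"
  using A.submoduleE[OF assms] subgroup.one_closed[OF submodule.axioms(1)[OF assms]] by auto

text \<open>Every element is a finite sum of monomials, so absorption of monomials suffices by
  distributivity.\<close>

lemma algebra_ideal_monI:
  assumes J: "submodule J R (Alg d)"
    and l: "\<And>c u x. c \<in> carrier R \<Longrightarrow> u \<in> free_semigroup d \<Longrightarrow> x \<in> J \<Longrightarrow> mon c u \<otimes>\<^bsub>Alg d\<^esub> x \<in> J"
    and r: "\<And>c u x. c \<in> carrier R \<Longrightarrow> u \<in> free_semigroup d \<Longrightarrow> x \<in> J \<Longrightarrow> x \<otimes>\<^bsub>Alg d\<^esub> mon c u \<in> J"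
  shows "algebra_ideal R (Alg d) J"
proof -
  have "a \<otimes>\<^bsub>Alg d\<^esub> x \<in> J \<and> x \<otimes>\<^bsub>Alg d\<^esub> a \<in> J" if x: "x \<in> J" and a: "a \<in> carrier (Alg d)" for x a
  proof -
    have x': "x \<in> carrier (Alg d)" using x submodule_AlgE(1)[OF J] by blast
    have Pi: "(\<lambda>w. mon (a w) w) \<in> supp a \<rightarrow> carrier (Alg d)"
      using a by (auto simp: Alg_carrier intro!: mon_closed)
    have aw: "a w \<in> carrier R" "w \<in> free_semigroup d" if "w \<in> supp a" for w
      using that a by (auto simp: Alg_carrier)
    have "comb d (supp a) a (\<lambda>w. w) \<otimes>\<^bsub>Alg d\<^esub> x \<in> J \<and> x \<otimes>\<^bsub>Alg d\<^esub> comb d (supp a) a (\<lambda>w. w) \<in> J"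
      unfolding comb_def finsum_mult_l[OF finite_supp[OF a] Pi x'] finsum_mult_r[OF finite_supp[OF a] Pi x']
      by (intro conjI submodule_finsum[OF module_Alg J finite_supp[OF a]] funcsetI l r x aw)
    then show ?thesis by (simp add: comb_supp[OF a])
  qed
  with J show ?thesis by (simp add: algebra_ideal_def)
qed

lemma algebra_ideal_carrier: "algebra_ideal R (Alg d) (carrier (Alg d))"
  by (simp add: algebra_ideal_def A.carrier_is_submodule Alg_mult_closed)

lemma pos_pow_closed: "n \<ge> 1 \<Longrightarrow> f \<in> carrier (Alg d) \<Longrightarrow> pos_pow (Alg d) f n \<in> carrier (Alg d)"
proof (induction n rule: dec_induct)
  case (step n)
  then show ?case by (cases n) (auto simp: pos_pow_Suc Alg_mult_closed)
qed (simp add: pos_pow_1)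

text \<open>The induction principle for the nil ideal: a property is collected into a set
  \<open>J\<close>, which is shown to be an ideal containing all powers.\<close>

lemma nil_ideal_least:
  assumes "algebra_ideal R (Alg d) J" "\<And>f. f \<in> carrier (Alg d) \<Longrightarrow> pos_pow (Alg d) f n \<in> J"
  shows "nil_ideal R n d \<subseteq> J"
  using assms by (auto simp: nil_ideal_def generated_algebra_ideal_def)

lemma pos_pow_in_nil_ideal:
  "f \<in> carrier (Alg d) \<Longrightarrow> pos_pow (Alg d) f n \<in> nil_ideal R n d"
  by (auto simp: nil_ideal_def generated_algebra_ideal_def)

lemma algebra_ideal_nil_ideal:
  assumes "n \<ge> 1"
  shows "algebra_ideal R (Alg d) (nil_ideal R n d)"
proof -
  let ?J = "{J. algebra_ideal R (Alg d) J \<and> {pos_pow (Alg d) f n |f. f \<in> carrier (Alg d)} \<subseteq> J}"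
  have eq: "nil_ideal R n d = \<Inter>?J"
    by (simp add: nil_ideal_def generated_algebra_ideal_def)
  have sub: "submodule J R (Alg d)" if "J \<in> ?J" for J
    using that by (simp add: algebra_ideal_def)
  have "nil_ideal R n d \<subseteq> carrier (Alg d)"
    by (rule nil_ideal_least[OF algebra_ideal_carrier pos_pow_closed[OF assms]])
  then have "submodule (nil_ideal R n d) R (Alg d)"
  proof (rule submodule_AlgI)
    show "\<zero>\<^bsub>Alg d\<^esub> \<in> nil_ideal R n d"
      unfolding eq using submodule_AlgE(2)[OF sub] by blast
    show "a \<oplus>\<^bsub>Alg d\<^esub> b \<in> nil_ideal R n d" if "a \<in> nil_ideal R n d" "b \<in> nil_ideal R n d" for a b
      using that unfolding eq using submodule_AlgE(3)[OF sub] by blast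
    show "c \<odot>\<^bsub>Alg d\<^esub> a \<in> nil_ideal R n d" if "c \<in> carrier R" "a \<in> nil_ideal R n d" for c a
      using that unfolding eq using submodule_AlgE(4)[OF sub] by blast
  qed
  then show ?thesis
    unfolding algebra_ideal_def by (auto simp: eq algebra_ideal_def)
qed

lemma nil_ideal_submodule: "n \<ge> 1 \<Longrightarrow> submodule (nil_ideal R n d) R (Alg d)"
  using algebra_ideal_nil_ideal by (simp add: algebra_ideal_def)

lemma sum_graded_comb:
  assumes "finite T" "c \<in> T \<rightarrow> carrier R" "\<omega> \<in> T \<rightarrow> free_semigroup d" "t \<in> carrier R"
  shows "(\<Oplus>\<^bsub>Alg d\<^esub>m\<in>{..N}. t [^] m \<odot>\<^bsub>Alg d\<^esub> comb d {s \<in> T. D s = m} c \<omega>) =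
    comb d {s \<in> T. D s \<le> N} (\<lambda>s. t [^] (D s :: nat) \<otimes> c s) \<omega>"
proof -
  have piece: "t [^] m \<odot>\<^bsub>Alg d\<^esub> comb d {s \<in> T. D s = m} c \<omega> =
      comb d {s \<in> T. D s = m} (\<lambda>s. t [^] D s \<otimes> c s) \<omega>" for m
  proof -
    have "t [^] m \<odot>\<^bsub>Alg d\<^esub> comb d {s \<in> T. D s = m} c \<omega> =
        comb d {s \<in> T. D s = m} (\<lambda>s. t [^] m \<otimes> c s) \<omega>"
      using assms by (intro smult_comb) auto
    also have "\<dots> = comb d {s \<in> T. D s = m} (\<lambda>s. t [^] D s \<otimes> c s) \<omega>"
      using assms by (intro comb_cong) auto
    finally show ?thesis .
  qed
  have cl: "comb d {s \<in> T. P s} (\<lambda>s. t [^] D s \<otimes> c s) \<omega> \<in> carrier (Alg d)" for P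
    using assms by (intro comb_closed) auto
  show ?thesis
    unfolding piece
  proof (induction N)
    case 0
    then show ?case using cl by (subst A.M.finsum_0) auto
  next
    case (Suc N)
    have "{s \<in> T. D s \<le> Suc N} = {s \<in> T. D s = Suc N} \<union> {s \<in> T. D s \<le> N}" by auto
    then have "comb d {s \<in> T. D s \<le> Suc N} (\<lambda>s. t [^] D s \<otimes> c s) \<omega> =
        comb d {s \<in> T. D s = Suc N} (\<lambda>s. t [^] D s \<otimes> c s) \<omega> \<oplus>\<^bsub>Alg d\<^esub>
        comb d {s \<in> T. D s \<le> N} (\<lambda>s. t [^] D s \<otimes> c s) \<omega>"
      using assms by (simp only:, intro comb_Un) auto
    then show ?case using Suc.IH cl by (subst A.M.finsum_Suc) auto
  qed
qed

lemma cprod_scaled: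
  assumes "c \<in> S \<rightarrow> carrier R" "t \<in> carrier R" "set ss \<subseteq> S"
  shows "cprod (\<lambda>s. t [^] (\<delta> s :: nat) \<otimes> c s) ss = t [^] sum_list (map \<delta> ss) \<otimes> cprod c ss"
  using assms(3)
proof (induction ss)
  case (Cons s ss)
  then have "c s \<in> carrier R" "cprod c ss \<in> carrier R" "t [^] \<delta> s \<in> carrier R"
     "t [^] sum_list (map \<delta> ss) \<in> carrier R"
    using assms cprod_closed[OF assms(1), of ss] by auto
  then have "(t [^] \<delta> s \<otimes> c s) \<otimes> (t [^] sum_list (map \<delta> ss) \<otimes> cprod c ss) =
      (t [^] \<delta> s \<otimes> t [^] sum_list (map \<delta> ss)) \<otimes> (c s \<otimes> cprod c ss)"
    by algebra
  with Cons assms show ?case by (simp add: nat_pow_mult)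
qed (use assms in auto)

text \<open>Scaling the coefficient of index \<open>s\<close> by \<open>t^(\<delta> s)\<close> gives
  another element of the algebra, whose power lies in the ideal for every \<open>t\<close>. This
  power is a polynomial in \<open>t\<close> with the graded parts as coefficients, and an infinite
  field separates them. Since weights sit on indices, one lemma serves both the degree in
  \<open>g\<close> and the degree in a letter.\<close>

lemma graded_pow_in_nil_ideal:
  fixes \<delta> :: "'s \<Rightarrow> nat"
  assumes "infinite (carrier R)" "n \<ge> 1" "finite S"
    and c: "c \<in> S \<rightarrow> carrier R" and \<omega>: "\<omega> \<in> S \<rightarrow> free_semigroup d"
  shows "comb d {ss \<in> tuples S n. sum_list (map \<delta> ss) = m} (cprod c) (\<lambda>ss. concat (map \<omega> ss))
    \<in> nil_ideal R n d"
proof -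
  let ?T = "tuples S n" and ?D = "\<lambda>ss. sum_list (map \<delta> ss)" and ?w = "\<lambda>ss. concat (map \<omega> ss)"
  note cl = tuples_closed[OF c \<omega> assms(2)] and fin = finite_tuples[OF assms(3), of n]
  obtain N where N: "\<forall>x\<in>?D ` ?T. x \<le> N"
    using fin finite_nat_set_iff_bounded_le by blast
  \<comment> \<open>Large enough to cover every weight that occurs as well as \<open>m\<close>
    itself, which may exceed all of them.\<close>
  define N' where "N' = max m N"
  have *: "(\<Oplus>\<^bsub>Alg d\<^esub>m\<in>{..N'}. t [^] m \<odot>\<^bsub>Alg d\<^esub> comb d {ss \<in> ?T. ?D ss = m} (cprod c) ?w)
      \<in> nil_ideal R n d" if t: "t \<in> carrier R" for t
  proof -
    have sc: "(\<lambda>s. t [^] \<delta> s \<otimes> c s) \<in> S \<rightarrow> carrier R" using t c by auto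
    have "(\<Oplus>\<^bsub>Alg d\<^esub>m\<in>{..N'}. t [^] m \<odot>\<^bsub>Alg d\<^esub> comb d {ss \<in> ?T. ?D ss = m} (cprod c) ?w) =
        comb d {ss \<in> ?T. ?D ss \<le> N'} (\<lambda>ss. t [^] ?D ss \<otimes> cprod c ss) ?w"
      by (rule sum_graded_comb[OF fin cl t])
    also have "\<dots> = comb d ?T (cprod (\<lambda>s. t [^] \<delta> s \<otimes> c s)) ?w"
    proof (rule comb_cong)
      show "{ss \<in> ?T. ?D ss \<le> N'} = ?T" using N by (auto simp: N'_def)
      show "t [^] ?D ss \<otimes> cprod c ss = cprod (\<lambda>s. t [^] \<delta> s \<otimes> c s) ss" if "ss \<in> ?T" for ss
        using cprod_scaled[OF c t, of ss \<delta>] that by (simp add: tuples_def)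
    qed (use tuples_closed[OF sc \<omega> assms(2)] in auto)
    also have "\<dots> = pos_pow (Alg d) (comb d S (\<lambda>s. t [^] \<delta> s \<otimes> c s) \<omega>) n"
      by (rule pow_comb[OF assms(2,3) sc \<omega>, symmetric])
    also have "\<dots> \<in> nil_ideal R n d"
      by (rule pos_pow_in_nil_ideal[OF comb_closed[OF sc \<omega>]])
    finally show ?thesis .
  qed
  show ?thesis
  proof (rule coefficients_in_submodule[OF module_Alg nil_ideal_submodule[OF assms(2)] assms(1) _ *])
    show "(\<lambda>m. comb d {ss \<in> ?T. ?D ss = m} (cprod c) ?w) \<in> {..N'} \<rightarrow> carrier (Alg d)"
      using cl by (auto intro!: comb_closed)
  qed (simp_all add: N'_def)
qed

section \<open>Substitutions and multihomogeneous components\<close>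

text \<open>The map \<open>\<theta>\<close> of words need not respect concatenation: it may be
  \<open>pad\<close>, or attach flanks that are possibly empty and so are not elements of the
  algebra.\<close>

definition lin :: "nat \<Rightarrow> (nat list \<Rightarrow> nat list) \<Rightarrow> (nat list \<Rightarrow> 'a) \<Rightarrow> nat list \<Rightarrow> 'a" where
  "lin d \<theta> f = comb d (supp f) f \<theta>"

lemma Alg_funcsets:
  assumes "f \<in> carrier (Alg d)" "\<theta> \<in> free_semigroup d \<rightarrow> free_semigroup e"
  shows "f \<in> S \<rightarrow> carrier R" "\<theta> \<in> supp f \<rightarrow> free_semigroup e"
  using assms by (auto simp: Alg_carrier)

lemma lin_closed:
  "f \<in> carrier (Alg d) \<Longrightarrow> \<theta> \<in> free_semigroup d \<rightarrow> free_semigroup e \<Longrightarrow> lin e \<theta> f \<in> carrier (Alg e)"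
  unfolding lin_def by (intro comb_closed Alg_funcsets)

lemma lin_superset:
  assumes "f \<in> carrier (Alg d)" "\<theta> \<in> free_semigroup d \<rightarrow> free_semigroup e"
    "finite T" "supp f \<subseteq> T" "T \<subseteq> free_semigroup d"
  shows "lin e \<theta> f = comb e T f \<theta>"
  unfolding lin_def
  by (rule comb_subset) (use assms in \<open>auto simp: Alg_carrier supp_def\<close>)

lemma comb_add:
  assumes "c \<in> S \<rightarrow> carrier R" "c' \<in> S \<rightarrow> carrier R" "\<omega> \<in> S \<rightarrow> free_semigroup d"
  shows "comb d S (\<lambda>s. c s \<oplus> c' s) \<omega> = comb d S c \<omega> \<oplus>\<^bsub>Alg d\<^esub> comb d S c' \<omega>"
  unfolding comb_def add_mon[symmetric, where d = d] using assms
  by (intro A.M.finsum_addf mon_Pi)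

lemma lin_add:
  assumes f: "f \<in> carrier (Alg d)" and g: "g \<in> carrier (Alg d)"
    and \<theta>: "\<theta> \<in> free_semigroup d \<rightarrow> free_semigroup e"
  shows "lin e \<theta> (f \<oplus>\<^bsub>Alg d\<^esub> g) = lin e \<theta> f \<oplus>\<^bsub>Alg e\<^esub> lin e \<theta> g"
proof -
  let ?T = "supp f \<union> supp g"
  have T: "finite ?T" "?T \<subseteq> free_semigroup d" using f g by (auto simp: Alg_carrier)
  have sub: "supp f \<subseteq> ?T" "supp g \<subseteq> ?T" "supp (f \<oplus>\<^bsub>Alg d\<^esub> g) \<subseteq> ?T"
    by (auto simp: supp_def Alg_add)
  have th: "\<theta> \<in> ?T \<rightarrow> free_semigroup e" using \<theta> T(2) by auto
  have "lin e \<theta> (f \<oplus>\<^bsub>Alg d\<^esub> g) = comb e ?T (f \<oplus>\<^bsub>Alg d\<^esub> g) \<theta>"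
    by (rule lin_superset[OF A.M.a_closed[OF f g] \<theta> T(1) sub(3) T(2)])
  also have "\<dots> = comb e ?T f \<theta> \<oplus>\<^bsub>Alg e\<^esub> comb e ?T g \<theta>"
    unfolding Alg_add[where f = f and g = g] by (rule comb_add[OF Alg_funcsets(1)[OF f \<theta>] Alg_funcsets(1)[OF g \<theta>] th])
  finally show ?thesis
    by (simp only: lin_superset[OF f \<theta> T(1) sub(1) T(2)] lin_superset[OF g \<theta> T(1) sub(2) T(2)])
qed

lemma lin_smult:
  assumes f: "f \<in> carrier (Alg d)" and c: "c \<in> carrier R"
    and \<theta>: "\<theta> \<in> free_semigroup d \<rightarrow> free_semigroup e"
  shows "lin e \<theta> (c \<odot>\<^bsub>Alg d\<^esub> f) = c \<odot>\<^bsub>Alg e\<^esub> lin e \<theta> f"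
proof -
  have sub: "supp (c \<odot>\<^bsub>Alg d\<^esub> f) \<subseteq> supp f" using c by (auto simp: supp_def Alg_smult)
  have "lin e \<theta> (c \<odot>\<^bsub>Alg d\<^esub> f) = comb e (supp f) (c \<odot>\<^bsub>Alg d\<^esub> f) \<theta>"
    by (rule lin_superset[OF A.smult_closed[OF c f] \<theta> finite_supp[OF f] sub supp_subset[OF f]])
  then show ?thesis
    unfolding Alg_smult[where f = f and c = c] lin_def
    by (simp only: smult_comb[OF finite_supp[OF f] c Alg_funcsets[OF f \<theta>]])
qed

lemma lin_zero: "lin e \<theta> \<zero>\<^bsub>Alg d\<^esub> = \<zero>\<^bsub>Alg e\<^esub>"
  by (simp add: lin_def supp_def Alg_zero comb_def)

lemma lin_mon:
  assumes "c \<in> carrier R" "w \<in> free_semigroup d" "\<theta> \<in> free_semigroup d \<rightarrow> free_semigroup e"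
  shows "lin e \<theta> (mon c w) = mon c (\<theta> w)"
proof -
  have "lin e \<theta> (mon c w) = comb e {w} (mon c w) \<theta>"
    by (rule lin_superset[OF mon_closed[OF assms(1,2)] assms(3)])
       (use assms(2) in \<open>auto simp: supp_def mon_def\<close>)
  also have "\<dots> = mon c (\<theta> w)"
    using comb_insert[of "{}" w "mon c w" \<theta> e] assms mon_closed[of c "\<theta> w" e]
    by (auto simp: comb_empty mon_def[of c w])
  finally show ?thesis .
qed

lemma lin_comb:
  assumes "finite S" "c \<in> S \<rightarrow> carrier R" "\<omega> \<in> S \<rightarrow> free_semigroup d"
    and \<theta>: "\<theta> \<in> free_semigroup d \<rightarrow> free_semigroup e"
  shows "lin e \<theta> (comb d S c \<omega>) = comb e S c (\<lambda>s. \<theta> (\<omega> s))"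
  using assms(1-3)
proof induction
  case empty
  show ?case by (simp only: comb_empty lin_zero)
next
  case (insert s S)
  then have s: "c s \<in> carrier R" "\<omega> s \<in> free_semigroup d"
    and S: "c \<in> S \<rightarrow> carrier R" "\<omega> \<in> S \<rightarrow> free_semigroup d" by auto
  have th: "(\<lambda>s. \<theta> (\<omega> s)) \<in> insert s S \<rightarrow> free_semigroup e"
    using insert.prems(2) \<theta> by auto
  show ?case
    by (simp only: comb_insert[OF insert.hyps insert.prems] comb_insert[OF insert.hyps insert.prems(1) th]
        lin_add[OF mon_closed[OF s] comb_closed[OF S] \<theta>] lin_mon[OF s \<theta>] insert.IH[OF S])
qed

lemma lin_lin:
  assumes f: "f \<in> carrier (Alg d)" and \<theta>: "\<theta> \<in> free_semigroup d \<rightarrow> free_semigroup e"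
    and \<theta>': "\<theta>' \<in> free_semigroup e \<rightarrow> free_semigroup e'"
  shows "lin e' \<theta>' (lin e \<theta> f) = lin e' (\<lambda>w. \<theta>' (\<theta> w)) f"
  unfolding lin_def[of e \<theta> f] lin_comb[OF finite_supp[OF f] Alg_funcsets[OF f \<theta>] \<theta>']
  by (simp only: lin_def)

lemma lin_id: "f \<in> carrier (Alg d) \<Longrightarrow> lin d (\<lambda>w. w) f = f"
  by (simp only: lin_def comb_supp)

lemma append_funcset:
  assumes "u \<in> free_semigroup d"
  shows "(\<lambda>w. u @ w) \<in> free_semigroup d \<rightarrow> free_semigroup d"
    "(\<lambda>w. w @ u) \<in> free_semigroup d \<rightarrow> free_semigroup d"
  using assms by (auto intro: append_free_semigroup)

lemma mon_times:
  assumes f: "f \<in> carrier (Alg d)" and c: "c \<in> carrier R" and u: "u \<in> free_semigroup d"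
  shows "mon c u \<otimes>\<^bsub>Alg d\<^esub> f = c \<odot>\<^bsub>Alg d\<^esub> lin d (\<lambda>w. u @ w) f"
proof -
  have id: "(\<lambda>w. w) \<in> supp f \<rightarrow> free_semigroup d" using supp_subset[OF f] by auto
  note fs = Alg_funcsets[OF f append_funcset(1)[OF u]]
  have "mon c u \<otimes>\<^bsub>Alg d\<^esub> comb d (supp f) f (\<lambda>w. w) = c \<odot>\<^bsub>Alg d\<^esub> lin d (\<lambda>w. u @ w) f"
    unfolding lin_def mon_comb[OF finite_supp[OF f] c u fs(1) id] smult_comb[OF finite_supp[OF f] c fs] ..
  then show ?thesis by (simp only: comb_supp[OF f])
qed

lemma times_mon:
  assumes f: "f \<in> carrier (Alg d)" and c: "c \<in> carrier R" and u: "u \<in> free_semigroup d"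
  shows "f \<otimes>\<^bsub>Alg d\<^esub> mon c u = c \<odot>\<^bsub>Alg d\<^esub> lin d (\<lambda>w. w @ u) f"
proof -
  have id: "(\<lambda>w. w) \<in> supp f \<rightarrow> free_semigroup d" using supp_subset[OF f] by auto
  note fs = Alg_funcsets[OF f append_funcset(2)[OF u]]
  have "comb d (supp f) f (\<lambda>w. w) \<otimes>\<^bsub>Alg d\<^esub> mon c u = c \<odot>\<^bsub>Alg d\<^esub> lin d (\<lambda>w. w @ u) f"
    unfolding lin_def comb_mon[OF finite_supp[OF f] c u fs(1) id] smult_comb[OF finite_supp[OF f] c fs]
    using fs c Alg_closed[OF f] by (intro comb_cong) (auto simp: m_comm)
  then show ?thesis by (simp only: comb_supp[OF f])
qed

lemma lin_mon_times:
  assumes f: "f \<in> carrier (Alg d)" and c: "c \<in> carrier R" and u: "u \<in> free_semigroup d"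
    and \<theta>: "\<theta> \<in> free_semigroup d \<rightarrow> free_semigroup e"
  shows "lin e \<theta> (mon c u \<otimes>\<^bsub>Alg d\<^esub> f) = c \<odot>\<^bsub>Alg e\<^esub> lin e (\<lambda>w. \<theta> (u @ w)) f"
    and "lin e \<theta> (f \<otimes>\<^bsub>Alg d\<^esub> mon c u) = c \<odot>\<^bsub>Alg e\<^esub> lin e (\<lambda>w. \<theta> (w @ u)) f"
  unfolding mon_times[OF f c u] times_mon[OF f c u]
    lin_smult[OF lin_closed[OF f append_funcset(1)[OF u]] c \<theta>]
    lin_smult[OF lin_closed[OF f append_funcset(2)[OF u]] c \<theta>]
    lin_lin[OF f append_funcset(1)[OF u] \<theta>] lin_lin[OF f append_funcset(2)[OF u] \<theta>] by simp_all

lemma nil_ideal_subset: "n \<ge> 1 \<Longrightarrow> nil_ideal R n d \<subseteq> carrier (Alg d)"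
  using submodule_AlgE(1)[OF nil_ideal_submodule] .

lemma nil_ideal_mult:
  assumes "n \<ge> 1" "x \<in> nil_ideal R n d" "a \<in> carrier (Alg d)"
  shows "a \<otimes>\<^bsub>Alg d\<^esub> x \<in> nil_ideal R n d" "x \<otimes>\<^bsub>Alg d\<^esub> a \<in> nil_ideal R n d"
  using algebra_ideal_nil_ideal[OF assms(1), of d] assms(2,3) unfolding algebra_ideal_def by blast+

lemma nil_ideal_shift:
  assumes n: "n \<ge> 1" and f: "f \<in> nil_ideal R n d" and "set p \<subseteq> {1..d}" "set q \<subseteq> {1..d}"
  shows "lin d (\<lambda>w. p @ w @ q) f \<in> nil_ideal R n d"
proof -
  \<comment> \<open>The empty flank has no monomial in a non-unital algebra and is treated as the
    identity map.\<close>
  have *: "u = [] \<or> u \<in> free_semigroup d" if "set u \<subseteq> {1..d}" for u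
    using that by (auto simp: free_semigroup_def)
  have ideal: "mon \<one> u \<otimes>\<^bsub>Alg d\<^esub> g \<in> nil_ideal R n d" "g \<otimes>\<^bsub>Alg d\<^esub> mon \<one> u \<in> nil_ideal R n d"
    if "g \<in> nil_ideal R n d" "u \<in> free_semigroup d" for u g
    using nil_ideal_mult[OF n that(1) mon_closed[OF one_closed that(2)]] by auto
  have l: "lin d (\<lambda>w. u @ w) g \<in> nil_ideal R n d"
    if g: "g \<in> nil_ideal R n d" and u: "set u \<subseteq> {1..d}" for u g
  proof -
    have gc: "g \<in> carrier (Alg d)" using g nil_ideal_subset[OF n] by blast
    show ?thesis
      using *[OF u] mon_times[OF gc one_closed, of u] ideal(1)[OF g, of u] g
        lin_closed[OF gc append_funcset(1), of u] by (auto simp: lin_id[OF gc])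
  qed
  have r: "lin d (\<lambda>w. w @ u) g \<in> nil_ideal R n d"
    if g: "g \<in> nil_ideal R n d" and u: "set u \<subseteq> {1..d}" for u g
  proof -
    have gc: "g \<in> carrier (Alg d)" using g nil_ideal_subset[OF n] by blast
    show ?thesis
      using *[OF u] times_mon[OF gc one_closed, of u] ideal(2)[OF g, of u] g
        lin_closed[OF gc append_funcset(2), of u] by (auto simp: lin_id[OF gc])
  qed
  have "lin d (\<lambda>w. p @ w) (lin d (\<lambda>w. w @ q) f) \<in> nil_ideal R n d"
    by (intro l r f assms)
  also have "lin d (\<lambda>w. p @ w) (lin d (\<lambda>w. w @ q) f) = lin d (\<lambda>w. p @ w @ q) f"
    using f nil_ideal_subset[OF n] assms(3,4)
    by (intro lin_lin[where d = d]) (auto simp: free_semigroup_def)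
  finally show ?thesis .
qed

lemma subst_funcset:
  assumes \<sigma>: "\<sigma> \<in> {1..d} \<rightarrow> free_semigroup e" and "set p \<subseteq> {1..e}" "set q \<subseteq> {1..e}"
  shows "(\<lambda>w. p @ concat (map \<sigma> w) @ q) \<in> free_semigroup d \<rightarrow> free_semigroup e"
proof
  fix w assume "w \<in> free_semigroup d"
  then have "concat (map \<sigma> w) \<in> free_semigroup e"
    by (intro concat_free_semigroup[OF \<sigma>]) (auto simp: free_semigroup_def)
  then show "p @ concat (map \<sigma> w) @ q \<in> free_semigroup e"
    using assms(2,3) by (auto simp: free_semigroup_def)
qed

text \<open>Substitution of words for letters maps powers to powers. The flanks are included because
  a monomial multiplied to an element of the ideal is absorbed into them after substitution.\<close>

lemma nil_ideal_subst:
  assumes n: "n \<ge> 1" and \<sigma>: "\<sigma> \<in> {1..d} \<rightarrow> free_semigroup e"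
    and "f \<in> nil_ideal R n d" "set p \<subseteq> {1..e}" "set q \<subseteq> {1..e}"
  shows "lin e (\<lambda>w. p @ concat (map \<sigma> w) @ q) f \<in> nil_ideal R n e"
proof -
  define \<theta> where "\<theta> p q w = p @ concat (map \<sigma> w) @ q" for p q w
  \<comment> \<open>All flanks are quantified inside \<open>J\<close>: multiplying by
    \<open>u\<close> replaces \<open>p\<close> by \<open>p @ concat (map \<sigma> u)\<close>, or
    \<open>q\<close> by the corresponding word, and the property is then needed for the new
    flank.\<close>
  define J where "J = {f \<in> carrier (Alg d). \<forall>p q. set p \<subseteq> {1..e} \<longrightarrow> set q \<subseteq> {1..e} \<longrightarrow>
      lin e (\<theta> p q) f \<in> nil_ideal R n e}"
  have \<theta>: "\<theta> p q \<in> free_semigroup d \<rightarrow> free_semigroup e"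
    if "set p \<subseteq> {1..e}" "set q \<subseteq> {1..e}" for p q
    using subst_funcset[OF \<sigma> that] by (simp add: \<theta>_def[abs_def])
  note I = submodule_AlgE[OF nil_ideal_submodule[OF n, of e]]
  have \<sigma>': "set (concat (map \<sigma> u)) \<subseteq> {1..e}" if "u \<in> free_semigroup d" for u
    using \<theta>[of "[]" "[]"] that by (auto simp: \<theta>_def Pi_def free_semigroup_def)
  have "nil_ideal R n d \<subseteq> J"
  proof (rule nil_ideal_least[OF algebra_ideal_monI])
    show "submodule J R (Alg d)"
    proof (rule submodule_AlgI)
      show "a \<oplus>\<^bsub>Alg d\<^esub> b \<in> J" if "a \<in> J" "b \<in> J" for a b
        using that I(3) by (simp add: J_def lin_add[OF _ _ \<theta>])
      show "c \<odot>\<^bsub>Alg d\<^esub> a \<in> J" if "c \<in> carrier R" "a \<in> J" for c a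
        using that I(4) by (simp add: J_def lin_smult[OF _ _ \<theta>])
      show "\<zero>\<^bsub>Alg d\<^esub> \<in> J" using I(2) by (simp add: J_def lin_zero)
    qed (simp add: J_def)
  next
    fix c u x assume c: "c \<in> carrier R" and u: "u \<in> free_semigroup d" and x: "x \<in> J"
    then have xc: "x \<in> carrier (Alg d)" by (simp add: J_def)
    have "lin e (\<theta> p q) (mon c u \<otimes>\<^bsub>Alg d\<^esub> x) \<in> nil_ideal R n e"
      if pq: "set p \<subseteq> {1..e}" "set q \<subseteq> {1..e}" for p q
    proof -
      have "lin e (\<theta> p q) (mon c u \<otimes>\<^bsub>Alg d\<^esub> x) = c \<odot>\<^bsub>Alg e\<^esub> lin e (\<theta> (p @ concat (map \<sigma> u)) q) x"
        unfolding lin_mon_times(1)[OF xc c u \<theta>[OF pq]] by (simp add: \<theta>_def[abs_def])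
      then show ?thesis using x \<sigma>'[OF u] pq c I(4) by (auto simp: J_def)
    qed
    then show "mon c u \<otimes>\<^bsub>Alg d\<^esub> x \<in> J"
      using Alg_mult_closed[OF mon_closed[OF c u] xc] by (simp add: J_def)
    have "lin e (\<theta> p q) (x \<otimes>\<^bsub>Alg d\<^esub> mon c u) \<in> nil_ideal R n e"
      if pq: "set p \<subseteq> {1..e}" "set q \<subseteq> {1..e}" for p q
    proof -
      have "lin e (\<theta> p q) (x \<otimes>\<^bsub>Alg d\<^esub> mon c u) = c \<odot>\<^bsub>Alg e\<^esub> lin e (\<theta> p (concat (map \<sigma> u) @ q)) x"
        unfolding lin_mon_times(2)[OF xc c u \<theta>[OF pq]] by (simp add: \<theta>_def[abs_def])
      then show ?thesis using x \<sigma>'[OF u] pq c I(4) by (auto simp: J_def)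
    qed
    then show "x \<otimes>\<^bsub>Alg d\<^esub> mon c u \<in> J"
      using Alg_mult_closed[OF xc mon_closed[OF c u]] by (simp add: J_def)
  next
    fix f assume f: "f \<in> carrier (Alg d)"
    have id: "(\<lambda>w. w) \<in> supp f \<rightarrow> free_semigroup d" using supp_subset[OF f] by auto
    note fs = Alg_funcsets[OF f \<theta>[of "[]" "[]"], simplified]
    note cl = tuples_closed[OF fs(1) id n] and cl' = tuples_closed[OF fs n]
    have pow: "pos_pow (Alg d) f n = comb d (tuples (supp f) n) (cprod f) (\<lambda>ss. concat (map (\<lambda>w. w) ss))"
      using pow_comb[OF n finite_supp[OF f] fs(1) id] by (simp only: comb_supp[OF f])
    have "lin e (\<theta> p q) (pos_pow (Alg d) f n) \<in> nil_ideal R n e"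
      if pq: "set p \<subseteq> {1..e}" "set q \<subseteq> {1..e}" for p q
    proof -
      \<comment> \<open>The expansion of the \<open>n\<close>-th power of the image of
        \<open>f\<close> under the substitution, over the same tuples as the expansion of the power
        of \<open>f\<close>.\<close>
      let ?g = "comb e (tuples (supp f) n) (cprod f) (\<lambda>ss. concat (map (\<theta> [] []) ss))"
      have "?g \<in> nil_ideal R n e"
        unfolding pow_comb[OF n finite_supp[OF f] fs, symmetric]
        by (rule pos_pow_in_nil_ideal[OF comb_closed[OF fs]])
      then have "lin e (\<lambda>w. p @ w @ q) ?g \<in> nil_ideal R n e"
        by (rule nil_ideal_shift[OF n _ pq])
      also have "lin e (\<lambda>w. p @ w @ q) ?g = comb e (tuples (supp f) n) (cprod f)
          (\<lambda>ss. p @ concat (map (\<theta> [] []) ss) @ q)"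
        using pq by (intro lin_comb[OF finite_tuples[OF finite_supp[OF f]] cl']) (auto simp: free_semigroup_def)
      also have "\<dots> = comb e (tuples (supp f) n) (cprod f) (\<lambda>ss. \<theta> p q (concat (map (\<lambda>w. w) ss)))"
      proof -
        have "p @ concat (map (\<theta> [] []) ss) @ q = \<theta> p q (concat ss)" for ss
        proof -
          have "concat (map (\<theta> [] []) ss) = concat (map \<sigma> (concat ss))"
            by (induction ss) (auto simp: \<theta>_def)
          then show ?thesis by (simp add: \<theta>_def)
        qed
        then show ?thesis by simp
      qed
      also have "\<dots> = lin e (\<theta> p q) (pos_pow (Alg d) f n)"
        unfolding pow by (rule lin_comb[OF finite_tuples[OF finite_supp[OF f]] cl \<theta>[OF pq], symmetric])
      finally show ?thesis .
    qed
    then show "pos_pow (Alg d) f n \<in> J"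
      using pos_pow_closed[OF n f] by (simp add: J_def)
  qed
  with assms(3-5) show ?thesis by (auto simp: J_def \<theta>_def[abs_def])
qed

section \<open>Multihomogeneous components\<close>

definition component :: "(nat list \<Rightarrow> bool) \<Rightarrow> (nat list \<Rightarrow> 'a) \<Rightarrow> nat list \<Rightarrow> 'a" where
  "component P f = (\<lambda>w. if P w then f w else \<zero>)"

lemma component_closed: "f \<in> carrier (Alg d) \<Longrightarrow> component P f \<in> carrier (Alg d)"
proof -
  assume f: "f \<in> carrier (Alg d)"
  have "supp (component P f) \<subseteq> supp f" by (auto simp: supp_def component_def)
  with f show ?thesis by (auto simp: Alg_carrier component_def intro: finite_subset)
qed

lemma component_add:
  "component P (f \<oplus>\<^bsub>Alg d\<^esub> g) = component P f \<oplus>\<^bsub>Alg d\<^esub> component P g"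
  by (auto simp: component_def Alg_add)

lemma component_smult:
  "c \<in> carrier R \<Longrightarrow> component P (c \<odot>\<^bsub>Alg d\<^esub> f) = c \<odot>\<^bsub>Alg d\<^esub> component P f"
  by (auto simp: component_def Alg_smult)

lemma component_zero: "component P \<zero>\<^bsub>Alg d\<^esub> = \<zero>\<^bsub>Alg d\<^esub>"
  by (auto simp: component_def Alg_zero)

lemma component_comb:
  assumes "finite S" "c \<in> S \<rightarrow> carrier R" "\<omega> \<in> S \<rightarrow> free_semigroup d"
  shows "component P (comb d S c \<omega>) = comb d {s \<in> S. P (\<omega> s)} c \<omega>"
  using assms
proof induction
  case empty
  show ?case by (simp add: comb_empty component_zero)
next
  case (insert s S)
  then have s: "c s \<in> carrier R" "\<omega> s \<in> free_semigroup d"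
    and S: "c \<in> S \<rightarrow> carrier R" "\<omega> \<in> S \<rightarrow> free_semigroup d" by auto
  let ?S = "{s \<in> S. P (\<omega> s)}"
  have cl: "comb d ?S c \<omega> \<in> carrier (Alg d)" using S by (intro comb_closed) auto
  have eq: "component P (comb d (insert s S) c \<omega>) =
      component P (mon (c s) (\<omega> s)) \<oplus>\<^bsub>Alg d\<^esub> comb d ?S c \<omega>"
    by (simp only: comb_insert[OF insert.hyps insert.prems] component_add insert.IH[OF S])
  show ?case
  proof (cases "P (\<omega> s)")
    case True
    then have "{t \<in> insert s S. P (\<omega> t)} = insert s ?S" by auto
    moreover have "comb d (insert s ?S) c \<omega> = mon (c s) (\<omega> s) \<oplus>\<^bsub>Alg d\<^esub> comb d ?S c \<omega>"
      using insert.hyps insert.prems by (intro comb_insert) auto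
    moreover have "component P (mon (c s) (\<omega> s)) = mon (c s) (\<omega> s)"
      using True by (auto simp: component_def mon_def)
    ultimately show ?thesis using eq by simp
  next
    case False
    then have "{t \<in> insert s S. P (\<omega> t)} = ?S" by auto
    moreover have "component P (mon (c s) (\<omega> s)) = \<zero>\<^bsub>Alg d\<^esub>"
      using False by (auto simp: component_def mon_def Alg_zero)
    ultimately show ?thesis using eq A.M.l_zero[OF cl] by simp
  qed
qed

lemma component_eq_comb:
  "f \<in> carrier (Alg d) \<Longrightarrow> component P f = comb d {w \<in> supp f. P w} f (\<lambda>w. w)"
  using component_comb[of "supp f" f "\<lambda>w. w" d P] comb_supp[of f d]
  by (auto simp: Alg_carrier)

lemma component_mon_times:
  assumes f: "f \<in> carrier (Alg d)" and c: "c \<in> carrier R" and u: "u \<in> free_semigroup d"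
  shows "component P (mon c u \<otimes>\<^bsub>Alg d\<^esub> f) = mon c u \<otimes>\<^bsub>Alg d\<^esub> component (\<lambda>w. P (u @ w)) f"
    and "component P (f \<otimes>\<^bsub>Alg d\<^esub> mon c u) = component (\<lambda>w. P (w @ u)) f \<otimes>\<^bsub>Alg d\<^esub> mon c u"
proof -
  have id: "(\<lambda>w. w) \<in> S \<rightarrow> free_semigroup d" "f \<in> S \<rightarrow> carrier R" "finite S" if "S \<subseteq> supp f" for S
    using supp_subset[OF f] that f finite_subset[OF that] by (auto simp: Alg_carrier)
  have cl: "(\<lambda>w. c \<otimes> f w) \<in> supp f \<rightarrow> carrier R" "(\<lambda>w. f w \<otimes> c) \<in> supp f \<rightarrow> carrier R"
     "(\<lambda>w. u @ w) \<in> supp f \<rightarrow> free_semigroup d" "(\<lambda>w. w @ u) \<in> supp f \<rightarrow> free_semigroup d"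
    using c Alg_closed[OF f] id[OF order_refl] append_funcset[OF u] by auto
  have S: "{w \<in> supp f. Q w} \<subseteq> supp f" for Q by auto
  have "component P (mon c u \<otimes>\<^bsub>Alg d\<^esub> comb d (supp f) f (\<lambda>w. w)) =
      mon c u \<otimes>\<^bsub>Alg d\<^esub> comb d {w \<in> supp f. P (u @ w)} f (\<lambda>w. w)"
    unfolding mon_comb[OF id(3) c u id(2,1), OF order_refl order_refl order_refl]
      mon_comb[OF id(3) c u id(2,1), OF S S S]
    by (rule component_comb[OF finite_supp[OF f] cl(1,3)])
  then show "component P (mon c u \<otimes>\<^bsub>Alg d\<^esub> f) = mon c u \<otimes>\<^bsub>Alg d\<^esub> component (\<lambda>w. P (u @ w)) f"
    by (simp only: comb_supp[OF f] component_eq_comb[OF f])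
  have "component P (comb d (supp f) f (\<lambda>w. w) \<otimes>\<^bsub>Alg d\<^esub> mon c u) =
      comb d {w \<in> supp f. P (w @ u)} f (\<lambda>w. w) \<otimes>\<^bsub>Alg d\<^esub> mon c u"
    unfolding comb_mon[OF id(3) c u id(2,1), OF order_refl order_refl order_refl]
      comb_mon[OF id(3) c u id(2,1), OF S S S]
    by (rule component_comb[OF finite_supp[OF f] cl(2,4)])
  then show "component P (f \<otimes>\<^bsub>Alg d\<^esub> mon c u) = component (\<lambda>w. P (w @ u)) f \<otimes>\<^bsub>Alg d\<^esub> mon c u"
    by (simp only: comb_supp[OF f] component_eq_comb[OF f])
qed

text \<open>On a power this is the grading of the tuples by the number of letters \<open>b\<close>
  in their words. Multiplication by \<open>u\<close> shifts the degree by
  \<open>count_list u b\<close>, hence all degrees \<open>m\<close> have to be treated together in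
  \<open>J\<close>; a degree below that shift yields the zero component.\<close>

lemma nil_ideal_component:
  assumes inf: "infinite (carrier R)" and n: "n \<ge> 1" and "f \<in> nil_ideal R n d"
  shows "component (\<lambda>w. count_list w b = m) f \<in> nil_ideal R n d"
proof -
  define J where "J = {f \<in> carrier (Alg d). \<forall>m. component (\<lambda>w. count_list w b = m) f \<in> nil_ideal R n d}"
  note I = submodule_AlgE[OF nil_ideal_submodule[OF n, of d]]
  have ideal: "mon c u \<otimes>\<^bsub>Alg d\<^esub> g \<in> nil_ideal R n d" "g \<otimes>\<^bsub>Alg d\<^esub> mon c u \<in> nil_ideal R n d"
    if "g \<in> nil_ideal R n d" "u \<in> free_semigroup d" "c \<in> carrier R" for u g c
    using nil_ideal_mult[OF n that(1) mon_closed[OF that(3,2)]] by auto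
  have "nil_ideal R n d \<subseteq> J"
  proof (rule nil_ideal_least[OF algebra_ideal_monI])
    show "submodule J R (Alg d)"
      by (rule submodule_AlgI) (use I in \<open>auto simp: J_def component_add component_smult component_zero\<close>)
  next
    fix c u x assume c: "c \<in> carrier R" and u: "u \<in> free_semigroup d" and x: "x \<in> J"
    then have xc: "x \<in> carrier (Alg d)" by (simp add: J_def)
    have "component (\<lambda>w. count_list u b + count_list w b = m) x \<in> nil_ideal R n d" for m
    proof (cases "count_list u b \<le> m")
      case True
      then have "(\<lambda>w. count_list u b + count_list w b = m) = (\<lambda>w. count_list w b = m - count_list u b)"
        by auto
      with x show ?thesis by (simp add: J_def)
    next
      case False
      then have "component (\<lambda>w. count_list u b + count_list w b = m) x = \<zero>\<^bsub>Alg d\<^esub>"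
        by (auto simp: component_def Alg_zero)
      then show ?thesis using I(2) by simp
    qed
    then have "component (\<lambda>w. count_list (u @ w) b = m) x \<in> nil_ideal R n d"
      "component (\<lambda>w. count_list (w @ u) b = m) x \<in> nil_ideal R n d" for m
      by (auto simp: add.commute)
    then show "mon c u \<otimes>\<^bsub>Alg d\<^esub> x \<in> J" "x \<otimes>\<^bsub>Alg d\<^esub> mon c u \<in> J"
      unfolding J_def using ideal[OF _ u c]
      by (auto simp only: mem_Collect_eq component_mon_times[OF xc c u]
          intro!: Alg_mult_closed[OF mon_closed[OF c u] xc] Alg_mult_closed[OF xc mon_closed[OF c u]])
  next
    fix f assume f: "f \<in> carrier (Alg d)"
    have id: "(\<lambda>w. w) \<in> supp f \<rightarrow> free_semigroup d" "f \<in> supp f \<rightarrow> carrier R"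
      using f by (auto simp: Alg_carrier)
    note cl = tuples_closed[OF id(2,1) n]
    have pow: "pos_pow (Alg d) f n = comb d (tuples (supp f) n) (cprod f) (\<lambda>ss. concat (map (\<lambda>w. w) ss))"
      using pow_comb[OF n finite_supp[OF f] id(2,1)] by (simp only: comb_supp[OF f])
    have "component (\<lambda>w. count_list w b = m) (pos_pow (Alg d) f n) \<in> nil_ideal R n d" for m
      unfolding pow component_comb[OF finite_tuples[OF finite_supp[OF f]] cl]
      using graded_pow_in_nil_ideal[OF inf n finite_supp[OF f] id(2,1), of "\<lambda>w. count_list w b" m]
      by (simp only: count_list_concat list.map_ident)
    then show "pos_pow (Alg d) f n \<in> J"
      using pos_pow_closed[OF n f] by (simp add: J_def)
  qed
  with assms(3) show ?thesis by (auto simp: J_def)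
qed

lemma nil_ideal_multicomponent:
  assumes "infinite (carrier R)" "n \<ge> 1" "f \<in> nil_ideal R n d"
  shows "component (\<lambda>w. \<forall>b\<in>set bs. count_list w b = m b) f \<in> nil_ideal R n d"
proof (induction bs)
  case Nil
  then show ?case using assms(3) by (simp add: component_def)
next
  case (Cons a bs)
  have "component (\<lambda>w. \<forall>b\<in>set (a # bs). count_list w b = m b) f =
      component (\<lambda>w. count_list w a = m a) (component (\<lambda>w. \<forall>b\<in>set bs. count_list w b = m b) f)"
    by (auto simp: component_def)
  with nil_ideal_component[OF assms(1,2) Cons] show ?case by simp
qed

section \<open>Reduction to words with larger runs\<close>

text \<open>In general only a subspace. With \<open>P\<close> chosen as \<open>uneven j D\<close> it
  holds the error terms modulo which the identity of degree \<open>k\<close> is valid.\<close>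

definition supported :: "nat \<Rightarrow> (nat list \<Rightarrow> bool) \<Rightarrow> (nat list \<Rightarrow> 'a) set" where
  "supported d P = {f \<in> carrier (Alg d). \<forall>w. f w \<noteq> \<zero> \<longrightarrow> P w}"

lemma submodule_supported: "submodule (supported d P) R (Alg d)"
proof (rule submodule_AlgI)
  show "a \<oplus>\<^bsub>Alg d\<^esub> b \<in> supported d P" if "a \<in> supported d P" "b \<in> supported d P" for a b
  proof -
    have "P w" if "(a \<oplus>\<^bsub>Alg d\<^esub> b) w \<noteq> \<zero>" for w
    proof (rule ccontr)
      assume "\<not> P w"
      with \<open>a \<in> supported d P\<close> \<open>b \<in> supported d P\<close> have "a w = \<zero>" "b w = \<zero>"
        by (auto simp: supported_def)
      with that show False by (simp add: Alg_add)
    qed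
    with that show ?thesis by (simp add: supported_def)
  qed
  show "c \<odot>\<^bsub>Alg d\<^esub> a \<in> supported d P" if "c \<in> carrier R" "a \<in> supported d P" for c a
  proof -
    have "P w" if "(c \<odot>\<^bsub>Alg d\<^esub> a) w \<noteq> \<zero>" for w
    proof (rule ccontr)
      assume "\<not> P w"
      with \<open>a \<in> supported d P\<close> have "a w = \<zero>" by (auto simp: supported_def)
      with that \<open>c \<in> carrier R\<close> show False by (simp add: Alg_smult)
    qed
    with that show ?thesis by (simp add: supported_def)
  qed
  show "\<zero>\<^bsub>Alg d\<^esub> \<in> supported d P"
    by (simp add: supported_def) (simp add: Alg_zero)
qed (auto simp: supported_def)

lemma comb_supported:
  assumes "finite S" "c \<in> S \<rightarrow> carrier R" "\<omega> \<in> S \<rightarrow> free_semigroup d" "\<And>s. s \<in> S \<Longrightarrow> P (\<omega> s)"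
  shows "comb d S c \<omega> \<in> supported d P"
  unfolding comb_def
proof (rule submodule_finsum[OF module_Alg submodule_supported assms(1)], rule funcsetI)
  fix s assume "s \<in> S"
  with assms have "mon (c s) (\<omega> s) \<in> carrier (Alg d)" "P (\<omega> s)"
    by (auto intro: mon_closed)
  then show "mon (c s) (\<omega> s) \<in> supported d P"
    by (simp add: supported_def mon_def)
qed

lemma lin_supported:
  assumes "f \<in> supported d P" and \<theta>: "\<theta> \<in> free_semigroup d \<rightarrow> free_semigroup e"
    and "\<And>w. w \<in> free_semigroup d \<Longrightarrow> P w \<Longrightarrow> Q (\<theta> w)"
  shows "lin e \<theta> f \<in> supported e Q"
proof -
  have f: "f \<in> carrier (Alg d)" using assms(1) by (simp add: supported_def)
  show ?thesis
    unfolding lin_def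
    by (rule comb_supported[OF finite_supp[OF f] Alg_funcsets[OF f \<theta>]])
       (use assms supp_subset[OF f] in \<open>auto simp: supported_def supp_def\<close>)
qed

definition plus_set :: "nat \<Rightarrow> (nat list \<Rightarrow> 'a) set \<Rightarrow> (nat list \<Rightarrow> 'a) set \<Rightarrow> (nat list \<Rightarrow> 'a) set" where
  "plus_set d H U = {h \<oplus>\<^bsub>Alg d\<^esub> u | h u. h \<in> H \<and> u \<in> U}"

lemma submodule_plus_set:
  assumes H: "submodule H R (Alg d)" and U: "submodule U R (Alg d)"
  shows "submodule (plus_set d H U) R (Alg d)"
proof (rule submodule_AlgI)
  note H' = submodule_AlgE[OF H] and U' = submodule_AlgE[OF U]
  have HU: "h \<in> H \<Longrightarrow> h \<in> carrier (Alg d)" "u \<in> U \<Longrightarrow> u \<in> carrier (Alg d)" for h u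
    using H'(1) U'(1) by auto
  show "plus_set d H U \<subseteq> carrier (Alg d)"
    using HU by (auto simp: plus_set_def)
  have "\<zero>\<^bsub>Alg d\<^esub> = \<zero>\<^bsub>Alg d\<^esub> \<oplus>\<^bsub>Alg d\<^esub> \<zero>\<^bsub>Alg d\<^esub>" by simp
  then show "\<zero>\<^bsub>Alg d\<^esub> \<in> plus_set d H U"
    using H'(2) U'(2) unfolding plus_set_def by blast
  fix a assume "a \<in> plus_set d H U"
  then obtain h u where a: "a = h \<oplus>\<^bsub>Alg d\<^esub> u" "h \<in> H" "u \<in> U" by (auto simp: plus_set_def)
  {
    fix b assume "b \<in> plus_set d H U"
    then obtain h' u' where b: "b = h' \<oplus>\<^bsub>Alg d\<^esub> u'" "h' \<in> H" "u' \<in> U" by (auto simp: plus_set_def)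
    have "a \<oplus>\<^bsub>Alg d\<^esub> b = (h \<oplus>\<^bsub>Alg d\<^esub> h') \<oplus>\<^bsub>Alg d\<^esub> (u \<oplus>\<^bsub>Alg d\<^esub> u')"
      unfolding a(1) b(1) using HU(1)[OF a(2)] HU(2)[OF a(3)] HU(1)[OF b(2)] HU(2)[OF b(3)]
      by (simp add: A.M.a_ac)
    then show "a \<oplus>\<^bsub>Alg d\<^esub> b \<in> plus_set d H U"
      using H'(3)[OF a(2) b(2)] U'(3)[OF a(3) b(3)] by (auto simp: plus_set_def)
  }
  fix c assume c: "c \<in> carrier R"
  have "c \<odot>\<^bsub>Alg d\<^esub> a = c \<odot>\<^bsub>Alg d\<^esub> h \<oplus>\<^bsub>Alg d\<^esub> c \<odot>\<^bsub>Alg d\<^esub> u"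
    unfolding a(1) by (rule A.smult_r_distr[OF c HU(1)[OF a(2)] HU(2)[OF a(3)]])
  then show "c \<odot>\<^bsub>Alg d\<^esub> a \<in> plus_set d H U"
    using H'(4)[OF c a(2)] U'(4)[OF c a(3)] by (auto simp: plus_set_def)
qed

lemma free_semigroup_letters:
  assumes "w \<in> free_semigroup D"
  shows "w \<noteq> []" "set w \<subseteq> {1..D}" "Suc D \<notin> set w"
  using assms by (auto simp: free_semigroup_def)

lemma set_pad_parts:
  assumes "set u \<subseteq> {1..D}"
  shows "set (lpad j D u) \<subseteq> {1..Suc D}" "set (rpad j D u) \<subseteq> {1..Suc D}"
proof -
  have "x \<in> {1..Suc D}" if "x \<in> set u" for x using that assms by force
  then show "set (lpad j D u) \<subseteq> {1..Suc D}" "set (rpad j D u) \<subseteq> {1..Suc D}"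
    by (auto simp: lpad_def rpad_def)
qed

lemma pad_funcset: "pad j D \<in> free_semigroup D \<rightarrow> free_semigroup (Suc D)"
proof
  fix w assume w: "w \<in> free_semigroup D"
  have "set (pad j D w) \<subseteq> {1..Suc D}"
    using set_pad_parts(2)[of w D j] free_semigroup_letters[OF w] by (auto simp: pad_def rpad_def)
  with w show "pad j D w \<in> free_semigroup (Suc D)"
    by (cases w) (auto simp: free_semigroup_def pad_def)
qed

lemma core_funcset: "core j D \<in> free_semigroup D \<rightarrow> free_semigroup (Suc D)"
proof
  fix w assume w: "w \<in> free_semigroup D"
  then obtain i u where iu: "w = i # u" by (cases w) (auto simp: free_semigroup_def)
  with w have "set u \<subseteq> {1..D}" "i \<in> {1..D}" by (auto simp: free_semigroup_def)
  then show "core j D w \<in> free_semigroup (Suc D)"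
    using set_pad_parts(1)[of u D j] by (auto simp: free_semigroup_def core_def iu)
qed

text \<open>The preimage \<open>J\<close> of the sum of nil ideal and error space is an ideal,
  because multiplication by words corresponds to the operations \<open>lpad\<close> and
  \<open>rpad\<close>, which respect both summands. It contains \<open>f^k\<close> because the
  evenly spaced terms in the degree \<open>k\<close> part of \<open>(a + g)^n\<close> add up to its
  image.\<close>

lemma pad_nil_ideal:
  assumes inf: "infinite (carrier R)" and k: "k = n div Suc j" "k \<ge> 1"
    and "f \<in> nil_ideal R k D"
  shows "lin (Suc D) (pad j D) f \<in> plus_set (Suc D) (nil_ideal R n (Suc D)) (supported (Suc D) (uneven j D))"
proof -
  let ?e = "Suc D"
  let ?I = "nil_ideal R n ?e" and ?U = "supported ?e (uneven j D)"
  let ?N = "plus_set ?e ?I ?U"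
  define J where "J = {f \<in> carrier (Alg D). lin ?e (pad j D) f \<in> ?N}"
  have n: "n \<ge> 1" using k by (cases n) auto
  note Isub = nil_ideal_submodule[OF n, of ?e] and Usub = submodule_supported[of ?e "uneven j D"]
  note Nsub = submodule_plus_set[OF Isub Usub]
  note N = submodule_AlgE[OF Nsub] and I = submodule_AlgE[OF Isub] and U = submodule_AlgE[OF Usub]
  note pf = pad_funcset[of j D]
  \<comment> \<open>Stability is available only for flanks that preserve unevenness; the error space
    is not closed under arbitrary ones.\<close>
  have shift: "lin ?e (\<lambda>w. p @ w @ q) g \<in> ?N"
    if g: "g \<in> ?N" and pq: "set p \<subseteq> {1..?e}" "set q \<subseteq> {1..?e}"
      and "\<And>z. uneven j D z \<Longrightarrow> uneven j D (p @ z @ q)" for p q g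
  proof -
    obtain h u where hu: "g = h \<oplus>\<^bsub>Alg ?e\<^esub> u" "h \<in> ?I" "u \<in> ?U" using g by (auto simp: plus_set_def)
    have fs: "(\<lambda>w. p @ w @ q) \<in> free_semigroup ?e \<rightarrow> free_semigroup ?e"
      using pq by (auto simp: free_semigroup_def)
    have "lin ?e (\<lambda>w. p @ w @ q) g = lin ?e (\<lambda>w. p @ w @ q) h \<oplus>\<^bsub>Alg ?e\<^esub> lin ?e (\<lambda>w. p @ w @ q) u"
      unfolding hu(1) using hu(2,3) I(1) U(1) by (intro lin_add[OF _ _ fs]) auto
    moreover have "lin ?e (\<lambda>w. p @ w @ q) h \<in> ?I" by (rule nil_ideal_shift[OF n hu(2) pq])
    moreover have "lin ?e (\<lambda>w. p @ w @ q) u \<in> ?U" using that(4) by (intro lin_supported[OF hu(3) fs])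
    ultimately show ?thesis by (auto simp: plus_set_def)
  qed
  have "nil_ideal R k D \<subseteq> J"
  proof (rule nil_ideal_least[OF algebra_ideal_monI])
    show "submodule J R (Alg D)"
    proof (rule submodule_AlgI)
      show "a \<oplus>\<^bsub>Alg D\<^esub> b \<in> J" if "a \<in> J" "b \<in> J" for a b
        using that N(3) by (simp add: J_def lin_add[OF _ _ pf])
      show "c \<odot>\<^bsub>Alg D\<^esub> a \<in> J" if "c \<in> carrier R" "a \<in> J" for c a
        using that N(4) by (simp add: J_def lin_smult[OF _ _ pf])
      show "\<zero>\<^bsub>Alg D\<^esub> \<in> J" using N(2) by (simp add: J_def lin_zero)
    qed (simp add: J_def)
  next
    fix c u x assume c: "c \<in> carrier R" and u: "u \<in> free_semigroup D" and x: "x \<in> J"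
    then have xc: "x \<in> carrier (Alg D)" and xN: "lin ?e (pad j D) x \<in> ?N" by (auto simp: J_def)
    note ul = free_semigroup_letters[OF u] and us = set_pad_parts[OF free_semigroup_letters(2)[OF u], of j]
    have fs: "(\<lambda>w. p @ w @ q) \<in> free_semigroup ?e \<rightarrow> free_semigroup ?e"
      if "set p \<subseteq> {1..?e}" "set q \<subseteq> {1..?e}" for p q
      using that by (auto simp: free_semigroup_def)
    have "lin ?e (\<lambda>w. lpad j D u @ w @ []) (lin ?e (pad j D) x) \<in> ?N"
      using us ul(3) by (intro shift[OF xN]) (auto intro: uneven_lpad)
    also have "lin ?e (\<lambda>w. lpad j D u @ w @ []) (lin ?e (pad j D) x) = lin ?e (\<lambda>w. pad j D (u @ w)) x"
      using us by (subst lin_lin[OF xc pf fs]) (auto simp: pad_lpad)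
    finally have "lin ?e (pad j D) (mon c u \<otimes>\<^bsub>Alg D\<^esub> x) \<in> ?N"
      unfolding lin_mon_times(1)[OF xc c u pf] by (rule N(4)[OF c])
    then show "mon c u \<otimes>\<^bsub>Alg D\<^esub> x \<in> J"
      using Alg_mult_closed[OF mon_closed[OF c u] xc] by (simp add: J_def)
    have "lin ?e (\<lambda>w. [] @ w @ rpad j D u) (lin ?e (pad j D) x) \<in> ?N"
      using us ul(3) by (intro shift[OF xN]) (auto intro: uneven_rpad)
    also have "lin ?e (\<lambda>w. [] @ w @ rpad j D u) (lin ?e (pad j D) x) = lin ?e (\<lambda>w. pad j D (w @ u)) x"
      using us by (subst lin_lin[OF xc pf fs]) (auto simp: pad_rpad)
    finally have "lin ?e (pad j D) (x \<otimes>\<^bsub>Alg D\<^esub> mon c u) \<in> ?N"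
      unfolding lin_mon_times(2)[OF xc c u pf] by (rule N(4)[OF c])
    then show "x \<otimes>\<^bsub>Alg D\<^esub> mon c u \<in> J"
      using Alg_mult_closed[OF xc mon_closed[OF c u]] by (simp add: J_def)
  next
    fix f assume f: "f \<in> carrier (Alg D)"
    let ?S = "supp f"
    define r where "r = n mod Suc j"
    have r: "r \<le> j" "n = r + k * Suc j"
      using k(1) mod_less_divisor[of "Suc j" n] div_mult_mod_eq[of n "Suc j"]
      by (auto simp: r_def)
    \<comment> \<open>Index set of the sum \<open>a + g\<close>: \<open>None\<close> stands for
      \<open>a\<close> with coefficient one, and \<open>Some w\<close> for the core of
      \<open>w\<close> with the coefficient of \<open>w\<close> in \<open>f\<close>. The weights
      \<open>\<delta>\<close> below measure the degree in \<open>g\<close>.\<close>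
    define X' where "X' = insert None (Some ` ?S)"
    define c where "c x = (case x of None \<Rightarrow> \<one> | Some w \<Rightarrow> f w)" for x
    define \<delta> :: "nat list option \<Rightarrow> nat" where "\<delta> x = (case x of None \<Rightarrow> 0 | Some _ \<Rightarrow> 1)" for x
    define T where "T = {xs \<in> tuples X' n. sum_list (map \<delta> xs) = k}"
    define \<omega> where "\<omega> xs = replicate (j - r) ?e @ concat (map (emb j D) xs)" for xs
    \<comment> \<open>The arrangements that yield evenly distributed words; all other tuples in
      \<open>T\<close> give errors.\<close>
    define E where "E = spaced j r ` tuples ?S k"
    have finS: "finite ?S" by (rule finite_supp[OF f])
    have fX: "finite X'" "finite T" using finS by (auto simp: X'_def T_def finite_tuples)
    have id: "(\<lambda>w. w) \<in> ?S \<rightarrow> free_semigroup D" "f \<in> ?S \<rightarrow> carrier R"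
      using f by (auto simp: Alg_carrier)
    have cX: "c \<in> X' \<rightarrow> carrier R" using id(2) by (auto simp: c_def X'_def)
    have eX: "emb j D \<in> X' \<rightarrow> free_semigroup ?e"
    proof
      fix x assume "x \<in> X'"
      then show "emb j D x \<in> free_semigroup ?e"
        using funcset_mem[OF core_funcset[of j D]] funcset_mem[OF id(1)]
        by (cases x) (auto simp: X'_def, simp add: free_semigroup_def)
    qed
    note cl = tuples_closed[OF cX eX n]
    have T: "T = {xs. set (somes xs) \<subseteq> ?S \<and> length xs = n \<and> length (somes xs) = k}"
    proof -
      have "set xs \<subseteq> X' \<longleftrightarrow> set (somes xs) \<subseteq> ?S" for xs
      proof
        assume "set xs \<subseteq> X'"
        then show "set (somes xs) \<subseteq> ?S" by (force simp: set_somes X'_def)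
      next
        assume *: "set (somes xs) \<subseteq> ?S"
        show "set xs \<subseteq> X'"
        proof
          fix x assume "x \<in> set xs"
          with * show "x \<in> X'" by (cases x) (auto simp: set_somes X'_def)
        qed
      qed
      then show ?thesis by (simp add: T_def tuples_def \<delta>_def[abs_def] length_somes conj_assoc)
    qed
    have TX: "T \<subseteq> tuples X' n" by (auto simp: T_def)
    have \<omega>T: "\<omega> \<in> T \<rightarrow> free_semigroup ?e" and cT: "cprod c \<in> T \<rightarrow> carrier R"
      using cl TX by (auto simp: \<omega>_def free_semigroup_def Pi_def)
    have ET: "E \<subseteq> T"
      by (auto simp: E_def T tuples_def somes_spaced length_spaced r(2))
    have letters: "w \<noteq> [] \<and> Suc D \<notin> set w" if "xs \<in> T" "Some w \<in> set xs" for xs w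
    proof -
      have "w \<in> ?S" using that by (auto simp: T set_somes)
      then show ?thesis using free_semigroup_letters id(1) by blast
    qed
    have "comb ?e T (cprod c) (\<lambda>xs. concat (map (emb j D) xs)) \<in> ?I"
      unfolding T_def by (rule graded_pow_in_nil_ideal[OF inf n fX(1) cX eX])
    then have "lin ?e (\<lambda>w. replicate (j - r) ?e @ w @ []) (comb ?e T (cprod c) (\<lambda>xs. concat (map (emb j D) xs))) \<in> ?I"
      by (rule nil_ideal_shift[OF n]) auto
    also have "lin ?e (\<lambda>w. replicate (j - r) ?e @ w @ []) (comb ?e T (cprod c) (\<lambda>xs. concat (map (emb j D) xs)))
        = comb ?e T (cprod c) \<omega>"
      unfolding \<omega>_def using cl(2) TX
      by (subst lin_comb[OF fX(2) cT, where d = ?e]) (auto simp: free_semigroup_def)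
    finally have inI: "comb ?e T (cprod c) \<omega> \<in> ?I" .
    have "comb ?e E (cprod c) \<omega> = comb ?e (tuples ?S k) (\<lambda>ss. cprod c (spaced j r ss)) (\<lambda>ss. \<omega> (spaced j r ss))"
      unfolding E_def
    proof (rule comb_reindex)
      show "inj_on (spaced j r) (tuples ?S k)"
        by (rule inj_on_inverseI[where g = somes]) (rule somes_spaced)
    qed (use cT \<omega>T ET in \<open>auto simp: E_def\<close>)
    also have "\<dots> = comb ?e (tuples ?S k) (cprod f) (\<lambda>ss. pad j D (concat ss))"
    proof (rule comb_cong[OF refl])
      note cl' = tuples_closed[OF id(2,1) k(2)]
      show "cprod f \<in> tuples ?S k \<rightarrow> carrier R" by (rule cl')
      show "(\<lambda>ss. pad j D (concat ss)) \<in> tuples ?S k \<rightarrow> free_semigroup ?e"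
        using cl'(2) pf by auto
      fix ss assume ss: "ss \<in> tuples ?S k"
      then have ssS: "set ss \<subseteq> ?S" by (simp add: tuples_def)
      then show "\<omega> (spaced j r ss) = pad j D (concat ss)"
        unfolding \<omega>_def using free_semigroup_letters(1) id(1)
        by (intro emb_spaced[OF r(1)]) blast
      \<comment> \<open>The factors \<open>a\<close> have coefficient one, so inserting them does
        not change the product of coefficients.\<close>
      have one: "cprod c (replicate m None @ xs) = cprod c xs" if "cprod c xs \<in> carrier R" for m xs
        using that by (induction m) (auto simp: c_def)
      have "cprod c (concat (map (\<lambda>s. Some s # replicate j None) ss)) = cprod f ss \<and>
          cprod f ss \<in> carrier R"
        using ssS
      proof (induction ss)
        case (Cons s ss)
        then show ?case using id(2) by (auto simp: one) (auto simp: c_def)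
      qed simp
      then show "cprod c (spaced j r ss) = cprod f ss" by (simp add: spaced_def one)
    qed
    also have "\<dots> = lin ?e (pad j D) (pos_pow (Alg D) f k)"
    proof -
      have "pos_pow (Alg D) f k = comb D (tuples ?S k) (cprod f) (\<lambda>ss. concat (map (\<lambda>w. w) ss))"
        using pow_comb[OF k(2) finS id(2,1)] by (simp only: comb_supp[OF f])
      then show ?thesis
        using lin_comb[OF finite_tuples[OF finS] tuples_closed[OF id(2,1) k(2)] pf] by simp
    qed
    finally have lin: "comb ?e E (cprod c) \<omega> = lin ?e (pad j D) (pos_pow (Alg D) f k)" .
    have rest: "comb ?e (T - E) (cprod c) \<omega> \<in> ?U"
    proof (rule comb_supported)
      fix xs assume xs: "xs \<in> T - E"
      then have "xs \<noteq> spaced j r (somes xs)"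
        by (auto simp: E_def T tuples_def)
      then show "uneven j D (\<omega> xs)"
        unfolding \<omega>_def using xs r letters
        by (intro emb_uneven) (auto simp: T)
    qed (use fX cT \<omega>T in auto)
    let ?L = "comb ?e E (cprod c) \<omega>" and ?V = "comb ?e (T - E) (cprod c) \<omega>"
    have LV: "?L \<in> carrier (Alg ?e)" "?V \<in> carrier (Alg ?e)"
      using cT \<omega>T ET by (auto intro!: comb_closed)
    have "comb ?e (E \<union> (T - E)) (cprod c) \<omega> = ?L \<oplus>\<^bsub>Alg ?e\<^esub> ?V"
      using fX(2) ET cT \<omega>T by (intro comb_Un) (auto intro: finite_subset)
    moreover have "E \<union> (T - E) = T" using ET by auto
    \<comment> \<open>The even part is the whole degree \<open>k\<close> part, which lies in the nil
      ideal, minus the uneven part.\<close>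
    ultimately have "?L = comb ?e T (cprod c) \<omega> \<oplus>\<^bsub>Alg ?e\<^esub> \<ominus>\<^bsub>Alg ?e\<^esub> ?V"
      using LV by (simp add: A.M.a_assoc A.M.r_neg)
    then have "?L \<in> ?N" using inI U(5)[OF rest] by (auto simp: plus_set_def)
    then show "pos_pow (Alg D) f k \<in> J"
      using pos_pow_closed[OF k(2) f] by (simp add: J_def lin)
  qed
  with assms(4) show ?thesis by (auto simp: J_def)
qed

lemma component_mon: "P w \<Longrightarrow> component P (mon c w) = mon c w"
  by (auto simp: component_def mon_def)

lemma supported_subset_ideal:
  assumes J: "submodule J R (Alg e)" and v: "v \<in> supported d P"
    and \<theta>: "\<theta> \<in> free_semigroup d \<rightarrow> free_semigroup e"
    and "\<And>z. z \<in> free_semigroup d \<Longrightarrow> P z \<Longrightarrow> mon \<one> (\<theta> z) \<in> J"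
  shows "lin e \<theta> v \<in> J"
  unfolding lin_def comb_def
proof (rule submodule_finsum[OF module_Alg J], rule_tac [2] funcsetI)
  have vc: "v \<in> carrier (Alg d)" using v by (simp add: supported_def)
  show "finite (supp v)" by (rule finite_supp[OF vc])
  fix z assume z: "z \<in> supp v"
  then have "z \<in> free_semigroup d" "P z" using supp_subset[OF vc] v by (auto simp: supported_def supp_def)
  then have "v z \<odot>\<^bsub>Alg e\<^esub> mon \<one> (\<theta> z) \<in> J"
    using assms(4) Alg_closed[OF vc] submodule_AlgE(4)[OF J] by blast
  then show "mon (v z) (\<theta> z) \<in> J"
    using Alg_closed[OF vc] by (simp add: smult_mon)
qed

text \<open>The word \<open>[1..<Suc c]\<close> is padded, the component of its multidegree is
  taken, and only then are words substituted by \<open>\<sigma>\<close>: afterwards different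
  letters may have become equal words and could no longer be told apart. The assumption
  \<open>higher\<close> is to be met by induction on words.\<close>

lemma pad_word_in_nil_ideal:
  assumes inf: "infinite (carrier R)" and k: "k = n div Suc j" "k \<ge> 1"
    and c: "1 \<le> c" "c \<le> D" "mon \<one> [1..<Suc c] \<in> nil_ideal R k D"
    and \<sigma>: "\<sigma> \<in> {1..Suc D} \<rightarrow> free_semigroup d" and pq: "set p \<subseteq> {1..d}" "set q \<subseteq> {1..d}"
    and higher: "\<And>z. z \<in> free_semigroup (Suc D) \<Longrightarrow> uneven j D z \<Longrightarrow>
      mset (filter (\<lambda>x. x \<noteq> Suc D) z) = mset [1..<Suc c] \<Longrightarrow>
      mon \<one> (p @ concat (map \<sigma> z) @ q) \<in> nil_ideal R n d"
  shows "mon \<one> (p @ concat (map \<sigma> (pad j D [1..<Suc c])) @ q) \<in> nil_ideal R n d"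
proof -
  let ?w = "[1..<Suc c]" and ?e = "Suc D"
  \<comment> \<open>The multidegree of \<open>[1..<Suc c]\<close>, with zeros for the letters from
    \<open>Suc c\<close> to \<open>D\<close>. The degree in \<open>Suc D\<close> is already fixed by
    unevenness.\<close>
  define m where "m b = (if b \<le> c then 1 else 0 :: nat)" for b :: nat
  define P where "P z \<longleftrightarrow> (\<forall>b\<in>{1..D}. count_list z b = m b)" for z
  have n: "n \<ge> 1" using k by (cases n) auto
  have w: "?w \<in> free_semigroup D" using c(1,2) by (auto simp: free_semigroup_def)
  have pw: "pad j D ?w \<in> free_semigroup ?e" using pad_funcset w by blast
  have sp: "set p \<subseteq> {1..d} \<Longrightarrow> (\<lambda>w. p @ concat (map \<sigma> w) @ q) \<in> free_semigroup ?e \<rightarrow> free_semigroup d"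
    using subst_funcset[OF \<sigma> pq] by simp
  note fs = sp[OF pq(1)]
  have "mon \<one> (pad j D ?w) \<in> plus_set ?e (nil_ideal R n ?e) (supported ?e (uneven j D))"
    using pad_nil_ideal[OF inf k c(3)] lin_mon[OF one_closed w pad_funcset] by simp
  then obtain h v where hv: "mon \<one> (pad j D ?w) = h \<oplus>\<^bsub>Alg ?e\<^esub> v" "h \<in> nil_ideal R n ?e"
    "v \<in> supported ?e (uneven j D)" by (auto simp: plus_set_def)
  have cw: "count_list (pad j D ?w) b = m b" if "b \<in> {1..D}" for b
  proof -
    have "filter (\<lambda>x. x \<noteq> Suc D) (pad j D ?w) = ?w"
      using count_pad_parts(4)[of D ?w j] c(2) by (simp add: pad_def rpad_def)
    then have "count_list (pad j D ?w) b = count_list ?w b"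
      using count_list_filter_neq[of b "Suc D" "pad j D ?w"] that by auto
    also have "\<dots> = m b"
      using that count_list_distinct[OF distinct_upt[of 1 "Suc c"], of b] by (simp add: m_def del: upt_Suc)
    finally show ?thesis .
  qed
  have "P (pad j D ?w)" unfolding P_def by (rule ballI) (rule cw)
  then have eq: "mon \<one> (pad j D ?w) = component P h \<oplus>\<^bsub>Alg ?e\<^esub> component P v"
    using component_mon[of P "pad j D ?w" \<one>] by (simp only: hv(1) component_add)
  have h: "component P h \<in> nil_ideal R n ?e"
  proof -
    have "{1..D} = set [1..<?e]" by auto
    then show ?thesis unfolding P_def by (simp only: nil_ideal_multicomponent[OF inf n hv(2)])
  qed
  have v: "component P v \<in> supported ?e (\<lambda>z. uneven j D z \<and> P z)"
    using hv(3) component_closed[of v ?e P] by (auto simp: supported_def component_def split: if_splits)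
  have H: "lin d (\<lambda>w. p @ concat (map \<sigma> w) @ q) (component P h) \<in> nil_ideal R n d"
    by (rule nil_ideal_subst[OF n \<sigma> h pq])
  have V: "lin d (\<lambda>w. p @ concat (map \<sigma> w) @ q) (component P v) \<in> nil_ideal R n d"
  proof (rule supported_subset_ideal[OF nil_ideal_submodule[OF n] v fs])
    fix z assume z: "z \<in> free_semigroup ?e" "uneven j D z \<and> P z"
    have "mset (filter (\<lambda>x. x \<noteq> ?e) z) = mset ?w"
    proof (rule multiset_eqI)
      fix b
      show "count (mset (filter (\<lambda>x. x \<noteq> ?e) z)) b = count (mset ?w) b"
      proof (cases "b \<in> {1..D}")
        case True
        then have "count_list z b = m b" using z(2) by (simp add: P_def)
        moreover have "count_list (filter (\<lambda>x. x \<noteq> ?e) z) b = count_list z b"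
          using True by (intro count_list_filter_neq) auto
        moreover have "count_list ?w b = m b"
          using True count_list_distinct[OF distinct_upt[of 1 "Suc c"], of b] by (simp add: m_def del: upt_Suc)
        ultimately show ?thesis by (simp only: count_mset_count_list)
      next
        case False
        then have "b \<notin> set (filter (\<lambda>x. x \<noteq> ?e) z)" "b \<notin> set ?w"
          using z(1) c(2) by (auto simp: free_semigroup_def)
        then show ?thesis by (metis count_mset_0_iff)
      qed
    qed
    with z show "mon \<one> (p @ concat (map \<sigma> z) @ q) \<in> nil_ideal R n d" by (intro higher) auto
  qed
  have hc: "component P h \<in> carrier (Alg ?e)" using h nil_ideal_subset[OF n] by blast
  have vc: "component P v \<in> carrier (Alg ?e)" using v by (simp add: supported_def)
  have "mon \<one> (p @ concat (map \<sigma> (pad j D ?w)) @ q) =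
      lin d (\<lambda>w. p @ concat (map \<sigma> w) @ q) (component P h) \<oplus>\<^bsub>Alg d\<^esub>
      lin d (\<lambda>w. p @ concat (map \<sigma> w) @ q) (component P v)"
    unfolding lin_mon[OF one_closed pw fs, symmetric] eq by (rule lin_add[OF hc vc fs])
  with submodule_AlgE(3)[OF nil_ideal_submodule[OF n] H V] show ?thesis by (simp only:)
qed

lemma pos_pow_mon:
  assumes "a \<in> {1..d}" "n \<ge> 1"
  shows "pos_pow (Alg d) (mon \<one> [a]) n = mon \<one> (replicate n a)"
  using assms(2)
proof (induction n rule: dec_induct)
  case base
  then show ?case by (simp add: pos_pow_1)
next
  case (step n)
  then obtain m where m: "n = Suc m" by (cases n) auto
  have "pos_pow (Alg d) (mon \<one> [a]) (Suc n) = mon \<one> (replicate n a) \<otimes>\<^bsub>Alg d\<^esub> mon \<one> [a]"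
    using step.IH pos_pow_Suc[of "Alg d" "mon \<one> [a]" m] by (simp add: m)
  also have "\<dots> = mon (\<one> \<otimes> \<one>) (replicate n a @ [a])"
    using assms(1) step.hyps by (intro mon_mult) (auto simp: free_semigroup_def)
  finally show ?case by (simp add: replicate_append_same)
qed

lemma power_word_in_nil_ideal:
  assumes "n \<ge> 1" "n \<le> e" "a \<in> {1..d}" "set p \<subseteq> {1..d}" "set q \<subseteq> {1..d}"
  shows "mon \<one> (p @ replicate e a @ q) \<in> nil_ideal R n d"
proof -
  have a: "[a] \<in> free_semigroup d" "replicate n a \<in> free_semigroup d"
    using assms by (auto simp: free_semigroup_def)
  have "mon \<one> (replicate n a) \<in> nil_ideal R n d"
    using pos_pow_in_nil_ideal[OF mon_closed[OF one_closed a(1)], of n] pos_pow_mon[OF assms(3,1)] by simp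
  then have "lin d (\<lambda>w. p @ w @ replicate (e - n) a @ q) (mon \<one> (replicate n a)) \<in> nil_ideal R n d"
    using assms by (intro nil_ideal_shift) auto
  also have "lin d (\<lambda>w. p @ w @ replicate (e - n) a @ q) (mon \<one> (replicate n a)) =
      mon \<one> (p @ replicate n a @ replicate (e - n) a @ q)"
    using assms by (intro lin_mon[OF one_closed a(2)]) (auto simp: free_semigroup_def subset_iff)
  also have "replicate n a @ replicate (e - n) a @ q = replicate e a @ q"
    using assms(2) by (simp flip: append_assoc replicate_add)
  finally show ?thesis .
qed

text \<open>A pair of letter and run length \<open>j\<close> occurring too often is rewritten into
  words with larger \<open>run_sq\<close>. The assumption \<open>small\<close> packages what is
  taken from large characteristic: some product of \<open>c\<close> distinct letters vanishes, where
  \<open>c\<close> may fall short of \<open>k^2\<close> and further letters may be present.\<close>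

lemma long_word_in_nil_ideal:
  assumes inf: "infinite (carrier R)" and n: "n \<ge> 1"
    and small: "\<And>k. 1 \<le> k \<Longrightarrow> 2 * k \<le> n \<Longrightarrow>
      \<exists>c D. 1 \<le> c \<and> c \<le> k ^ 2 \<and> c \<le> D \<and> mon \<one> [1..<Suc c] \<in> nil_ideal R k D"
    and w: "w \<in> free_semigroup d" "d * (\<Sum>j\<in>{1..<n}. j * (n div Suc j) ^ 2) < length w"
  shows "mon \<one> w \<in> nil_ideal R n d"
  using w
\<comment> \<open>The length never changes while \<open>run_sq\<close> grows, and
  \<open>run_sq_le\<close> guarantees that the truncated difference really decreases.\<close>
proof (induction "length w ^ 2 - run_sq w" arbitrary: w rule: less_induct)
  case less
  obtain rs where rs: "w = expand rs" "\<forall>x\<in>set rs. 1 \<le> snd x" "distinct_adj (map fst rs)"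
    "run_sq w = (\<Sum>x\<leftarrow>rs. snd x ^ 2)" by (rule run_lengths[of w])
  have letters: "a \<in> {1..d}" if "(a, e) \<in> set rs" for a e
  proof -
    have "1 \<le> e" using that rs(2) by fastforce
    then have "(a, e) \<in> {x \<in> set rs. 1 \<le> snd x}" using that by simp
    then have "a \<in> set w" unfolding rs(1) set_expand by (metis fst_conv image_eqI)
    then show ?thesis using less.prems(1) unfolding free_semigroup_def by blast
  qed
  have exp: "set (expand rs') \<subseteq> {1..d}" if "set rs' \<subseteq> set rs" for rs'
    using that letters unfolding set_expand by auto
  show ?case
  proof (cases "\<exists>(a, e)\<in>set rs. n \<le> e")
    case True
    then obtain a e where ae: "(a, e) \<in> set rs" "n \<le> e" by blast
    then obtain P Q where PQ: "rs = P @ (a, e) # Q" by (meson split_list)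
    then have "set P \<subseteq> set rs" "set Q \<subseteq> set rs" by auto
    from power_word_in_nil_ideal[OF n ae(2) letters[OF ae(1)] exp[OF this(1)] exp[OF this(2)]]
    show ?thesis by (simp add: rs(1) PQ)
  next
    case False
    \<comment> \<open>Pigeonhole: if every letter had at most \<open>(n div Suc j)^2\<close> runs of
      each length \<open>j < n\<close>, the word would be too short.\<close>
    have "\<exists>a j. a \<in> {1..d} \<and> 1 \<le> j \<and> j < n \<and> (n div Suc j) ^ 2 < count_list rs (a, j)"
    proof (rule ccontr)
      assume *: "\<not> ?thesis"
      have "length (expand rs) \<le> d * (\<Sum>j\<in>{1..<n}. j * (n div Suc j) ^ 2)"
      proof (rule length_le_by_counts)
        show "a \<in> {1..d} \<and> 1 \<le> e \<and> e < n" if "(a, e) \<in> set rs" for a e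
          using letters[OF that] bspec[OF rs(2) that] False that by (auto simp: not_le)
        show "count_list rs (a, e) \<le> (n div Suc e) ^ 2" if "a \<in> {1..d}" "1 \<le> e" "e < n" for a e
        proof (rule ccontr)
          assume "\<not> ?thesis"
          then have "(n div Suc e) ^ 2 < count_list rs (a, e)" by simp
          with * that show False by blast
        qed
      qed
      with less.prems(2) show False by (simp add: rs(1))
    qed
    then obtain a j where aj: "a \<in> {1..d}" "1 \<le> j" "j < n" "(n div Suc j) ^ 2 < count_list rs (a, j)"
      by blast
    define k where "k = n div Suc j"
    \<comment> \<open>\<open>k\<close> is positive because \<open>j < n\<close>; below,
      \<open>j \<ge> 1\<close> gives \<open>2 * k \<le> n\<close>. So the assumption
      \<open>small\<close> applies to \<open>k\<close>.\<close>
    have k1: "1 \<le> k" using aj(3) by (simp add: k_def div_greater_zero_iff Suc_le_eq)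
    have "k * 2 \<le> k * Suc j" using aj(2) by (intro mult_le_mono) auto
    also have "\<dots> \<le> n" by (simp add: k_def div_times_less_eq_dividend del: mult_Suc_right)
    finally have k2: "2 * k \<le> n" by simp
    obtain c D where c: "1 \<le> c" "c \<le> k ^ 2" "c \<le> D" "mon \<one> [1..<Suc c] \<in> nil_ideal R k D"
      using small[OF k1 k2] by blast
    have "Suc c \<le> count_list rs (a, j)" using c(2) aj(4) by (simp add: k_def)
    then obtain P Us Q where Us: "length Us = c"
      and rs_eq: "rs = P @ (a, j) # concat (map (\<lambda>U. U @ [(a, j)]) Us) @ Q"
      by (rule split_occurrences)
    define us where "us = map expand Us"
    define p where "p = expand P"
    define q where "q = expand Q"
    \<comment> \<open>The default \<open>[a]\<close> is the value intended for \<open>Suc D\<close>,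
      which exceeds \<open>c\<close>; the letters between \<open>c\<close> and \<open>D\<close>
      receive it too, but do not occur in the component that is used.\<close>
    define \<sigma> where "\<sigma> i = (if 1 \<le> i \<and> i \<le> c then us ! (i - 1) else [a])" for i
    have \<sigma>D: "\<sigma> (Suc D) = [a]" using c(3) by (simp add: \<sigma>_def)
    have map_\<sigma>: "map (\<lambda>i. g (\<sigma> i)) [1..<Suc c] = map g us" for g :: "nat list \<Rightarrow> 'c"
      by (rule nth_equalityI) (auto simp: \<sigma>_def us_def Us simp del: upt_Suc)
    have us: "u \<in> free_semigroup d" if mem: "u \<in> set us" for u
    proof -
      obtain U where U: "U \<in> set Us" "u = expand U" using mem by (auto simp: us_def)
      have "U \<noteq> []"
        by (rule split_occurrences_nonempty[OF rs(3)[unfolded rs_eq] U(1)])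
      moreover have sub: "set U \<subseteq> set rs" using U(1) by (auto simp: rs_eq)
      ultimately have "u \<noteq> []" using rs(2) U(2) by (cases U) (auto simp: expand_def)
      then show ?thesis using exp[OF sub] by (simp add: U(2) free_semigroup_def)
    qed
    have pq: "set p \<subseteq> {1..d}" "set q \<subseteq> {1..d}" unfolding p_def q_def by (rule exp; auto simp: rs_eq)+
    have \<sigma>: "\<sigma> \<in> {1..Suc D} \<rightarrow> free_semigroup d"
    proof
      fix i
      show "\<sigma> i \<in> free_semigroup d"
      proof (cases "1 \<le> i \<and> i \<le> c")
        case True
        then have "us ! (i - 1) \<in> set us" by (intro nth_mem) (auto simp: us_def Us)
        with True us show ?thesis by (simp add: \<sigma>_def)
      next
        case False
        then show ?thesis using aj(1) by (auto simp: \<sigma>_def free_semigroup_def)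
      qed
    qed
    have "concat (map \<sigma> (pad j D [1..<Suc c])) = replicate j a @ concat (map (\<lambda>i. \<sigma> i @ replicate j a) [1..<Suc c])"
    proof -
      have "concat (map \<sigma> (replicate j (Suc D))) = replicate j a"
        by (induction j) (auto simp: \<sigma>D)
      moreover have "concat (map \<sigma> (concat (map (\<lambda>i. i # replicate j (Suc D)) v))) =
          concat (map (\<lambda>i. \<sigma> i @ replicate j a) v)" for v
        using calculation by (induction v) auto
      ultimately show ?thesis unfolding pad_def by (simp only: map_append concat_append)
    qed
    also have "concat (map (\<lambda>i. \<sigma> i @ replicate j a) [1..<Suc c]) = concat (map (\<lambda>u. u @ replicate j a) us)"
      using map_\<sigma>[of "\<lambda>u. u @ replicate j a"] by simp
    also have "\<dots> = expand (concat (map (\<lambda>U. U @ [(a, j)]) Us))"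
      unfolding us_def by (induction Us) auto
    finally have weq: "w = p @ concat (map \<sigma> (pad j D [1..<Suc c])) @ q"
      by (simp add: rs(1) rs_eq p_def q_def)
    \<comment> \<open>The \<open>Suc c\<close> selected runs contribute \<open>j^2\<close> each; the
      remaining ones are distributed over the flanks and the gaps.\<close>
    have "run_sq w = (\<Sum>x\<leftarrow>P. snd x ^ 2) + j ^ 2 * Suc c + (\<Sum>U\<leftarrow>Us. \<Sum>x\<leftarrow>U. snd x ^ 2) + (\<Sum>x\<leftarrow>Q. snd x ^ 2)"
    proof -
      have "(\<Sum>x\<leftarrow>concat (map (\<lambda>U. U @ [(a, j)]) Us). snd x ^ 2) =
          j ^ 2 * length Us + (\<Sum>U\<leftarrow>Us. \<Sum>x\<leftarrow>U. snd x ^ 2)"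
        by (induction Us) auto
      then show ?thesis unfolding rs(4) unfolding rs_eq by (simp add: Us)
    qed
    also have "\<dots> \<le> run_sq p + j ^ 2 * Suc c + (\<Sum>u\<leftarrow>us. run_sq u) + run_sq q"
    proof -
      have "(\<Sum>U\<leftarrow>Us. \<Sum>x\<leftarrow>U. snd x ^ 2) \<le> (\<Sum>U\<leftarrow>Us. run_sq (expand U))"
        by (rule sum_list_mono) (rule sum_sq_le_run_sq)
      then show ?thesis
        using sum_sq_le_run_sq[of P] sum_sq_le_run_sq[of Q]
        by (simp add: p_def q_def us_def comp_def)
    qed
    finally have sq_w: "run_sq w \<le> run_sq p + j ^ 2 * Suc c + (\<Sum>u\<leftarrow>us. run_sq u) + run_sq q" .
    have "mon \<one> (p @ concat (map \<sigma> (pad j D [1..<Suc c])) @ q) \<in> nil_ideal R n d"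
    proof (rule pad_word_in_nil_ideal[OF inf k_def k1 c(1,3,4) \<sigma> pq])
      fix z assume z: "z \<in> free_semigroup (Suc D)" "uneven j D z"
        "mset (filter (\<lambda>x. x \<noteq> Suc D) z) = mset [1..<Suc c]"
      let ?f = "filter (\<lambda>x. x \<noteq> Suc D) z" and ?z = "p @ concat (map \<sigma> z) @ q"
      \<comment> \<open>The letters of \<open>z\<close> other than \<open>Suc D\<close> are a
        permutation of \<open>1, ..., c\<close>, so any sum over the substituted words is unchanged.
        This is applied to \<open>length\<close> and to \<open>run_sq\<close>.\<close>
      have sum: "(\<Sum>b\<leftarrow>?f. g (\<sigma> b)) = (\<Sum>u\<leftarrow>us. g u)" for g :: "nat list \<Rightarrow> nat"
      proof -
        have "(\<Sum>b\<leftarrow>?f. g (\<sigma> b)) = (\<Sum>b\<in>#mset ?f. g (\<sigma> b))"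
          by (simp only: sum_mset_sum_list flip: mset_map)
        also have "\<dots> = (\<Sum>b\<leftarrow>[1..<Suc c]. g (\<sigma> b))"
          by (simp only: z(3) sum_mset_sum_list flip: mset_map)
        finally show ?thesis by (simp only: map_\<sigma>[of g])
      qed
      have lf: "length ?f = c" using mset_eq_length[OF z(3)] by (simp del: upt_Suc)
      have len: "length (concat (map \<sigma> v)) = count_list v (Suc D) + (\<Sum>b\<leftarrow>filter (\<lambda>x. x \<noteq> Suc D) v. length (\<sigma> b))" for v
        using sum_list_filter_split[of "\<lambda>b. length (\<sigma> b)" v "Suc D"] by (simp add: length_concat comp_def \<sigma>D)
      have "filter (\<lambda>x. x \<noteq> Suc D) (pad j D [1..<Suc c]) = [1..<Suc c]"
        "count_list (pad j D [1..<Suc c]) (Suc D) = j * Suc c"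
      proof -
        have "Suc D \<notin> set [1..<Suc c]" using c(3) by simp
        moreover have "pad j D [1..<Suc c] = replicate j (Suc D) @ rpad j D [1..<Suc c]"
          by (simp only: pad_def rpad_def)
        moreover have "count_list (replicate j (Suc D)) (Suc D) = j" by (induction j) auto
        ultimately show "filter (\<lambda>x. x \<noteq> Suc D) (pad j D [1..<Suc c]) = [1..<Suc c]"
          "count_list (pad j D [1..<Suc c]) (Suc D) = j * Suc c"
          using count_pad_parts(2,4)[of D "[1..<Suc c]" j] by (simp_all del: upt_Suc)
      qed
      then have "length (concat (map \<sigma> (pad j D [1..<Suc c]))) = j * Suc c + (\<Sum>u\<leftarrow>us. length u)"
        by (simp only: len map_\<sigma>[of length])
      \<comment> \<open>Unevenness prescribes \<open>j * Suc c\<close> letters \<open>a\<close>, the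
        same number as in the padded word.\<close>
      moreover have "length (concat (map \<sigma> z)) = j * Suc c + (\<Sum>u\<leftarrow>us. length u)"
        using z(2) by (simp only: len sum[of length] uneven_def lf)
      ultimately have len_eq: "length ?z = length w"
        unfolding weq by (simp only: length_append)
      have "run_sq w < run_sq ?z"
      proof -
        have "(\<Sum>u\<leftarrow>us. run_sq u) + j ^ 2 * Suc c < run_sq (concat (map \<sigma> z))"
          using run_sq_uneven[of \<sigma> D a j z, OF \<sigma>D z(2)] unfolding sum[of run_sq] lf .
        moreover have "run_sq p + (run_sq (concat (map \<sigma> z)) + run_sq q) \<le> run_sq ?z"
          using run_sq_append[of p "concat (map \<sigma> z) @ q"] run_sq_append[of "concat (map \<sigma> z)" q] by simp
        ultimately show ?thesis using sq_w by simp
      qed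
      moreover have "run_sq ?z \<le> length ?z ^ 2" by (rule run_sq_le)
      ultimately have decr: "length ?z ^ 2 - run_sq ?z < length w ^ 2 - run_sq w"
        unfolding len_eq by (intro diff_less_mono2) simp_all
      have zd: "?z \<in> free_semigroup d"
        using subst_funcset[OF \<sigma> pq] z(1) by (rule funcset_mem)
      show "mon \<one> ?z \<in> nil_ideal R n d"
        by (rule less.hyps[OF decr zd]) (simp only: len_eq less.prems(2))
    qed
    then show ?thesis unfolding weq .
  qed
qed

section \<open>The nilpotency degree\<close>

lemma abelian_subgroup_nil_ideal:
  assumes "n \<ge> 1"
  shows "abelian_subgroup (nil_ideal R n d) (Alg d)"
  by (rule abelian_subgroupI3)
     (auto intro: additive_subgroup.intro submodule.axioms(1)[OF nil_ideal_submodule[OF assms]]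
       A.M.abelian_group_axioms)

text \<open>The product of cosets is a union over all pairs of representatives. It is computed
  directly from the absorption property, since the theory of ring ideals presupposes a unit.\<close>

lemma coset_mult:
  assumes n: "n \<ge> 1" and f: "f \<in> carrier (Alg d)" and g: "g \<in> carrier (Alg d)"
  shows "(nil_ideal R n d +>\<^bsub>Alg d\<^esub> f) \<otimes>\<^bsub>Alg d Quot nil_ideal R n d\<^esub> (nil_ideal R n d +>\<^bsub>Alg d\<^esub> g) =
    nil_ideal R n d +>\<^bsub>Alg d\<^esub> (f \<otimes>\<^bsub>Alg d\<^esub> g)"
proof -
  let ?I = "nil_ideal R n d"
  interpret I: abelian_subgroup ?I "Alg d" by (rule abelian_subgroup_nil_ideal[OF n])
  note sub = submodule_AlgE[OF nil_ideal_submodule[OF n, of d]]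
  have "?I +>\<^bsub>Alg d\<^esub> (a \<otimes>\<^bsub>Alg d\<^esub> b) = ?I +>\<^bsub>Alg d\<^esub> (f \<otimes>\<^bsub>Alg d\<^esub> g)"
    if a: "a \<in> ?I +>\<^bsub>Alg d\<^esub> f" and b: "b \<in> ?I +>\<^bsub>Alg d\<^esub> g" for a b
  proof -
    obtain h h' where h: "a = h \<oplus>\<^bsub>Alg d\<^esub> f" "h \<in> ?I" and h': "b = h' \<oplus>\<^bsub>Alg d\<^esub> g" "h' \<in> ?I"
      using a b by (auto simp: a_r_coset_def')
    have hc: "h \<in> carrier (Alg d)" "h' \<in> carrier (Alg d)" using h(2) h'(2) sub(1) by auto
    \<comment> \<open>The difference of \<open>a b\<close> and \<open>f g\<close> for
      \<open>a = h + f\<close> and \<open>b = h' + g\<close>.\<close>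
    let ?y = "h \<otimes>\<^bsub>Alg d\<^esub> b \<oplus>\<^bsub>Alg d\<^esub> f \<otimes>\<^bsub>Alg d\<^esub> h'"
    have bc: "b \<in> carrier (Alg d)" using hc g by (simp add: h')
    have y: "?y \<in> ?I" by (intro sub(3) nil_ideal_mult[OF n] h(2) h'(2) bc f)
    have "a \<otimes>\<^bsub>Alg d\<^esub> b = h \<otimes>\<^bsub>Alg d\<^esub> b \<oplus>\<^bsub>Alg d\<^esub> f \<otimes>\<^bsub>Alg d\<^esub> b"
      unfolding h(1) by (rule Alg_l_distr[OF hc(1) f bc])
    also have "f \<otimes>\<^bsub>Alg d\<^esub> b = f \<otimes>\<^bsub>Alg d\<^esub> h' \<oplus>\<^bsub>Alg d\<^esub> f \<otimes>\<^bsub>Alg d\<^esub> g"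
      unfolding h'(1) by (rule Alg_r_distr[OF hc(2) g f])
    also have "h \<otimes>\<^bsub>Alg d\<^esub> b \<oplus>\<^bsub>Alg d\<^esub> (f \<otimes>\<^bsub>Alg d\<^esub> h' \<oplus>\<^bsub>Alg d\<^esub> f \<otimes>\<^bsub>Alg d\<^esub> g) = ?y \<oplus>\<^bsub>Alg d\<^esub> f \<otimes>\<^bsub>Alg d\<^esub> g"
      by (rule A.M.a_assoc[symmetric]) (intro Alg_mult_closed hc f g bc)+
    finally have "a \<otimes>\<^bsub>Alg d\<^esub> b \<in> ?I +>\<^bsub>Alg d\<^esub> (f \<otimes>\<^bsub>Alg d\<^esub> g)"
      using y by (auto simp: a_r_coset_def')
    then show ?thesis
      using A.M.a_repr_independence[OF _ Alg_mult_closed[OF f g]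
        submodule.axioms(1)[OF nil_ideal_submodule[OF n]]] by simp
  qed
  then have "rcoset_mult (Alg d) ?I (?I +>\<^bsub>Alg d\<^esub> f) (?I +>\<^bsub>Alg d\<^esub> g) =
      (\<Union>a\<in>?I +>\<^bsub>Alg d\<^esub> f. \<Union>b\<in>?I +>\<^bsub>Alg d\<^esub> g. ?I +>\<^bsub>Alg d\<^esub> (f \<otimes>\<^bsub>Alg d\<^esub> g))"
    unfolding rcoset_mult_def by (intro SUP_cong refl)
  also have "\<dots> = ?I +>\<^bsub>Alg d\<^esub> (f \<otimes>\<^bsub>Alg d\<^esub> g)"
    \<comment> \<open>A union of a constant family equals that constant only over nonempty index
      sets; each coset contains its representative.\<close>
    using I.a_rcos_self[OF f] I.a_rcos_self[OF g] unfolding UN_constant by (metis empty_iff)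
  finally show ?thesis
    by (simp add: FactRing_def)
qed

lemma foldl_mult_closed:
  "f \<in> carrier (Alg d) \<Longrightarrow> set fs \<subseteq> carrier (Alg d) \<Longrightarrow> foldl (\<otimes>\<^bsub>Alg d\<^esub>) f fs \<in> carrier (Alg d)"
  by (induction fs arbitrary: f) (auto simp: Alg_mult_closed)

lemma nonempty_prod_closed:
  "fs \<noteq> [] \<Longrightarrow> set fs \<subseteq> carrier (Alg d) \<Longrightarrow> nonempty_prod (Alg d) fs \<in> carrier (Alg d)"
  by (cases fs) (auto simp: foldl_mult_closed)

lemma nonempty_prod_cosets:
  assumes n: "n \<ge> 1" and "fs \<noteq> []" "set fs \<subseteq> carrier (Alg d)"
  shows "nonempty_prod (Alg d Quot nil_ideal R n d) (map (\<lambda>f. nil_ideal R n d +>\<^bsub>Alg d\<^esub> f) fs) =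
    nil_ideal R n d +>\<^bsub>Alg d\<^esub> nonempty_prod (Alg d) fs"
proof -
  have "foldl (\<otimes>\<^bsub>Alg d Quot nil_ideal R n d\<^esub>) (nil_ideal R n d +>\<^bsub>Alg d\<^esub> f)
      (map (\<lambda>f. nil_ideal R n d +>\<^bsub>Alg d\<^esub> f) fs) = nil_ideal R n d +>\<^bsub>Alg d\<^esub> foldl (\<otimes>\<^bsub>Alg d\<^esub>) f fs"
    if "f \<in> carrier (Alg d)" "set fs \<subseteq> carrier (Alg d)" for f fs
    using that
  proof (induction fs arbitrary: f)
    case (Cons g fs)
    then show ?case by (simp add: coset_mult[OF n] Alg_mult_closed)
  qed simp
  with assms(2,3) show ?thesis by (cases fs) auto
qed

text \<open>Every element of the quotient is a coset, so lists of its elements lift to lists in the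
  free algebra, and a coset is zero exactly when its representative lies in the ideal.\<close>

lemma quotient_products_zero_iff:
  assumes n: "n \<ge> 1" and c: "c > 0"
  shows "(\<forall>as. length as = c \<and> set as \<subseteq> carrier (rel_free_nil_algebra R n d) \<longrightarrow>
      nonempty_prod (rel_free_nil_algebra R n d) as = \<zero>\<^bsub>rel_free_nil_algebra R n d\<^esub>) \<longleftrightarrow>
    (\<forall>fs. length fs = c \<and> set fs \<subseteq> carrier (Alg d) \<longrightarrow> nonempty_prod (Alg d) fs \<in> nil_ideal R n d)"
    (is "?L \<longleftrightarrow> ?R")
proof -
  let ?I = "nil_ideal R n d"
  interpret I: abelian_subgroup ?I "Alg d" by (rule abelian_subgroup_nil_ideal[OF n])
  have zero: "\<zero>\<^bsub>rel_free_nil_algebra R n d\<^esub> = ?I"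
    by (simp add: rel_free_nil_algebra_def FactRing_def)
  have carrier: "carrier (rel_free_nil_algebra R n d) = (\<lambda>f. ?I +>\<^bsub>Alg d\<^esub> f) ` carrier (Alg d)"
    by (auto simp: rel_free_nil_algebra_def FactRing_def A_RCOSETS_def')
  have iff: "nonempty_prod (rel_free_nil_algebra R n d) (map (\<lambda>f. ?I +>\<^bsub>Alg d\<^esub> f) fs) = ?I \<longleftrightarrow>
      nonempty_prod (Alg d) fs \<in> ?I" if fs: "length fs = c" "set fs \<subseteq> carrier (Alg d)" for fs
  proof -
    have ne: "fs \<noteq> []" using fs c by auto
    note cl = nonempty_prod_closed[OF ne fs(2)]
    have "?I +>\<^bsub>Alg d\<^esub> nonempty_prod (Alg d) fs = ?I \<longleftrightarrow> nonempty_prod (Alg d) fs \<in> ?I"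
      using I.a_rcos_self[OF cl] I.a_rcos_const by auto
    then show ?thesis
      unfolding rel_free_nil_algebra_def nonempty_prod_cosets[OF n ne fs(2)] .
  qed
  show ?thesis
  proof
    assume L: ?L
    show ?R
    proof (intro allI impI)
      fix fs assume fs: "length fs = c \<and> set fs \<subseteq> carrier (Alg d)"
      then have "nonempty_prod (rel_free_nil_algebra R n d) (map (\<lambda>f. ?I +>\<^bsub>Alg d\<^esub> f) fs) = ?I"
        using L[rule_format, of "map (\<lambda>f. ?I +>\<^bsub>Alg d\<^esub> f) fs"] by (auto simp: carrier zero)
      with iff fs show "nonempty_prod (Alg d) fs \<in> ?I" by blast
    qed
  next
    assume R: ?R
    show ?L
    proof (intro allI impI)
      fix as assume as: "length as = c \<and> set as \<subseteq> carrier (rel_free_nil_algebra R n d)"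
      then have "as \<in> lists ((\<lambda>f. ?I +>\<^bsub>Alg d\<^esub> f) ` carrier (Alg d))" by (auto simp: carrier)
      then obtain fs where fs: "as = map (\<lambda>f. ?I +>\<^bsub>Alg d\<^esub> f) fs" "set fs \<subseteq> carrier (Alg d)"
        unfolding lists_image by auto
      with iff[of fs] as R show "nonempty_prod (rel_free_nil_algebra R n d) as = \<zero>\<^bsub>rel_free_nil_algebra R n d\<^esub>"
        by (simp add: zero)
    qed
  qed
qed

lemma C_deg_eq:
  assumes "n \<ge> 1"
  shows "C_deg R n d = Inf {enat c | c. c > 0 \<and> (\<forall>fs. length fs = c \<and> set fs \<subseteq> carrier (Alg d) \<longrightarrow>
    nonempty_prod (Alg d) fs \<in> nil_ideal R n d)}"
proof -
  have "{enat c | c. c > 0 \<and> (\<forall>as. length as = c \<and> set as \<subseteq> carrier (rel_free_nil_algebra R n d) \<longrightarrow>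
      nonempty_prod (rel_free_nil_algebra R n d) as = \<zero>\<^bsub>rel_free_nil_algebra R n d\<^esub>)} =
    {enat c | c. c > 0 \<and> (\<forall>fs. length fs = c \<and> set fs \<subseteq> carrier (Alg d) \<longrightarrow>
      nonempty_prod (Alg d) fs \<in> nil_ideal R n d)}"
    by (rule Collect_cong) (metis quotient_products_zero_iff[OF assms])
  then show ?thesis by (simp only: C_deg_def nilpotency_degree_def)
qed

lemma foldl_mon:
  assumes "u \<in> free_semigroup d" "set v \<subseteq> {1..d}"
  shows "foldl (\<otimes>\<^bsub>Alg d\<^esub>) (mon \<one> u) (map (\<lambda>i. mon \<one> [i]) v) = mon \<one> (u @ v)"
  using assms
proof (induction v arbitrary: u)
  case (Cons i v)
  then have "[i] \<in> free_semigroup d" by (auto simp: free_semigroup_def)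
  then have "mon \<one> u \<otimes>\<^bsub>Alg d\<^esub> mon \<one> [i] = mon \<one> (u @ [i])" "u @ [i] \<in> free_semigroup d"
    using Cons.prems by (auto simp: mon_mult intro: append_free_semigroup)
  with Cons show ?case by simp
qed simp

text \<open>The vanishing of all products of \<open>c\<close> factors is evaluated at the letters
  \<open>1, ..., c\<close>, which exist because \<open>m \<le> d\<close>.\<close>

lemma letters_in_nil_ideal:
  assumes n: "n \<ge> 1" and "C_deg R n d \<le> enat m" "1 \<le> m" "m \<le> d"
  obtains c where "1 \<le> c" "c \<le> m" "mon \<one> [1..<Suc c] \<in> nil_ideal R n d"
proof -
  let ?P = "\<lambda>c. c > 0 \<and> (\<forall>fs. length fs = c \<and> set fs \<subseteq> carrier (Alg d) \<longrightarrow>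
      nonempty_prod (Alg d) fs \<in> nil_ideal R n d)"
  \<comment> \<open>A bound on the infimum has to be turned into an actual length: if all admissible
    \<open>c\<close> exceeded \<open>m\<close>, then \<open>Suc m\<close> would be a lower bound of
    the set.\<close>
  have "\<exists>c. ?P c \<and> c \<le> m"
  proof (rule ccontr)
    assume *: "\<not> ?thesis"
    have "enat (Suc m) \<le> Inf {enat c | c. ?P c}"
    proof (rule Inf_greatest)
      fix x assume "x \<in> {enat c | c. ?P c}"
      then obtain c where "x = enat c" "?P c" by blast
      with * have "x = enat c" "\<not> c \<le> m" by blast+
      then show "enat (Suc m) \<le> x" by simp
    qed
    also have "\<dots> = C_deg R n d" by (rule C_deg_eq[OF n, symmetric])
    finally have "enat (Suc m) \<le> enat m" using assms(2) by (rule order_trans)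
    then show False by simp
  qed
  then obtain c where c: "?P c" "c \<le> m" by blast
  have lettersW: "[i] \<in> free_semigroup d" if "i \<in> set [1..<Suc c]" for i
    using that c(2) assms(4) by (auto simp: free_semigroup_def)
  then have "set (map (\<lambda>i. mon \<one> [i]) [1..<Suc c]) \<subseteq> carrier (Alg d)"
    unfolding set_map by (intro image_subsetI mon_closed one_closed)
  moreover have "length (map (\<lambda>i. mon \<one> [i]) [1..<Suc c]) = c"
    by (simp del: upt_Suc)
  ultimately have "nonempty_prod (Alg d) (map (\<lambda>i. mon \<one> [i]) [1..<Suc c]) \<in> nil_ideal R n d"
    using c(1) by blast
  moreover have upt: "[1..<Suc c] = 1 # [2..<Suc c]"
    using c(1) upt_conv_Cons[of 1 "Suc c"] by (simp add: numeral_2_eq_2 del: upt_Suc)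
  moreover have "foldl (\<otimes>\<^bsub>Alg d\<^esub>) (mon \<one> [1]) (map (\<lambda>i. mon \<one> [i]) [2..<Suc c]) = mon \<one> ([1] @ [2..<Suc c])"
    using c assms(4) by (intro foldl_mon) (auto simp: free_semigroup_def)
  ultimately have "mon \<one> [1..<Suc c] \<in> nil_ideal R n d"
    unfolding upt by (simp del: upt_Suc)
  with that[of c] c show thesis by (auto simp del: upt_Suc)
qed

text \<open>Without a unit every further factor contributes at least one letter.\<close>

lemma supp_prod_length:
  assumes "f \<in> carrier (Alg d)" "set fs \<subseteq> carrier (Alg d)" "\<And>w. w \<in> supp f \<Longrightarrow> m \<le> length w"
    "w \<in> supp (foldl (\<otimes>\<^bsub>Alg d\<^esub>) f fs)"
  shows "m + length fs \<le> length w"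
  using assms
proof (induction fs arbitrary: f m)
  case (Cons g fs)
  then have g: "g \<in> carrier (Alg d)" by simp
  have "Suc m \<le> length v" if v: "v \<in> supp (f \<otimes>\<^bsub>Alg d\<^esub> g)" for v
  proof -
    obtain x y where xy: "x \<in> supp f" "y \<in> supp g" "v = x @ y"
      by (rule supp_mult[OF Cons.prems(1) g v])
    then have "y \<noteq> []" using supp_subset[OF g] by (auto simp: free_semigroup_def)
    with xy Cons.prems(3)[OF xy(1)] show ?thesis by (cases y) auto
  qed
  with Cons.IH[OF Alg_mult_closed[OF Cons.prems(1) g], of "Suc m"] Cons.prems show ?case by simp
qed simp

text \<open>A product of this many elements is a combination of words that are at least as long; the
  \<open>Suc\<close> yields the strict inequality that \<open>long_word_in_nil_ideal\<close> asks
  for.\<close>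

lemma C_deg_le:
  assumes inf: "infinite (carrier R)" and n: "n \<ge> 1"
    and small: "\<And>k. 1 \<le> k \<Longrightarrow> 2 * k \<le> n \<Longrightarrow>
      \<exists>c D. 1 \<le> c \<and> c \<le> k ^ 2 \<and> c \<le> D \<and> mon \<one> [1..<Suc c] \<in> nil_ideal R k D"
  shows "C_deg R n d \<le> enat (Suc (d * (\<Sum>j\<in>{1..<n}. j * (n div Suc j) ^ 2)))"
proof -
  let ?b = "d * (\<Sum>j\<in>{1..<n}. j * (n div Suc j) ^ 2)"
  have "nonempty_prod (Alg d) fs \<in> nil_ideal R n d"
    if fs: "length fs = Suc ?b" "set fs \<subseteq> carrier (Alg d)" for fs
  proof -
    obtain f gs where fgs: "fs = f # gs" using fs(1) by (cases fs) auto
    then have f: "f \<in> carrier (Alg d)" and gs: "set gs \<subseteq> carrier (Alg d)" using fs(2) by auto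
    let ?g = "nonempty_prod (Alg d) fs"
    have g: "?g \<in> carrier (Alg d)" using foldl_mult_closed[OF f gs] by (simp add: fgs)
    have one: "1 \<le> length w" if "w \<in> supp f" for w
      using supp_subset[OF f] that by (cases w) (auto simp: free_semigroup_def)
    have long: "?b < length w" if "w \<in> supp ?g" for w
      using supp_prod_length[OF f gs one, of w] that fs(1) by (simp add: fgs)
    have "comb d (supp ?g) ?g (\<lambda>w. w) \<in> nil_ideal R n d"
      unfolding comb_def
    proof (rule submodule_finsum[OF module_Alg nil_ideal_submodule[OF n] finite_supp[OF g]], rule funcsetI)
      fix w assume w: "w \<in> supp ?g"
      then have "mon \<one> w \<in> nil_ideal R n d"
        using long_word_in_nil_ideal[OF inf n small _ long[OF w]] supp_subset[OF g] by blast
      from submodule_AlgE(4)[OF nil_ideal_submodule[OF n] Alg_closed[OF g, of w] this]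
      show "mon (?g w) w \<in> nil_ideal R n d"
        using Alg_closed[OF g, of w] by (simp only: smult_mon r_one)
    qed
    then show ?thesis by (simp only: comb_supp[OF g])
  qed
  then show ?thesis unfolding C_deg_eq[OF n] by (intro Inf_lower) blast
qed

text \<open>The multiples of the unit that vanish are those divisible by its additive order, and a
  field has no zero divisors.\<close>

lemma prime_ring_char:
  assumes "ring_char R \<ge> 1"
  shows "prime (ring_char R)"
proof -
  let ?p = "ring_char R"
  have ord: "([n] \<cdot> \<one> = \<zero>) \<longleftrightarrow> ?p dvd n" for n :: nat
    using add.pow_eq_id[of \<one> n] by (simp add: ring_char_def add_pow_def)
  show ?thesis
  proof (rule prime_natI)
    show "?p \<ge> 2"
    proof -
      have "?p \<noteq> 1" using ord[of 1] by auto
      with assms show ?thesis by linarith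
    qed
    fix m k :: nat assume "?p dvd m * k"
    then have "[(m * k)] \<cdot> \<one> = \<zero>" by (simp add: ord)
    moreover have "([m] \<cdot> \<one>) \<otimes> ([k] \<cdot> \<one>) = [(m * k)] \<cdot> \<one>"
      by (simp add: add_pow_ldistr add.nat_pow_pow mult.commute)
    ultimately have "[m] \<cdot> \<one> = \<zero> \<or> [k] \<cdot> \<one> = \<zero>"
      by (intro integral) auto
    then show "?p dvd m \<or> ?p dvd k" by (simp add: ord)
  qed
qed

end

section \<open>The logarithmic estimate and the conclusion\<close>

lemma sum_le_ln:
  assumes "n \<ge> 2"
  shows "(\<Sum>j\<in>{1..<n}. real j / real (Suc j) ^ 2) \<le> ln (real n) - 1 / 4"
  using assms
proof (induction n rule: dec_induct)
  case base
  \<comment> \<open>For \<open>n = 2\<close> the sum is \<open>1/4\<close>, so the crude bound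
    \<open>ln 2 \<ge> 1/2\<close> leaves exactly the slack \<open>1/4\<close>.\<close>
  have "ln (1 / 2) \<le> 1 / 2 - (1 :: real)" by (rule ln_le_minus_one) simp
  then have "ln 2 \<ge> (1 / 2 :: real)" by (simp add: ln_div)
  then show ?case by (simp add: numeral_2_eq_2)
next
  case (step n)
  \<comment> \<open>The new summand is compared with the increment of the logarithm through
    \<open>1 / (n + 1)\<close>, using \<open>ln x \<le> x - 1\<close> at
    \<open>x = n / (n + 1)\<close>.\<close>
  have "real n / real (Suc n) ^ 2 \<le> 1 / real (Suc n)"
    by (simp add: divide_simps power2_eq_square)
  also have "\<dots> \<le> ln (real (Suc n)) - ln (real n)"
  proof -
    have "ln (real n / real (Suc n)) \<le> real n / real (Suc n) - 1"
      using step.hyps by (intro ln_le_minus_one) simp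
    moreover have "real n / real (Suc n) - 1 = - (1 / real (Suc n))"
      by (simp add: divide_simps)
    moreover have "ln (real n / real (Suc n)) = ln (real n) - ln (real (Suc n))"
      using step.hyps by (simp add: ln_div del: of_nat_Suc)
    ultimately show ?thesis by linarith
  qed
  finally have "real n / real (Suc n) ^ 2 \<le> ln (real (Suc n)) - ln (real n)" .
  moreover have "{1..<Suc n} = insert n {1..<n}" using step.hyps by auto
  ultimately show ?case using step.IH by simp
qed

lemma degree_bound_less:
  assumes "n \<ge> 2" "d \<ge> 2"
  shows "real (Suc (d * (\<Sum>j\<in>{1..<n}. j * (n div Suc j) ^ 2))) < real n ^ 2 * ln (real n) * real d"
proof -
  have "real (\<Sum>j\<in>{1..<n}. j * (n div Suc j) ^ 2) \<le> (\<Sum>j\<in>{1..<n}. real n ^ 2 * (real j / real (Suc j) ^ 2))"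
    unfolding of_nat_sum
  proof (rule sum_mono)
    fix j
    have "real (n div Suc j) ^ 2 \<le> (real n / real (Suc j)) ^ 2"
      by (intro power_mono of_nat_div_le_of_nat) simp
    then have "real j * real (n div Suc j) ^ 2 \<le> real j * (real n / real (Suc j)) ^ 2"
      by (rule mult_left_mono) simp
    then show "real (j * (n div Suc j) ^ 2) \<le> real n ^ 2 * (real j / real (Suc j) ^ 2)"
      by (simp add: power_divide mult.commute)
  qed
  also have "\<dots> \<le> real n ^ 2 * (ln (real n) - 1 / 4)"
    unfolding sum_distrib_left[symmetric] by (intro mult_left_mono sum_le_ln[OF assms(1)]) simp
  finally have "real d * real (\<Sum>j\<in>{1..<n}. j * (n div Suc j) ^ 2) \<le> real d * (real n ^ 2 * (ln (real n) - 1 / 4))"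
    by (rule mult_left_mono) simp
  \<comment> \<open>The slack \<open>d * n^2 / 4\<close> is at least 2 and so outweighs the summand
    \<open>1\<close> that comes from \<open>Suc\<close>.\<close>
  moreover have "2 * 2 ^ 2 \<le> real d * real n ^ 2"
    using assms by (intro mult_mono power_mono) auto
  ultimately show ?thesis by (simp add: algebra_simps)
qed

theorem corollary4p7:
  assumes "\<And>(n::nat) (d::nat) (p::nat) (K :: 'a ring).
      n \<ge> 2 \<Longrightarrow> d \<ge> 2 \<Longrightarrow> prime p \<Longrightarrow> p > n \<Longrightarrow>
      field K \<Longrightarrow> infinite (carrier K) \<Longrightarrow> ring_char K = p \<Longrightarrow>
      C_deg K n d \<le> enat (n ^ 2)"
  shows "\<And>(n::nat) (d::nat) (p::nat) (F :: 'a ring).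
      n \<ge> 2 \<Longrightarrow> d \<ge> 2 \<Longrightarrow>
      field F \<Longrightarrow> infinite (carrier F) \<Longrightarrow> ring_char F = p \<Longrightarrow>
      real n / 2 < real p \<Longrightarrow> p \<le> n \<Longrightarrow>
      ereal_of_enat (C_deg F n d) < ereal (real n ^ 2 * ln (real n) * real d)"
proof -
  fix n d p :: nat and F :: "'a ring"
  assume n: "n \<ge> 2" and d: "d \<ge> 2" and F: "field F" and inf: "infinite (carrier F)"
    and p: "ring_char F = p" "real n / 2 < real p"
  interpret field F by (rule F)
  \<comment> \<open>Gives \<open>p > 0\<close>, hence primality of the characteristic, and
    \<open>k < p\<close> whenever \<open>2 * k \<le> n\<close>.\<close>
  have np: "n < 2 * p" using p(2) by linarith
  then have "prime p" using prime_ring_char p(1) n by auto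
  have small: "\<exists>c D. 1 \<le> c \<and> c \<le> k ^ 2 \<and> c \<le> D \<and> mon \<one>\<^bsub>F\<^esub> [1..<Suc c] \<in> nil_ideal F k D"
    if k: "1 \<le> k" "2 * k \<le> n" for k
  proof (cases "k = 1")
    case True
    \<comment> \<open>The hypothesis starts at exponent 2; for exponent 1 every element is a first
      power and lies in the nil ideal.\<close>
    have "mon \<one>\<^bsub>F\<^esub> [1] \<in> nil_ideal F 1 1"
      using pos_pow_in_nil_ideal[of "mon \<one>\<^bsub>F\<^esub> [1]" 1 1] mon_closed[of "\<one>\<^bsub>F\<^esub>" "[1]" 1]
      by (simp add: pos_pow_1 free_semigroup_def)
    with True show ?thesis by (intro exI[of _ 1]) simp
  next
    case False
    \<comment> \<open>At least two letters for the hypothesis, and at least \<open>k^2\<close> so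
      that a product of up to \<open>k^2\<close> distinct letters can be formed.\<close>
    let ?D = "max 2 (k ^ 2)"
    have "C_deg F k ?D \<le> enat (k ^ 2)"
      using assms[OF _ _ \<open>prime p\<close> _ F inf p(1), of k ?D] k False np by auto
    then obtain c where "1 \<le> c" "c \<le> k ^ 2" "mon \<one>\<^bsub>F\<^esub> [1..<Suc c] \<in> nil_ideal F k ?D"
      using letters_in_nil_ideal[of k ?D "k ^ 2"] k by auto
    then show ?thesis by (intro exI[of _ c] exI[of _ ?D]) auto
  qed
  have "C_deg F n d \<le> enat (Suc (d * (\<Sum>j\<in>{1..<n}. j * (n div Suc j) ^ 2)))"
    by (rule C_deg_le[OF inf _ small]) (use n in auto)
  then have "ereal_of_enat (C_deg F n d) \<le> ereal_of_enat (enat (Suc (d * (\<Sum>j\<in>{1..<n}. j * (n div Suc j) ^ 2))))"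
    by (simp only: ereal_of_enat_le_iff)
  also have "\<dots> = ereal (real (Suc (d * (\<Sum>j\<in>{1..<n}. j * (n div Suc j) ^ 2))))" by simp
  also have "\<dots> < ereal (real n ^ 2 * ln (real n) * real d)"
    unfolding less_ereal.simps by (rule degree_bound_less[OF n d])
  finally show "ereal_of_enat (C_deg F n d) < ereal (real n ^ 2 * ln (real n) * real d)" .
qed

end
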